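(* In $\mathcal M=(M;S;g_{1/n}:n\in\mathbb N\setminus\{0\})$, the first homology group $H_1(p_0)$ of the unique strong $1$-type $p_0=\{x=x\}$ over $\emptyset$ is isomorphic to $\mathbb R/\mathbb Z$.
   Context: **The structure.** $M$ is a saturated circle (i.e. $\mathcal M$ is a saturated model of the theory of the unit circle with the following structure); $S$ is a ternary relation such that $S(a,b,c)$ holds iff $a,b,c$ are distinct and $b$ comes before $c$ going around the circle clockwise starting at $a$; for each $n\in\mathbb N\setminus\{0\}$, $g_{1/n}$ is a unary function, the clockwise rotation by $2\pi/n$ radians. There is only one strong $1$-type over $\emptyset$, $p_0(x)=\{x=x\}$, and $\mathrm{acl}(a)=\mathrm{dcl}(a)$ for $a\models p_0$. **First homology group.** Work in the monster model $\mathcal M=\mathcal M^{\mathrm{eq}}$, with $B=\mathrm{acl}(\emptyset)$ named. Fix an automorphism-invariant ternary relation $A\perp^*_C D$ between small sets satisfying: (finite character) $A\perp^*_CD$ iff $a\perp^*_Cd$ for all finite tuples $a\in A$, $d\in D$; (normality) $A\perp^*_CD$ implies $A\perp^*_C\mathrm{acl}(DC)$; (symmetry) $A\perp^*_CD$ iff $D\perp^*_CA$; (transitivity) for $E\subseteq C\subseteq D$, $A\perp^*_ED$ iff $A\perp^*_EC$ and $A\perp^*_CD$; (extension) for $E\subseteq C$ there is $A'\equiv_E A$ with $A'\perp^*_EC$. Examples are thorn-independence and the trivial relation (always true); $H_1$ below does not depend on the choice. A family is $*$-independent over $C$ if each member is $*$-independent over $C$ from the union of the others. For a finite $s\subset\omega$,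 $\mathcal P(s)$ is a category with one morphism $u\to v$ when $u\subseteq v$ and none otherwise. $\mathcal C$ is the category of small subsets of $\mathcal M$ containing $B$, with elementary maps over $B$ as morphisms. For a functor $f$ write $f^u_v:f(u)\to f(v)$ for the image of $u\to v$, and $f^u_v(u)$ for the set $f^u_v[f(u)]$. An $n$-simplex of $p_0$ is a functor $f:\mathcal P(s)\to\mathcal C$ with $|s|=n+1$ such that $f(\emptyset)=B$, each $f(\{i\})$ is of the form $\mathrm{acl}(b)$ with $b\models p_0$, and for nonempty $u\subseteq s$, $f(u)=\mathrm{acl}(\bigcup_{i\in u}f^{\{i\}}_u(\{i\}))$ and $\{f^{\{i\}}_u(\{i\}): i\in u\}$ is $*$-independent over $B$. $C_n$ is the free abelian group on $n$-simplices. For $s=\{s_0<\dots<s_n\}$ put $\partial^i f=f\restriction\mathcal P(s\setminus\{s_i\})$, $\partial f=\sum_{i}(-1)^i\partial^i f$ (extended linearly), and $H_1(p_0)=\ker\partial_1/\mathrm{Im}\,\partial_2$. *)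

theory Defs
  imports
    Complex_Main
    "HOL-Library.FuncSet"
    "HOL-Library.Equipollence"
    "HOL-Algebra.Free_Abelian_Groups"
begin

section \<open>The language of the circle, its structures, and saturation\<close>

text \<open>
  The symbol \<open>Rot n\<close> stands for the function symbol written $g_{1/(n+1)}$, so that all and only the
  functions $g_{1/m}$ with $m > 0$ are present.
\<close>

datatype tm = Var nat | Rot nat tm

datatype fm =
    FEq tm tm
  | FS tm tm tm
  | FNot fm
  | FAnd fm fm
  | FEx nat fm

record 'a circ_struct =
  points :: "'a set"
  circ :: "'a \<Rightarrow> 'a \<Rightarrow> 'a \<Rightarrow> bool"
  rot :: "nat \<Rightarrow> 'a \<Rightarrow> 'a"

definition is_circ_struct :: "'a circ_struct \<Rightarrow> bool" where
  "is_circ_struct M \<longleftrightarrow> points M \<noteq> {} \<and> (\<forall>n. \<forall>x\<in>points M. rot M n x \<in> points M)"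

primrec tm_val :: "'a circ_struct \<Rightarrow> (nat \<Rightarrow> 'a) \<Rightarrow> tm \<Rightarrow> 'a" where
  "tm_val M v (Var i) = v i"
| "tm_val M v (Rot n t) = rot M n (tm_val M v t)"

primrec sat :: "'a circ_struct \<Rightarrow> (nat \<Rightarrow> 'a) \<Rightarrow> fm \<Rightarrow> bool" where
  "sat M v (FEq t u) \<longleftrightarrow> tm_val M v t = tm_val M v u"
| "sat M v (FS t u w) \<longleftrightarrow> circ M (tm_val M v t) (tm_val M v u) (tm_val M v w)"
| "sat M v (FNot \<phi>) \<longleftrightarrow> \<not> sat M v \<phi>"
| "sat M v (FAnd \<phi> \<psi>) \<longleftrightarrow> sat M v \<phi> \<and> sat M v \<psi>"
| "sat M v (FEx i \<phi>) \<longleftrightarrow> (\<exists>x\<in>points M. sat M (v(i := x)) \<phi>)"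

primrec tm_vars :: "tm \<Rightarrow> nat set" where
  "tm_vars (Var i) = {i}"
| "tm_vars (Rot n t) = tm_vars t"

primrec fv :: "fm \<Rightarrow> nat set" where
  "fv (FEq t u) = tm_vars t \<union> tm_vars u"
| "fv (FS t u w) = tm_vars t \<union> tm_vars u \<union> tm_vars w"
| "fv (FNot \<phi>) = fv \<phi>"
| "fv (FAnd \<phi> \<psi>) = fv \<phi> \<union> fv \<psi>"
| "fv (FEx i \<phi>) = fv \<phi> - {i}"

definition theory_of :: "'a circ_struct \<Rightarrow> fm set" where
  "theory_of M = {\<phi>. fv \<phi> = {} \<and> (\<forall>v. range v \<subseteq> points M \<longrightarrow> sat M v \<phi>)}"

definition is_model :: "'a circ_struct \<Rightarrow> fm set \<Rightarrow> bool" where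
  "is_model M T \<longleftrightarrow> is_circ_struct M \<and> (\<forall>\<phi>\<in>T. \<forall>v. range v \<subseteq> points M \<longrightarrow> sat M v \<phi>)"

text \<open>
  On the unit circle the point at clockwise angle $\theta$ from \<open>a\<close> is \<open>a * cis (- \<theta>)\<close>. The strict
  inequalities below force \<open>a\<close>, \<open>b\<close>, \<open>c\<close> to be distinct.
\<close>

definition unit_circle :: "complex circ_struct" where
  "unit_circle =
    \<lparr> points = {z. cmod z = 1},
      circ = (\<lambda>a b c. \<exists>\<beta> \<gamma>. 0 < \<beta> \<and> \<beta> < \<gamma> \<and> \<gamma> < 2 * pi \<and> b = a * cis (- \<beta>) \<and> c = a * cis (- \<gamma>)),
      rot = (\<lambda>n z. z * cis (- (2 * pi / real (Suc n)))) \<rparr>"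

text \<open>
  A formula in the free variable 0 with parameters is a pair \<open>(\<phi>, v)\<close>, where \<open>v\<close> interprets the
  remaining free variables; the value \<open>v 0\<close> is irrelevant.
\<close>

definition param_formulas :: "'a set \<Rightarrow> (fm \<times> (nat \<Rightarrow> 'a)) set" where
  "param_formulas A = {(\<phi>, v). \<forall>i\<in>fv \<phi> - {0}. v i \<in> A}"

definition realized :: "'a circ_struct \<Rightarrow> (fm \<times> (nat \<Rightarrow> 'a)) set \<Rightarrow> bool" where
  "realized M \<Gamma> \<longleftrightarrow> (\<exists>x\<in>points M. \<forall>(\<phi>, v)\<in>\<Gamma>. sat M (v(0 := x)) \<phi>)"

definition saturated :: "'a circ_struct \<Rightarrow> bool" where
  "saturated M \<longleftrightarrow>
    (\<forall>A \<Gamma>. A \<subseteq> points M \<and> A \<prec> points M \<and> \<Gamma> \<subseteq> param_formulas A \<and>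
       (\<forall>\<Gamma>'. finite \<Gamma>' \<and> \<Gamma>' \<subseteq> \<Gamma> \<longrightarrow> realized M \<Gamma>') \<longrightarrow> realized M \<Gamma>)"

section \<open>Imaginaries\<close>

text \<open>
  The imaginary sort \<open>Imag_sort n \<phi>\<close> is the quotient of the \<open>n\<close>-tuples by the equivalence relation
  that \<open>\<phi>\<close> defines, with \<open>n\<close>-tuples of variables \<open>0..<n\<close> and \<open>n..<2n\<close>. If \<open>\<phi>\<close> does not define an
  equivalence relation on \<open>n\<close>-tuples without parameters, the sort is empty.
\<close>

datatype srt = Home_sort | Imag_sort nat fm

datatype 'a meq = Home 'a | Imag nat fm "'a list set"

definition tuples :: "'a circ_struct \<Rightarrow> nat \<Rightarrow> 'a list set" where
  "tuples M n = {xs. length xs = n \<and> set xs \<subseteq> points M}"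

definition imag_rel :: "'a circ_struct \<Rightarrow> nat \<Rightarrow> fm \<Rightarrow> ('a list \<times> 'a list) set" where
  "imag_rel M n \<phi> = {(xs, ys). xs \<in> tuples M n \<and> ys \<in> tuples M n \<and> sat M (\<lambda>i. (xs @ ys) ! i) \<phi>}"

primrec sort_set :: "'a circ_struct \<Rightarrow> srt \<Rightarrow> 'a meq set" where
  "sort_set M Home_sort = Home ` points M"
| "sort_set M (Imag_sort n \<phi>) =
    (if 0 < n \<and> fv \<phi> \<subseteq> {..<2 * n} \<and> equiv (tuples M n) (imag_rel M n \<phi>)
     then Imag n \<phi> ` (tuples M n // imag_rel M n \<phi>) else {})"

definition Meq :: "'a circ_struct \<Rightarrow> 'a meq set" where
  "Meq M = (\<Union>s. sort_set M s)"

text \<open>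
  Formulas of the many-sorted language of \<open>Meq\<close>. The functions, that is the rotations on the home
  sort and the projections from tuples to imaginary sorts, enter through their graphs; atomic
  formulas that are not well-sorted are false. The quantifier \<open>QEx s i\<close> ranges over the sort \<open>s\<close>.
\<close>

datatype qfm =
    QEq nat nat
  | QS nat nat nat
  | QRot nat nat nat
  | QProj nat fm "nat list" nat
  | QNot qfm
  | QAnd qfm qfm
  | QEx srt nat qfm

primrec qsat :: "'a circ_struct \<Rightarrow> (nat \<Rightarrow> 'a meq) \<Rightarrow> qfm \<Rightarrow> bool" where
  "qsat M v (QEq i j) \<longleftrightarrow> v i = v j"
| "qsat M v (QS i j k) \<longleftrightarrow>
    (\<exists>a\<in>points M. \<exists>b\<in>points M. \<exists>c\<in>points M.
       v i = Home a \<and> v j = Home b \<and> v k = Home c \<and> circ M a b c)"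
| "qsat M v (QRot n i j) \<longleftrightarrow> (\<exists>a\<in>points M. v i = Home a \<and> v j = Home (rot M n a))"
| "qsat M v (QProj n \<phi> is j) \<longleftrightarrow>
    v j \<in> sort_set M (Imag_sort n \<phi>) \<and>
    (\<exists>xs\<in>tuples M n. map v is = map Home xs \<and> v j = Imag n \<phi> (imag_rel M n \<phi> `` {xs}))"
| "qsat M v (QNot \<psi>) \<longleftrightarrow> \<not> qsat M v \<psi>"
| "qsat M v (QAnd \<psi> \<chi>) \<longleftrightarrow> qsat M v \<psi> \<and> qsat M v \<chi>"
| "qsat M v (QEx s i \<psi>) \<longleftrightarrow> (\<exists>x\<in>sort_set M s. qsat M (v(i := x)) \<psi>)"

primrec qfv :: "qfm \<Rightarrow> nat set" where
  "qfv (QEq i j) = {i, j}"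
| "qfv (QS i j k) = {i, j, k}"
| "qfv (QRot n i j) = {i, j}"
| "qfv (QProj n \<phi> is j) = insert j (set is)"
| "qfv (QNot \<psi>) = qfv \<psi>"
| "qfv (QAnd \<psi> \<chi>) = qfv \<psi> \<union> qfv \<chi>"
| "qfv (QEx s i \<psi>) = qfv \<psi> - {i}"

definition acl :: "'a circ_struct \<Rightarrow> 'a meq set \<Rightarrow> 'a meq set" where
  "acl M A = {c. \<exists>s \<psi> v. c \<in> sort_set M s \<and> (\<forall>i\<in>qfv \<psi> - {0}. v i \<in> A) \<and>
     qsat M (v(0 := c)) \<psi> \<and> finite {x \<in> sort_set M s. qsat M (v(0 := x)) \<psi>}}"

abbreviation acl_empty :: "'a circ_struct \<Rightarrow> 'a meq set" where
  "acl_empty M \<equiv> acl M {}"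

definition small :: "'a circ_struct \<Rightarrow> 'a meq set \<Rightarrow> bool" where
  "small M A \<longleftrightarrow> A \<subseteq> Meq M \<and> A \<prec> points M"

definition elementary_on :: "'a circ_struct \<Rightarrow> 'a meq set \<Rightarrow> ('a meq \<Rightarrow> 'a meq) \<Rightarrow> bool" where
  "elementary_on M A h \<longleftrightarrow>
    (\<forall>\<psi> v. (\<forall>i\<in>qfv \<psi>. v i \<in> A) \<longrightarrow> (qsat M v \<psi> \<longleftrightarrow> qsat M (\<lambda>i. h (v i)) \<psi>))"

text \<open>\<open>A' \<equiv>\<^sub>E A\<close>, in the language in which the elements of \<open>acl_empty M\<close> are named.\<close>

definition conj_over :: "'a circ_struct \<Rightarrow> 'a meq set \<Rightarrow> 'a meq set \<Rightarrow> 'a meq set \<Rightarrow> bool" where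
  "conj_over M E A A' \<longleftrightarrow>
    (\<exists>h. elementary_on M (A \<union> E \<union> acl_empty M) h \<and> (\<forall>e\<in>E \<union> acl_empty M. h e = e) \<and> h ` A = A')"

definition automorphism :: "'a circ_struct \<Rightarrow> ('a \<Rightarrow> 'a) \<Rightarrow> bool" where
  "automorphism M \<sigma> \<longleftrightarrow>
    bij_betw \<sigma> (points M) (points M) \<and>
    (\<forall>a\<in>points M. \<forall>b\<in>points M. \<forall>c\<in>points M. circ M (\<sigma> a) (\<sigma> b) (\<sigma> c) \<longleftrightarrow> circ M a b c) \<and>
    (\<forall>n. \<forall>a\<in>points M. \<sigma> (rot M n a) = rot M n (\<sigma> a))"

text \<open>The unique extension of an automorphism to the imaginaries.\<close>

primrec meq_map :: "('a \<Rightarrow> 'a) \<Rightarrow> 'a meq \<Rightarrow> 'a meq" where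
  "meq_map \<sigma> (Home a) = Home (\<sigma> a)"
| "meq_map \<sigma> (Imag n \<phi> X) = Imag n \<phi> (map \<sigma> ` X)"

section \<open>Independence relations\<close>

text \<open>\<open>ind A C D\<close> is \<open>A\<close> independent from \<open>D\<close> over \<open>C\<close>; only its values on small sets matter.\<close>

locale indep_relation =
  fixes M :: "'a circ_struct"
    and ind :: "'a meq set \<Rightarrow> 'a meq set \<Rightarrow> 'a meq set \<Rightarrow> bool"
  assumes invariance:
      "\<lbrakk>small M A; small M C; small M D; automorphism M \<sigma>; \<forall>b\<in>acl_empty M. meq_map \<sigma> b = b\<rbrakk>
        \<Longrightarrow> ind (meq_map \<sigma> ` A) (meq_map \<sigma> ` C) (meq_map \<sigma> ` D) \<longleftrightarrow> ind A C D"
    and finite_character: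
      "\<lbrakk>small M A; small M C; small M D\<rbrakk>
        \<Longrightarrow> ind A C D \<longleftrightarrow> (\<forall>a d. finite a \<and> a \<subseteq> A \<and> finite d \<and> d \<subseteq> D \<longrightarrow> ind a C d)"
    and normality:
      "\<lbrakk>small M A; small M C; small M D; ind A C D\<rbrakk> \<Longrightarrow> ind A C (acl M (D \<union> C))"
    and symmetry:
      "\<lbrakk>small M A; small M C; small M D\<rbrakk> \<Longrightarrow> ind A C D \<longleftrightarrow> ind D C A"
    and transitivity:
      "\<lbrakk>small M A; small M D; E \<subseteq> C; C \<subseteq> D\<rbrakk> \<Longrightarrow> ind A E D \<longleftrightarrow> ind A E C \<and> ind A C D"
    and extension:
      "\<lbrakk>small M A; small M C; E \<subseteq> C\<rbrakk> \<Longrightarrow> \<exists>A'. conj_over M E A A' \<and> ind A' E C"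

definition indep_family ::
    "('a meq set \<Rightarrow> 'a meq set \<Rightarrow> 'a meq set \<Rightarrow> bool) \<Rightarrow> 'a meq set \<Rightarrow> 'i set \<Rightarrow> ('i \<Rightarrow> 'a meq set) \<Rightarrow> bool"
  where "indep_family ind C I X \<longleftrightarrow> (\<forall>i\<in>I. ind (X i) C (\<Union>j\<in>I - {i}. X j))"

section \<open>Simplices and homology\<close>

text \<open>
  A functor on the power set category of \<open>supp\<close>: \<open>obj u\<close> is $f(u)$ and \<open>arr u v\<close> is $f^u_v$. Values
  outside the domain are fixed arbitrarily, so that equality of these data is equality of functors.
\<close>

record 'q cube =
  supp :: "nat set"
  obj :: "nat set \<Rightarrow> 'q set"
  arr :: "nat set \<Rightarrow> nat set \<Rightarrow> 'q \<Rightarrow> 'q"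

definition C_object :: "'a circ_struct \<Rightarrow> 'a meq set \<Rightarrow> bool" where
  "C_object M A \<longleftrightarrow> small M A \<and> acl_empty M \<subseteq> A"

definition C_morphism ::
    "'a circ_struct \<Rightarrow> 'a meq set \<Rightarrow> 'a meq set \<Rightarrow> ('a meq \<Rightarrow> 'a meq) \<Rightarrow> bool" where
  "C_morphism M A D h \<longleftrightarrow>
    h \<in> A \<rightarrow>\<^sub>E D \<and> elementary_on M A h \<and> (\<forall>b\<in>acl_empty M. h b = b)"

definition is_functor :: "'a circ_struct \<Rightarrow> 'a meq cube \<Rightarrow> bool" where
  "is_functor M f \<longleftrightarrow>
    (\<forall>u\<subseteq>supp f. C_object M (obj f u)) \<and>
    (\<forall>u v. u \<subseteq> v \<and> v \<subseteq> supp f \<longrightarrow> C_morphism M (obj f u) (obj f v) (arr f u v)) \<and>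
    (\<forall>u\<subseteq>supp f. \<forall>x\<in>obj f u. arr f u u x = x) \<and>
    (\<forall>u v w. u \<subseteq> v \<and> v \<subseteq> w \<and> w \<subseteq> supp f \<longrightarrow>
       (\<forall>x\<in>obj f u. arr f v w (arr f u v x) = arr f u w x)) \<and>
    (\<forall>u. \<not> u \<subseteq> supp f \<longrightarrow> obj f u = {}) \<and>
    (\<forall>u v. \<not> (u \<subseteq> v \<and> v \<subseteq> supp f) \<longrightarrow> arr f u v = (\<lambda>x. undefined))"

text \<open>A type of the home sort without parameters is a set of formulas in the free variable 0.\<close>

definition p0 :: "fm set" where
  "p0 = {FEq (Var 0) (Var 0)}"

definition realizations :: "'a circ_struct \<Rightarrow> fm set \<Rightarrow> 'a set" where
  "realizations M p = {b \<in> points M. \<forall>\<phi>\<in>p. sat M (\<lambda>_. b) \<phi>}"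

definition vertex_image :: "'a meq cube \<Rightarrow> nat set \<Rightarrow> nat \<Rightarrow> 'a meq set" where
  "vertex_image f u i = arr f {i} u ` obj f {i}"

definition simplices ::
    "'a circ_struct \<Rightarrow> ('a meq set \<Rightarrow> 'a meq set \<Rightarrow> 'a meq set \<Rightarrow> bool) \<Rightarrow> fm set \<Rightarrow> nat \<Rightarrow> 'a meq cube set"
  where
  "simplices M ind p n = {f.
     finite (supp f) \<and> card (supp f) = n + 1 \<and> is_functor M f \<and>
     obj f {} = acl_empty M \<and>
     (\<forall>i\<in>supp f. \<exists>b\<in>realizations M p. obj f {i} = acl M {Home b}) \<and>
     (\<forall>u. u \<noteq> {} \<and> u \<subseteq> supp f \<longrightarrow>
        obj f u = acl M (\<Union>i\<in>u. vertex_image f u i) \<and>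
        indep_family ind (acl_empty M) u (vertex_image f u))}"

definition restrict_cube :: "'q cube \<Rightarrow> nat set \<Rightarrow> 'q cube" where
  "restrict_cube f t =
    \<lparr> supp = t,
      obj = (\<lambda>u. if u \<subseteq> t then obj f u else {}),
      arr = (\<lambda>u v. if u \<subseteq> v \<and> v \<subseteq> t then arr f u v else (\<lambda>x. undefined)) \<rparr>"

definition face :: "nat \<Rightarrow> 'q cube \<Rightarrow> 'q cube" where
  "face i f = restrict_cube f (supp f - {sorted_list_of_set (supp f) ! i})"

definition boundary :: "('q cube \<Rightarrow>\<^sub>0 int) \<Rightarrow> ('q cube \<Rightarrow>\<^sub>0 int)" where
  "boundary = frag_extend (\<lambda>f. \<Sum>i<card (supp f). frag_cmul ((- 1) ^ i) (frag_of (face i f)))"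

definition chains ::
    "'a circ_struct \<Rightarrow> ('a meq set \<Rightarrow> 'a meq set \<Rightarrow> 'a meq set \<Rightarrow> bool) \<Rightarrow> fm set \<Rightarrow> nat
      \<Rightarrow> ('a meq cube \<Rightarrow>\<^sub>0 int) monoid" where
  "chains M ind p n = free_Abelian_group (simplices M ind p n)"

definition H1 ::
    "'a circ_struct \<Rightarrow> ('a meq set \<Rightarrow> 'a meq set \<Rightarrow> 'a meq set \<Rightarrow> bool) \<Rightarrow> fm set
      \<Rightarrow> ('a meq cube \<Rightarrow>\<^sub>0 int) set monoid" where
  "H1 M ind p =
    subgroup_generated (chains M ind p 1) (kernel (chains M ind p 1) (chains M ind p 0) boundary)
      Mod (boundary ` carrier (chains M ind p 2))"

definition real_add_group :: "real monoid" where
  "real_add_group = \<lparr> carrier = UNIV, monoid.mult = (+), one = 0 \<rparr>"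

end

theory Submission
  imports Defs "HOL-Library.Countable_Set" "HOL-Analysis.Continuum_Not_Denumerable"
begin

text \<open>
  Any two points of \<open>M\<close> have a standard angle in \<open>\<real>/\<int>\<close>, read off from the position of the second
  relative to all rational rotations of the first. A formula uses the rotations by multiples of \<open>1/N\<close>
  for a single \<open>N\<close>, and at level \<open>N\<close> the type of a tuple is given by the finitely many positions of its
  members relative to each other. Hence back and forth works, on imaginaries too, without saturation.
  An imaginary with finitely many conjugates over a finite set of points depends on no further point:
  moving this point along an infinite increasing sequence gives the same value twice. So the algebraic
  closure of a nonempty finite set of points is its definable closure, the algebraic closure of the
  empty set is fixed by every elementary map, and an edge is given by its two vertices and a pair of
  points up to their type.

  The angle of an edge is additive along the boundary of a triangle, which gives a map from \<open>H\<^sub>1\<close> to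
  \<open>\<real>/\<int>\<close>. Two edges with common ends form a loop. Extension moves a whole family of prescribed angles
  off a given finite set, so loops of every angle exist, and two loops of the same angle are homologous
  since both can be coned off to one apex with matching sides. Coning off an arbitrary cycle turns it
  into a loop, and a loop of angle 0 is a boundary.
\<close>

section \<open>Transfer from the unit circle\<close>

text \<open>The angle alone does not determine the type of a pair: at a rational angle the second
  point may be the rotated first one or infinitely close to it on either side. At an irrational
  angle every code is forced. Hence the apex of a cone is placed at irrational angles from the base;
  its sides may then be exchanged for any independent pairs of the same angle modulo 1. An edge
  carries more than its ends. The arrows embed both vertices into the object of the edge, and there
  the images of the generators can have any angle, so different edges join the same two vertices. A
  point and its rotations have the same closure; one generator per closure is chosen once and for
  all, since otherwise the angle of an edge would be defined only modulo the rationals. Identities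
  between codes come from real arithmetic, after copying a finite tuple to reals that agree with it
  on finitely many formulas. Saturation is used only to realise an irrational angle; rational ones
  follow by composing two turns. That all angles occur makes the model uncountable and countable
  sets small.\<close>

fun FConj :: "fm list \<Rightarrow> fm" where
  "FConj [] = FEq (Var 0) (Var 0)"
| "FConj (\<phi> # \<phi>s) = FAnd \<phi> (FConj \<phi>s)"

lemma sat_FConj [simp]: "sat M v (FConj \<phi>s) \<longleftrightarrow> (\<forall>\<phi>\<in>set \<phi>s. sat M v \<phi>)"
  by (induction \<phi>s) auto

lemma fv_FConj: "fv (FConj \<phi>s) = insert 0 (\<Union>\<phi>\<in>set \<phi>s. fv \<phi>)"
  by (induction \<phi>s) auto

text \<open>Satisfaction, quantifier and domain are abstract so that the statement serves both the
  one-sorted formulas and those with imaginaries.\<close>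

lemma foldr_ex:
  assumes "\<And>v j \<phi>. S v (Q j \<phi>) \<longleftrightarrow> (\<exists>x\<in>X. S (v(j := x)) \<phi>)"
  shows "S v (foldr Q js \<phi>) \<longleftrightarrow> (\<exists>w. (\<forall>i. i \<notin> set js \<longrightarrow> w i = v i) \<and> (\<forall>i\<in>set js. w i \<in> X) \<and> S w \<phi>)"
proof (induction js arbitrary: v)
  case Nil
  have "(\<forall>i. w i = v i) \<longleftrightarrow> w = v" for w by auto
  then show ?case by simp
next
  case (Cons j js)
  have "S v (foldr Q (j # js) \<phi>) \<longleftrightarrow> (\<exists>x\<in>X. \<exists>w. (\<forall>i. i \<notin> set js \<longrightarrow> w i = (v(j := x)) i) \<and>
      (\<forall>i\<in>set js. w i \<in> X) \<and> S w \<phi>)"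
    by (simp add: assms Cons.IH)
  also have "\<dots> \<longleftrightarrow> (\<exists>w. (\<forall>i. i \<notin> set (j # js) \<longrightarrow> w i = v i) \<and> (\<forall>i\<in>set (j # js). w i \<in> X) \<and> S w \<phi>)"
    (is "?l \<longleftrightarrow> ?r")
  proof
    assume ?l
    then obtain x w where w: "x \<in> X" "\<forall>i. i \<notin> set js \<longrightarrow> w i = (v(j := x)) i" "\<forall>i\<in>set js. w i \<in> X" "S w \<phi>"
      by blast
    then have "w j \<in> X" by (cases "j \<in> set js") auto
    with w show ?r by (intro exI[of _ w]) auto
  next
    assume ?r
    then obtain w where w: "\<forall>i. i \<notin> set (j # js) \<longrightarrow> w i = v i" "\<forall>i\<in>set (j # js). w i \<in> X" "S w \<phi>" by blast
    then show ?l by (intro bexI[of _ "w j"] exI[of _ w]) auto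
  qed
  finally show ?case .
qed

definition FExs :: "nat list \<Rightarrow> fm \<Rightarrow> fm" where
  "FExs js \<phi> = foldr FEx js \<phi>"

lemma fv_FExs: "fv (FExs js \<phi>) = fv \<phi> - set js"
  unfolding FExs_def by (induction js) auto

lemma sat_FExs:
  "sat M v (FExs js \<phi>) \<longleftrightarrow>
    (\<exists>w. (\<forall>i. i \<notin> set js \<longrightarrow> w i = v i) \<and> (\<forall>i\<in>set js. w i \<in> points M) \<and> sat M w \<phi>)"
  unfolding FExs_def by (rule foldr_ex) (simp add: fun_upd_def)

definition frq :: "fm \<Rightarrow> bool \<Rightarrow> fm" where
  "frq \<phi> b = (if b then \<phi> else FNot \<phi>)"

lemma sat_frq [simp]: "sat M v (frq \<phi> b) \<longleftrightarrow> (sat M v \<phi> \<longleftrightarrow> b)"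
  by (simp add: frq_def)

lemma fv_frq [simp]: "fv (frq \<phi> b) = fv \<phi>"
  by (simp add: frq_def)

text \<open>Measuring clockwise in full turns makes rotations additions of rationals and equality of
  points congruence modulo 1.\<close>

definition cpt :: "real \<Rightarrow> complex" where
  "cpt t = cis (- (2 * pi * t))"

lemma cpt_range: "range cpt = {z. cmod z = 1}"
proof -
  have "z \<in> range cpt" if "cmod z = 1" for z
  proof -
    have "z = cis (Arg z)" using that cis_Arg[of z] by (cases "z = 0") (auto simp: sgn_div_norm)
    also have "\<dots> = cpt (- (Arg z / (2 * pi)))" by (simp add: cpt_def)
    finally show ?thesis by blast
  qed
  then show ?thesis by (auto simp: cpt_def)
qed

lemma cpt_eq_iff: "cpt s = cpt t \<longleftrightarrow> t - s \<in> \<int>"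
proof -
  have "cpt s = cpt t * cis (2 * pi * (t - s))" by (simp add: cpt_def cis_mult algebra_simps)
  moreover have "cpt t \<noteq> 0" by (simp add: cpt_def)
  ultimately have "cpt s = cpt t \<longleftrightarrow> cis (2 * pi * (t - s)) = 1" by simp
  also have "\<dots> \<longleftrightarrow> t - s \<in> \<int>"
  proof
    assume "cis (2 * pi * (t - s)) = 1"
    then have "cos (2 * pi * (t - s)) = 1" by (metis cis.simps(1) one_complex.simps(1))
    then obtain n :: int where "2 * pi * (t - s) = of_int n * 2 * pi"
      using cos_one_2pi_int by blast
    then have "t - s = of_int n" by simp
    then show "t - s \<in> \<int>" by simp
  next
    assume "t - s \<in> \<int>"
    then show "cis (2 * pi * (t - s)) = 1" by simp
  qed
  finally show ?thesis .
qed

text \<open>Betweenness on the circle in these coordinates: both offsets are read in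
  \<open>[0, 1)\<close> starting from \<open>a\<close>.\<close>

definition cyc :: "real \<Rightarrow> real \<Rightarrow> real \<Rightarrow> bool" where
  "cyc a b c \<longleftrightarrow> 0 < frac (b - a) \<and> frac (b - a) < frac (c - a)"

lemma circ_unit: "circ unit_circle (cpt a) (cpt b) (cpt c) \<longleftrightarrow> cyc a b c"
proof -
  have *: "cpt b = cpt a * cis (- \<beta>) \<longleftrightarrow> frac (b - a) = \<beta> / (2 * pi)" if "0 < \<beta>" "\<beta> < 2 * pi" for b \<beta>
  proof -
    have "2 * pi * (a + \<beta> / (2 * pi)) = 2 * pi * a + \<beta>" by (simp add: field_simps)
    then have "cpt a * cis (- \<beta>) = cpt (a + \<beta> / (2 * pi))" by (simp add: cpt_def cis_mult)
    then have "cpt b = cpt a * cis (- \<beta>) \<longleftrightarrow> a + \<beta> / (2 * pi) - b \<in> \<int>" by (simp add: cpt_eq_iff)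
    also have "\<dots> \<longleftrightarrow> b - a - \<beta> / (2 * pi) \<in> \<int>"
    proof -
      have "b - a - \<beta> / (2 * pi) = - (a + \<beta> / (2 * pi) - b)" by simp
      then show ?thesis by (metis minus_in_Ints_iff)
    qed
    also have "\<dots> \<longleftrightarrow> frac (b - a) = \<beta> / (2 * pi)"
    proof -
      have "0 \<le> \<beta> / (2 * pi)" "\<beta> / (2 * pi) < 1" using that by (auto simp: field_simps)
      then show ?thesis using frac_unique_iff[of "b - a" "\<beta> / (2 * pi)"] by auto
    qed
    finally show ?thesis .
  qed
  show ?thesis
  proof
    assume "circ unit_circle (cpt a) (cpt b) (cpt c)"
    then obtain \<beta> \<gamma> where "0 < \<beta>" "\<beta> < \<gamma>" "\<gamma> < 2 * pi" "cpt b = cpt a * cis (- \<beta>)" "cpt c = cpt a * cis (- \<gamma>)"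
      by (auto simp: unit_circle_def)
    then have "frac (b - a) = \<beta> / (2 * pi)" "frac (c - a) = \<gamma> / (2 * pi)" using *[of \<beta> b] *[of \<gamma> c] by auto
    then show "cyc a b c" using \<open>0 < \<beta>\<close> \<open>\<beta> < \<gamma>\<close> by (simp add: cyc_def divide_strict_right_mono)
  next
    assume c: "cyc a b c"
    let ?\<beta> = "2 * pi * frac (b - a)" and ?\<gamma> = "2 * pi * frac (c - a)"
    have "0 < ?\<beta>" "?\<beta> < ?\<gamma>" "?\<gamma> < 2 * pi" using c frac_lt_1[of "c - a"] by (auto simp: cyc_def)
    moreover have "cpt b = cpt a * cis (- ?\<beta>)" "cpt c = cpt a * cis (- ?\<gamma>)"
      using *[of ?\<beta> b] *[of ?\<gamma> c] calculation by auto
    ultimately have "\<exists>\<beta> \<gamma>. 0 < \<beta> \<and> \<beta> < \<gamma> \<and> \<gamma> < 2 * pi \<and>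
        cpt b = cpt a * cis (- \<beta>) \<and> cpt c = cpt a * cis (- \<gamma>)" by blast
    then show "circ unit_circle (cpt a) (cpt b) (cpt c)"
      unfolding unit_circle_def circ_struct.simps by assumption
  qed
qed

lemma rot_unit: "rot unit_circle n (cpt t) = cpt (t + 1 / Suc n)"
proof -
  have "2 * pi * (t + 1 / Suc n) = 2 * pi * t + 2 * pi / real (Suc n)" by (simp add: field_simps)
  then show ?thesis by (simp add: unit_circle_def cpt_def cis_mult)
qed

lemma points_unit: "points unit_circle = range cpt"
  by (simp add: unit_circle_def cpt_range)

text \<open>\<open>rots M n m\<close> is the rotation by \<open>m/n\<close> of a full turn, for \<open>n > 0\<close>.\<close>

definition rots :: "'a circ_struct \<Rightarrow> nat \<Rightarrow> nat \<Rightarrow> 'a \<Rightarrow> 'a" where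
  "rots M n m = (rot M (n - 1) ^^ m)"

definition rot_tm :: "nat \<Rightarrow> nat \<Rightarrow> nat \<Rightarrow> tm" where
  "rot_tm n m i = (Rot (n - 1) ^^ m) (Var i)"

lemma tm_val_rot_tm [simp]: "tm_val M v (rot_tm n m i) = rots M n m (v i)"
  unfolding rot_tm_def rots_def by (induction m) auto

lemma tm_vars_rot_tm [simp]: "tm_vars (rot_tm n m i) = {i}"
  unfolding rot_tm_def by (induction m) auto

lemma rots_unit: "n > 0 \<Longrightarrow> rots unit_circle n m (cpt t) = cpt (t + m / n)"
  unfolding rots_def by (induction m) (auto simp: rot_unit field_simps)

locale circle_model =
  fixes M :: "'a circ_struct"
  assumes model: "is_model M (theory_of unit_circle)"
begin

abbreviation "P \<equiv> points M"
abbreviation "G n m x \<equiv> rots M n m x"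

lemma rot_in [simp]: "x \<in> P \<Longrightarrow> rot M n x \<in> P"
  using model by (auto simp: is_model_def is_circ_struct_def)

lemma rots_in [simp]: "x \<in> P \<Longrightarrow> G n m x \<in> P"
  unfolding rots_def by (induction m) auto

lemma points_ne: "P \<noteq> {}"
  using model by (auto simp: is_model_def is_circ_struct_def)

lemma transfer_sentence:
  assumes "fv \<phi> = {}" and "\<And>v. range v \<subseteq> range cpt \<Longrightarrow> sat unit_circle v \<phi>" and "range v \<subseteq> P"
  shows "sat M v \<phi>"
proof -
  have "\<phi> \<in> theory_of unit_circle" using assms by (auto simp: theory_of_def points_unit)
  then show ?thesis using model assms(3) by (auto simp: is_model_def)
qed

text \<open>\<open>theory_of unit_circle\<close> contains every sentence true on the unit circle.
  The sentence that no tuple shows this pattern of truth values is refuted in \<open>M\<close> by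
  \<open>x\<close>, so it is false on the unit circle.\<close>

lemma shadow_fms:
  assumes x: "\<And>i. x i \<in> P" and \<Phi>: "finite \<Phi>" "\<And>\<phi>. \<phi> \<in> \<Phi> \<Longrightarrow> fv \<phi> \<subseteq> {..<k}"
  shows "\<exists>s :: nat \<Rightarrow> real. \<forall>\<phi>\<in>\<Phi>. sat M x \<phi> \<longleftrightarrow> sat unit_circle (\<lambda>i. cpt (s i)) \<phi>"
proof -
  obtain L where L: "set L = \<Phi>" using \<Phi>(1) finite_list by blast
  define \<chi> where "\<chi> = FConj (map (\<lambda>\<phi>. frq \<phi> (sat M x \<phi>)) L)"
  \<comment> \<open>The block of quantifiers reaches \<open>Suc k\<close> variables because
    \<open>FConj\<close> mentions variable 0 even if \<open>k = 0\<close>.\<close>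
  define \<sigma> where "\<sigma> = FNot (FExs [0..<Suc k] \<chi>)"
  have fv: "fv \<sigma> = {}" using \<Phi>(2) L by (fastforce simp: \<sigma>_def \<chi>_def fv_FExs fv_FConj)
  have "sat M x (FExs [0..<Suc k] \<chi>)"
    unfolding sat_FExs by (intro exI[of _ x]) (auto simp: x \<chi>_def)
  then have "\<not> sat M x \<sigma>" by (simp add: \<sigma>_def)
  then obtain v where v: "range v \<subseteq> range cpt" "\<not> sat unit_circle v \<sigma>"
    using transfer_sentence[OF fv, of x] x by blast
  then obtain w where w: "\<forall>i. i \<notin> set [0..<Suc k] \<longrightarrow> w i = v i" "\<forall>i\<in>set [0..<Suc k]. w i \<in> points unit_circle"
      "sat unit_circle w \<chi>"
    by (auto simp: \<sigma>_def sat_FExs)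
  have "\<forall>i. \<exists>t. w i = cpt t" using w(1,2) v(1) unfolding points_unit by (metis imageE range_subsetD)
  then obtain s where s: "\<And>i. w i = cpt (s i)" by metis
  then have "w = (\<lambda>i. cpt (s i))" by auto
  then show ?thesis using w(3) L by (auto simp: \<chi>_def)
qed

text \<open>Reals that imitate the first \<open>k\<close> points for atomic statements with
  rotations of numerator and denominator at most \<open>K\<close>. Facts about finitely many points
  of \<open>M\<close> can thus be computed in the reals. A copy faithful for all \<open>K\<close> at
  once need not exist, since points may be infinitely close.\<close>

definition shadow :: "nat \<Rightarrow> nat \<Rightarrow> (nat \<Rightarrow> 'a) \<Rightarrow> (nat \<Rightarrow> real) \<Rightarrow> bool" where
  "shadow K k x s \<longleftrightarrow> (\<forall>i<k. \<forall>j<k. \<forall>l<k. \<forall>n\<in>{1..K}. \<forall>m\<le>K. \<forall>m'\<le>K.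
     (G n m (x i) = x j \<longleftrightarrow> s j - (s i + m / n) \<in> \<int>) \<and>
     (circ M (G n m (x i)) (x j) (G n m' (x l)) \<longleftrightarrow> cyc (s i + m / n) (s j) (s l + m' / n)))"

lemma shadow_exists:
  assumes x: "\<And>i. i < k \<Longrightarrow> x i \<in> P"
  shows "\<exists>s. shadow K k x s"
proof -
  \<comment> \<open>\<open>shadow_fms\<close> wants a total assignment into \<open>P\<close>; the
    indices from \<open>k\<close> on get a default point.\<close>
  define x' where "x' = (\<lambda>i. if i < k then x i else (SOME y. y \<in> P))"
  have x': "x' i \<in> P" for i using x points_ne by (auto simp: x'_def some_in_eq)
  let ?I = "{..<k} \<times> {..<k} \<times> {..<k} \<times> {1..K} \<times> {..K} \<times> {..K}"
  define A where "A = (\<lambda>(i,j,l::nat,n,m,m'::nat). FEq (rot_tm n m i) (Var j)) ` ?I"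
  define B where "B = (\<lambda>(i,j,l,n,m,m'). FS (rot_tm n m i) (Var j) (rot_tm n m' l)) ` ?I"
  have "finite (A \<union> B)" by (simp add: A_def B_def)
  moreover have "fv \<phi> \<subseteq> {..<k}" if "\<phi> \<in> A \<union> B" for \<phi> using that by (auto simp: A_def B_def)
  ultimately have "\<exists>s :: nat \<Rightarrow> real. \<forall>\<phi>\<in>A \<union> B. sat M x' \<phi> \<longleftrightarrow> sat unit_circle (\<lambda>i. cpt (s i)) \<phi>"
    by (intro shadow_fms[OF x'])
  then obtain s where s: "\<forall>\<phi>\<in>A \<union> B. sat M x' \<phi> \<longleftrightarrow> sat unit_circle (\<lambda>i. cpt (s i)) \<phi>" ..
  have "(G n m (x i) = x j \<longleftrightarrow> s j - (s i + m / n) \<in> \<int>) \<and>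
     (circ M (G n m (x i)) (x j) (G n m' (x l)) \<longleftrightarrow> cyc (s i + m / n) (s j) (s l + m' / n))"
    if "i < k" "j < k" "l < k" "n \<in> {1..K}" "m \<le> K" "m' \<le> K" for i j l n m m'
  proof -
    have "(i, j, l, n, m, m') \<in> ?I" using that by simp
    then have "FEq (rot_tm n m i) (Var j) \<in> A" "FS (rot_tm n m i) (Var j) (rot_tm n m' l) \<in> B"
      unfolding A_def B_def by (force simp only: prod.case intro: image_eqI)+
    then have "sat M x' (FEq (rot_tm n m i) (Var j)) \<longleftrightarrow> sat unit_circle (\<lambda>i. cpt (s i)) (FEq (rot_tm n m i) (Var j))"
      "sat M x' (FS (rot_tm n m i) (Var j) (rot_tm n m' l)) \<longleftrightarrow>
        sat unit_circle (\<lambda>i. cpt (s i)) (FS (rot_tm n m i) (Var j) (rot_tm n m' l))"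
      using s by blast+
    then show ?thesis using that by (simp add: x'_def rots_unit cpt_eq_iff circ_unit)
  qed
  then show ?thesis unfolding shadow_def by blast
qed

end

section \<open>Pair types at a finite level\<close>

text \<open>Position of \<open>d\<close> in the subdivision by multiples of \<open>1 / N\<close>:
  floor and ceiling agree at a division point and differ by one inside a cell, so even values stand
  for division points and odd ones for open cells. Unlike the floor, the sum changes sign with
  \<open>d\<close>.\<close>

definition kap :: "nat \<Rightarrow> real \<Rightarrow> int" where
  "kap N d = \<lfloor>real N * d\<rfloor> + \<lceil>real N * d\<rceil>"

lemma kap_add: "real N * t = of_int z \<Longrightarrow> kap N (d + t) = kap N d + 2 * z"
  by (simp add: kap_def distrib_left)

lemma kap_uminus: "kap N (- d) = - kap N d"
  by (simp add: kap_def floor_minus ceiling_minus)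

lemma kap_mono: "a \<le> b \<Longrightarrow> kap N a \<le> kap N b"
  unfolding kap_def by (intro add_mono floor_mono ceiling_mono mult_left_mono) auto

lemma kap_bounds: "2 * real N * d - 1 \<le> of_int (kap N d)" "of_int (kap N d) \<le> 2 * real N * d + 1"
  using of_int_floor_le[of "real N * d"] real_of_int_floor_add_one_gt[of "real N * d"]
    le_of_int_ceiling[of "real N * d"] of_int_ceiling_le_add_one[of "real N * d"]
  unfolding kap_def of_int_add by linarith+

lemma kap_cases:
  obtains (ex) m where "real N * d = of_int m" "kap N d = 2 * m"
  | (gap) m where "of_int m < real N * d" "real N * d < of_int m + 1" "kap N d = 2 * m + 1"
proof (cases "real N * d \<in> \<int>")
  case True
  then obtain m where "real N * d = of_int m" by (auto elim: Ints_cases)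
  then show ?thesis using ex by (simp add: kap_def)
next
  case False
  then have "\<lceil>real N * d\<rceil> = \<lfloor>real N * d\<rfloor> + 1" by (metis Ints_of_int ceiling_altdef)
  moreover have "of_int \<lfloor>real N * d\<rfloor> < real N * d"
    using False by (metis Ints_of_int of_int_floor_le order_le_less)
  ultimately show ?thesis using gap[of "\<lfloor>real N * d\<rfloor>"] by (simp add: kap_def)
qed

text \<open>Distinct reals with the same value cannot be at a division point; they share an open
  cell, whose length is \<open>1 / N\<close>.\<close>

lemma kap_eq_close:
  assumes "kap N f = kap N h" "f < h" "N > 0"
  shows "kap N (h - f) = 1"
proof -
  have "real N * f < real N * h" using assms by simp
  then have "real N * h - real N * f < 1 \<and> real N * h - real N * f > 0"
    by (rule_tac kap_cases[of N f]; rule_tac kap_cases[of N h]) (use assms(1) in auto)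
  then have "0 < real N * (h - f)" "real N * (h - f) < 1" by (auto simp: algebra_simps)
  then have "\<lfloor>real N * (h - f)\<rfloor> = 0" "\<lceil>real N * (h - f)\<rceil> = 1" by linarith+
  then show ?thesis by (simp add: kap_def)
qed

lemma kap_range:
  assumes "0 \<le> d" "d < 1" "N > 0"
  shows "0 \<le> kap N d" "kap N d < 2 * int N"
proof -
  show "0 \<le> kap N d" using kap_mono[of 0 d N] assms by (simp add: kap_def)
  have "real N * d < real N" using assms by simp
  then have "real N * d < of_int (int N)" by simp
  then have "\<lfloor>real N * d\<rfloor> < int N" "\<lceil>real N * d\<rceil> \<le> int N" by linarith+
  then show "kap N d < 2 * int N" by (simp add: kap_def)
qed

lemma kap_mod: 
  assumes "N > 0" "a - b \<in> \<int>"
  shows "kap N a mod (2 * int N) = kap N b mod (2 * int N)"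
proof -
  from assms obtain z where "a = b + of_int z" by (auto elim!: Ints_cases simp: algebra_simps)
  moreover have "kap N (b + of_int z) = kap N b + 2 * (int N * z)"
    by (rule kap_add) simp
  ultimately show ?thesis by (metis mod_mult_self2 mult.assoc)
qed

lemma kap_frac:
  assumes "N > 0" shows "kap N d mod (2 * int N) = kap N (frac d)"
proof -
  have "kap N d mod (2 * int N) = kap N (frac d) mod (2 * int N)"
    by (rule kap_mod) (use assms in \<open>auto simp: frac_def\<close>)
  also have "\<dots> = kap N (frac d)" using kap_range[of "frac d" N] assms by (simp add: frac_lt_1)
  finally show ?thesis .
qed

lemma kap_0_iff: "N > 0 \<Longrightarrow> kap N (frac d) = 0 \<longleftrightarrow> frac d = 0"
proof -
  assume N: "N > 0"
  show ?thesis
  proof (rule kap_cases[of N "frac d"])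
    fix m assume "real N * frac d = of_int m" "kap N (frac d) = 2 * m"
    then show ?thesis using N by (metis mult_eq_0_iff of_int_eq_0_iff of_nat_eq_0_iff not_gr0 zero_neq_numeral)
  next
    fix m assume m: "of_int m < real N * frac d" "real N * frac d < of_int m + 1" "kap N (frac d) = 2 * m + 1"
    have "frac d \<noteq> 0"
    proof
      assume "frac d = 0"
      then have "of_int m < (0::real)" "(0::real) < of_int m + 1"
        using m(1,2) by (simp_all only: mult_zero_right)
      then have "m < 0" "0 < m + 1" by linarith+
      then show False by simp
    qed
    moreover have "2 * m + 1 \<noteq> 0" by presburger
    ultimately show ?thesis using m(3) by simp
  qed
qed

lemma kap_1_iff: "N > 0 \<Longrightarrow> kap N (frac d) = 1 \<longleftrightarrow> 0 < frac d \<and> frac d < 1 / N"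
proof -
  assume N: "N > 0"
  show ?thesis
  proof (rule kap_cases[of N "frac d"])
    fix m assume m: "real N * frac d = of_int m" "kap N (frac d) = 2 * m"
    have "\<not> (0 < frac d \<and> frac d < 1 / N)"
    proof
      assume "0 < frac d \<and> frac d < 1 / N"
      then have "0 < real N * frac d" "real N * frac d < 1" using N by (auto simp: field_simps)
      then show False using m by auto
    qed
    moreover have "2 * m \<noteq> 1" by presburger
    ultimately show ?thesis using m(2) by simp
  next
    fix m assume m: "of_int m < real N * frac d" "real N * frac d < of_int m + 1" "kap N (frac d) = 2 * m + 1"
    have "0 < frac d \<and> frac d < 1 / N \<longleftrightarrow> 0 < real N * frac d \<and> real N * frac d < 1"
      using N by (simp add: field_simps zero_less_mult_iff del: frac_gt_0_iff)
    also have "\<dots> \<longleftrightarrow> m = 0"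
    proof
      assume "0 < real N * frac d \<and> real N * frac d < 1"
      then have "m < 1" "0 < m + 1" using m by linarith+
      then show "m = 0" by simp
    next
      assume "m = 0" then show "0 < real N * frac d \<and> real N * frac d < 1" using m by simp
    qed
    finally show ?thesis using m by auto
  qed
qed

text \<open>The value at level \<open>N\<close> gives back floor and ceiling of \<open>N * d\<close>
  by halving. Dividing them by \<open>k\<close> gives those of \<open>n * d\<close>; the ceiling is
  divided through its negative, because \<open>div\<close> rounds down.\<close>

lemma kap_dvd:
  assumes "N = k * n" "k > 0" 
  shows "kap n d = ((kap N d) div 2) div int k - ((- ((kap N d + 1) div 2)) div int k)"
proof -
  have f: "\<lfloor>real N * d\<rfloor> = kap N d div 2" "\<lceil>real N * d\<rceil> = (kap N d + 1) div 2"
    by (rule kap_cases[of N d]; simp add: floor_eq_iff ceiling_eq_iff)+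
  have n: "real n * d = (real N * d) / real_of_int (int k)" using assms by simp
  have "\<lfloor>real n * d\<rfloor> = \<lfloor>real N * d\<rfloor> div int k"
    unfolding n by (rule floor_divide_real_eq_div) simp
  moreover have "- \<lceil>real n * d\<rceil> = (- \<lceil>real N * d\<rceil>) div int k"
  proof -
    have "- \<lceil>real n * d\<rceil> = \<lfloor>(- (real N * d)) / real_of_int (int k)\<rfloor>"
      unfolding n by (simp add: ceiling_def)
    also have "\<dots> = \<lfloor>- (real N * d)\<rfloor> div int k" by (rule floor_divide_real_eq_div) simp
    finally show ?thesis by (simp add: ceiling_def)
  qed
  ultimately show ?thesis unfolding kap_def[of n] f by simp
qed

section \<open>Codes of pairs of points in a model\<close>

context circle_model
begin

text \<open>\<open>cod N x y\<close> is \<open>2 * m\<close> if \<open>y\<close> is \<open>x\<close> rotated by \<open>m/N\<close>, and \<open>2 * m + 1\<close> if \<open>y\<close> lies strictly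
  between \<open>x\<close> rotated by \<open>m/N\<close> and by \<open>(m+1)/N\<close>.\<close>

definition cod :: "nat \<Rightarrow> 'a \<Rightarrow> 'a \<Rightarrow> nat" where
  "cod N x y = (LEAST c. if even c then G N (c div 2) x = y
                 else circ M (G N (c div 2) x) y (G N (Suc (c div 2)) x))"

lemma shadow_cod_frac:
  assumes s: "shadow K k x s" and ij: "i < k" "j < k" and N: "2 \<le> N" "N \<le> K"
  shows "int (cod N (x i) (x j)) = kap N (frac (s j - s i))"
proof -
  define d where "d = frac (s j - s i)"
  have d: "0 \<le> d" "d < 1" by (auto simp: d_def frac_lt_1)
  define Q where "Q = (\<lambda>c. if even c then G N (c div 2) (x i) = x j
                 else circ M (G N (c div 2) (x i)) (x j) (G N (Suc (c div 2)) (x i)))"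
  have sd: "s j - s i - d \<in> \<int>" by (simp add: d_def frac_def)
  \<comment> \<open>Exactly one \<open>c\<close> below \<open>2 * N\<close> qualifies. Larger ones
    may repeat it after full turns, which is why \<open>cod\<close> takes the least.\<close>
  have Q: "Q c \<longleftrightarrow> int c = kap N d" if c: "c < 2 * N" for c
  proof -
    define m where "m = c div 2"
    have m: "m < N" using c by (auto simp: m_def)
    have mN: "real m / real N < 1" "0 \<le> real m / real N" using m N by auto
    show ?thesis
    proof (cases "even c")
      case True
      have "Q c \<longleftrightarrow> s j - (s i + m / N) \<in> \<int>"
        using True s ij N m unfolding shadow_def Q_def m_def[symmetric] by auto
      also have "\<dots> \<longleftrightarrow> (s j - s i) - m / N \<in> \<int>" by (simp add: algebra_simps)
      also have "\<dots> \<longleftrightarrow> d = m / N" using mN frac_unique_iff[of "s j - s i" "real m / real N"] by (auto simp: d_def)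
      also have "\<dots> \<longleftrightarrow> real N * d = m" using N by (auto simp: field_simps)
      also have "\<dots> \<longleftrightarrow> kap N d = 2 * int m"
      proof (rule kap_cases[of N d])
        fix k assume "real N * d = real_of_int k" "kap N d = 2 * k"
        then show ?thesis by (metis mult_cancel_left of_int_eq_iff of_int_of_nat_eq zero_neq_numeral)
      next
        fix k assume k: "real_of_int k < real N * d" "real N * d < real_of_int k + 1" "kap N d = 2 * k + 1"
        have "real N * d \<noteq> m"
        proof
          assume "real N * d = m"
          then have "k < int m" "int m < k + 1" using k by linarith+
          then show False by simp
        qed
        moreover have "2 * k + 1 \<noteq> 2 * int m" by presburger
        ultimately show ?thesis using k(3) by simp
      qed
      also have "2 * int m = int c" using True by (auto simp: m_def)
      finally show ?thesis by auto
    next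
      case False
      have "Q c \<longleftrightarrow> cyc (s i + m / N) (s j) (s i + Suc m / N)"
        using False s ij N m unfolding shadow_def Q_def m_def[symmetric] by auto
      also have "\<dots> \<longleftrightarrow> 0 < frac (s j - s i - m / N) \<and> frac (s j - s i - m / N) < 1 / N"
      proof -
        have "s i + real (Suc m) / N - (s i + m / N) = 1 / N" by (simp add: add_divide_distrib)
        \<comment> \<open>Uses \<open>N \<ge> 2\<close>: for \<open>N = 1\<close> both ends of the
          arc coincide and \<open>cyc\<close> never holds.\<close>
        moreover have "frac (1 / real N) = 1 / N" using N by (subst frac_eq) auto
        ultimately show ?thesis by (simp add: cyc_def algebra_simps)
      qed
      also have "\<dots> \<longleftrightarrow> m / N < d \<and> d < Suc m / N"
      proof (cases "m / N \<le> d")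
        case True
        have e: "s j - s i - m / N - (d - m / N) = s j - s i - d" by simp
        have "frac (s j - s i - m / N) = d - m / N"
        proof (subst frac_unique_iff, intro conjI)
          show "s j - s i - m / N - (d - m / N) \<in> \<int>" unfolding e by (rule sd)
          show "0 \<le> d - m / N" using True by simp
          show "d - m / N < 1" using d mN by linarith
        qed
        then show ?thesis by (simp only: of_nat_Suc add_divide_distrib) auto
      next
        case False
        have "s j - s i - m / N - (d - m / N + 1) = s j - s i - d - 1" by simp
        also have "\<dots> \<in> \<int>" using sd by (metis Ints_1 Ints_diff)
        finally have e: "s j - s i - m / N - (d - m / N + 1) \<in> \<int>" .
        have "frac (s j - s i - m / N) = d - m / N + 1"
        proof (subst frac_unique_iff, intro conjI)
          show "s j - s i - m / N - (d - m / N + 1) \<in> \<int>" by (rule e)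
          show "0 \<le> d - m / N + 1" using d mN by linarith
          show "d - m / N + 1 < 1" using False by linarith
        qed
        moreover have "\<not> d - m / N + 1 < 1 / N"
        proof -
          have "real (Suc m) / N \<le> 1" using m N by auto
          then have "m / N + 1 / N \<le> 1" by (simp add: add_divide_distrib)
          then show ?thesis using d by linarith
        qed
        ultimately show ?thesis using False by auto
      qed
      also have "\<dots> \<longleftrightarrow> real m < real N * d \<and> real N * d < real m + 1" using N by (auto simp: field_simps)
      also have "\<dots> \<longleftrightarrow> kap N d = 2 * int m + 1"
      proof (rule kap_cases[of N d])
        fix k assume k: "real N * d = real_of_int k" "kap N d = 2 * k"
        have "\<not> (real m < real N * d \<and> real N * d < real m + 1)"
        proof
          assume "real m < real N * d \<and> real N * d < real m + 1"
          then have "int m < k" "k < int m + 1" using k(1) by linarith+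
          then show False by simp
        qed
        moreover have "2 * k \<noteq> 2 * int m + 1" by presburger
        ultimately show ?thesis using k(2) by simp
      next
        fix k assume k: "real_of_int k < real N * d" "real N * d < real_of_int k + 1" "kap N d = 2 * k + 1"
        have "real m < real N * d \<and> real N * d < real m + 1 \<longleftrightarrow> k = int m"
        proof
          assume "real m < real N * d \<and> real N * d < real m + 1"
          then have "k < int m + 1" "int m < k + 1" using k by linarith+
          then show "k = int m" by simp
        next
          assume "k = int m"
          then show "real m < real N * d \<and> real N * d < real m + 1" using k by simp
        qed
        then show ?thesis using k by auto
      qed
      also have "2 * int m + 1 = int c" using False by (auto simp: m_def elim: oddE)
      finally show ?thesis by auto
    qed
  qed
  have r: "0 \<le> kap N d" "kap N d < 2 * int N" using kap_range[of d N] d N by auto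
  define c where "c = nat (kap N d)"
  have c: "int c = kap N d" "c < 2 * N" using r by (auto simp: c_def)
  have "(LEAST c. Q c) = c"
  proof (rule Least_equality)
    show "Q c" using Q c by blast
    fix y assume y: "Q y"
    show "c \<le> y"
    proof (rule ccontr)
      assume "\<not> c \<le> y"
      then have "y < 2 * N" using c by simp
      then have "int y = kap N d" using Q y by blast
      then show False using c \<open>\<not> c \<le> y\<close> by linarith
    qed
  qed
  then show ?thesis using c unfolding cod_def Q_def d_def[symmetric] by auto
qed

lemma shadow_cod:
  assumes "shadow K k x s" "i < k" "j < k" "2 \<le> N" "N \<le> K"
  shows "int (cod N (x i) (x j)) = kap N (s j - s i) mod (2 * int N)"
  using shadow_cod_frac[OF assms] kap_frac[of N] assms by simp

lemma rots_0 [simp]: "G n 0 x = x" by (simp add: rots_def)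

lemma shadow_circ:
  assumes "shadow K k x s" "i < k" "j < k" "l < k" "1 \<le> K"
  shows "circ M (x i) (x j) (x l) \<longleftrightarrow> cyc (s i) (s j) (s l)"
proof -
  have "circ M (G 1 0 (x i)) (x j) (G 1 0 (x l)) \<longleftrightarrow> cyc (s i + real 0 / real 1) (s j) (s l + real 0 / real 1)"
    using assms unfolding shadow_def by (metis atLeastAtMost_iff le0 le_refl)
  then show ?thesis by simp
qed

lemma shadow_rots:
  assumes "shadow K k x s" "i < k" "j < k" "1 \<le> n" "n \<le> K" "m \<le> K"
  shows "G n m (x i) = x j \<longleftrightarrow> s j - (s i + m / n) \<in> \<int>"
  using assms unfolding shadow_def by auto

lemma shadow_list:
  assumes "set xs \<subseteq> P" shows "\<exists>s. shadow K (length xs) ((!) xs) s"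
  by (rule shadow_exists) (use assms nth_mem in auto)

lemma cod_lt:
  assumes "x \<in> P" "y \<in> P" "2 \<le> N" shows "cod N x y < 2 * N"
proof -
  obtain s where s: "shadow N (length [x, y]) ((!) [x, y]) s" using shadow_list[of "[x,y]"] assms by auto
  have "int (cod N x y) < 2 * int N"
    using shadow_cod[OF s, of 0 1 N] assms by (simp add: pos_mod_bound)
  then show ?thesis by simp
qed

lemma cod_eq_0: 
  assumes "x \<in> P" "y \<in> P" "2 \<le> N" shows "cod N x y = 0 \<longleftrightarrow> x = y"
proof -
  obtain s where s: "shadow N (length [x, y]) ((!) [x, y]) s" using shadow_list[of "[x,y]"] assms by auto
  have "int (cod N x y) = kap N (frac (s 1 - s 0))"
    using shadow_cod_frac[OF s, of 0 1 N] assms by simp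
  moreover have "G 1 0 x = y \<longleftrightarrow> s 1 - s 0 \<in> \<int>"
    using shadow_rots[OF s, of 0 1 1 0] assms by simp
  moreover have "kap N (frac (s 1 - s 0)) = 0 \<longleftrightarrow> s 1 - s 0 \<in> \<int>"
    using kap_0_iff[of N "s 1 - s 0"] assms by (simp only: frac_eq_0_iff)
  ultimately show ?thesis by (metis of_nat_eq_0_iff rots_0)
qed

lemma cod_swap:
  assumes "x \<in> P" "y \<in> P" "2 \<le> N" shows "int (cod N y x) = (- int (cod N x y)) mod (2 * int N)"
proof -
  obtain s where s: "shadow N (length [x, y]) ((!) [x, y]) s" using shadow_list[of "[x,y]"] assms by auto
  have 1: "int (cod N x y) = kap N (s 1 - s 0) mod (2 * int N)"
    using shadow_cod[OF s, of 0 1 N] assms by simp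
  have 2: "int (cod N y x) = kap N (s 0 - s 1) mod (2 * int N)"
    using shadow_cod[OF s, of 1 0 N] assms by simp
  have "kap N (s 0 - s 1) = - kap N (s 1 - s 0)" using kap_uminus[of N "s 1 - s 0"] by simp
  then show ?thesis unfolding 1 2 by (simp add: mod_minus_eq)
qed

text \<open>A rotation by \<open>m / n\<close> with \<open>n dvd N\<close> moves division points of
  level \<open>N\<close> to division points, so it shifts codes by an even amount.\<close>

lemma cod_rot_right:
  assumes "x \<in> P" "y \<in> P" "2 \<le> N" "n dvd N" 
  shows "int (cod N x (G n m y)) = (int (cod N x y) + 2 * int (m * (N div n))) mod (2 * int N)"
proof -
  define K where "K = N + m"
  have n: "1 \<le> n" "n \<le> N" using assms by (auto intro: dvd_imp_le Suc_leI elim: dvdE intro!: Nat.gr0I)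
  obtain s where s: "shadow K (length [x, y, G n m y]) ((!) [x, y, G n m y]) s"
    using shadow_list[of "[x,y,G n m y]"] assms by auto
  have 1: "int (cod N x y) = kap N (s 1 - s 0) mod (2 * int N)"
    using shadow_cod[OF s, of 0 1 N] assms by (simp add: K_def)
  have 2: "int (cod N x (G n m y)) = kap N (s 2 - s 0) mod (2 * int N)"
    using shadow_cod[OF s, of 0 2 N] assms by (simp add: K_def)
  have 3: "s 2 - (s 1 + m / n) \<in> \<int>"
    using shadow_rots[OF s, of 1 2 n m] n by (simp add: K_def)
  have "kap N (s 2 - s 0) mod (2 * int N) = kap N ((s 1 - s 0) + m / n) mod (2 * int N)"
    by (rule kap_mod) (use 3 assms in \<open>auto simp: algebra_simps\<close>)
  also have "kap N ((s 1 - s 0) + m / n) = kap N (s 1 - s 0) + 2 * int (m * (N div n))"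
    by (rule kap_add) (use assms n in \<open>auto simp: real_of_nat_div\<close>)
  finally show ?thesis unfolding 1 2 by (simp add: mod_add_left_eq)
qed

lemma cod_rot_left:
  assumes "x \<in> P" "y \<in> P" "2 \<le> N" "n dvd N"
  shows "int (cod N (G n m x) y) = (int (cod N x y) - 2 * int (m * (N div n))) mod (2 * int N)"
proof -
  have "int (cod N (G n m x) y) = (- int (cod N y (G n m x))) mod (2 * int N)"
    using cod_swap[of y "G n m x"] assms by simp
  also have "\<dots> = (- (int (cod N y x) + 2 * int (m * (N div n)))) mod (2 * int N)"
    using cod_rot_right[of y x N n m] assms by (simp only: mod_minus_eq)
  also have "\<dots> = (- ((- int (cod N x y)) mod (2 * int N) + 2 * int (m * (N div n)))) mod (2 * int N)"
    using cod_swap[of x y N] assms by simp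
  also have "\<dots> = (- (- int (cod N x y) + 2 * int (m * (N div n)))) mod (2 * int N)"
    by (metis mod_add_left_eq mod_minus_eq)
  finally show ?thesis by (simp add: algebra_simps)
qed

lemma cod_self: "x \<in> P \<Longrightarrow> 2 \<le> N \<Longrightarrow> cod N x x = 0"
  using cod_eq_0 by blast

lemma cod_rots_self:
  assumes "x \<in> P" "2 \<le> N" "m < N" shows "cod N x (G N m x) = 2 * m"
proof -
  have "int (cod N x (G N m x)) = int (2 * m)" using cod_rot_right[of x x N N m] cod_self[of x N] assms by simp
  then show ?thesis by (simp only: of_nat_eq_iff)
qed

lemma cod_unrot:
  assumes "x \<in> P" "y \<in> P" "2 \<le> N" "cod N x y = 2 * m + c" shows "cod N (G N m x) y = c"
proof -
  have "int (cod N (G N m x) y) = int c mod (2 * int N)" using cod_rot_left[of x y N N m] assms by simp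
  moreover have "c < 2 * N" using cod_lt[of x y N] assms by simp
  ultimately show ?thesis by simp
qed

text \<open>Different codes from \<open>x\<close> decide the order. Equal positive codes of distinct
  points mean that both lie in the same open cell, and then code 1 from \<open>y\<close> to
  \<open>z\<close> says that \<open>y\<close> comes first. So the ternary relation is determined by
  codes of pairs.\<close>

lemma circ_cod:
  assumes "x \<in> P" "y \<in> P" "z \<in> P" "2 \<le> N"
  shows "circ M x y z \<longleftrightarrow> 0 < cod N x y \<and> (cod N x y < cod N x z \<or> cod N x y = cod N x z \<and> cod N y z = 1)"
proof -
  obtain s where s: "shadow N (length [x, y, z]) ((!) [x, y, z]) s" using shadow_list[of "[x,y,z]"] assms by auto
  define f where "f = frac (s 1 - s 0)" 
  define h where "h = frac (s 2 - s 0)" 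
  have N: "N > 0" using assms by auto
  have 1: "int (cod N x y) = kap N f" using shadow_cod_frac[OF s, of 0 1 N] assms by (simp add: f_def)
  have 2: "int (cod N x z) = kap N h" using shadow_cod_frac[OF s, of 0 2 N] assms by (simp add: h_def)
  have "int (cod N y z) = kap N (s 2 - s 1) mod (2 * int N)" using shadow_cod[OF s, of 1 2 N] assms by simp
  also have "\<dots> = kap N (h - f) mod (2 * int N)"
  proof (rule kap_mod[OF N])
    have "s 2 - s 1 - (h - f) = of_int (\<lfloor>s 2 - s 0\<rfloor> - \<lfloor>s 1 - s 0\<rfloor>)" by (simp add: h_def f_def frac_def)
    then show "s 2 - s 1 - (h - f) \<in> \<int>" by (metis Ints_of_int)
  qed
  finally have 3: "int (cod N y z) = kap N (h - f) mod (2 * int N)" .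
  have f0: "0 \<le> f" by (simp add: f_def)
  have pos: "0 < f \<longleftrightarrow> 0 < cod N x y"
    using kap_0_iff[OF N, of "s 1 - s 0"] 1 f0 unfolding f_def[symmetric] by linarith
  have "circ M x y z \<longleftrightarrow> 0 < f \<and> f < h" using shadow_circ[OF s, of 0 1 2] assms by (simp add: cyc_def f_def h_def)
  also have "f < h \<longleftrightarrow> (cod N x y < cod N x z \<or> cod N x y = cod N x z \<and> cod N y z = 1)"
  proof
    assume fh: "f < h"
    show "cod N x y < cod N x z \<or> cod N x y = cod N x z \<and> cod N y z = 1"
    proof (cases "cod N x y = cod N x z")
      case True
      then have "kap N (h - f) = 1" using kap_eq_close[OF _ fh N] 1 2 by simp
      then show ?thesis using True 3 assms by simp
    next
      case False
      then show ?thesis using kap_mono[of f h N] fh 1 2 by simp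
    qed
  next
    assume "cod N x y < cod N x z \<or> cod N x y = cod N x z \<and> cod N y z = 1"
    then show "f < h"
    proof
      assume "cod N x y < cod N x z"
      then show "f < h" using kap_mono[of h f N] 1 2 by linarith
    next
      assume e: "cod N x y = cod N x z \<and> cod N y z = 1"
      show "f < h"
      proof (rule ccontr)
        assume "\<not> f < h"
        then consider "f = h" | "h < f" by linarith
        then show False
        proof cases
          case 1 then show False using 3 e by (simp add: kap_def)
        next
          case 2
          \<comment> \<open>In the wrong order the code from \<open>y\<close> to \<open>z\<close>
            would be \<open>2 * N - 1\<close>, which is not 1 as \<open>N \<ge> 2\<close>.\<close>
          have "kap N (f - h) = 1" using kap_eq_close[OF _ 2 N] e 1 \<open>int (cod N x z) = kap N h\<close> by simp
          then have "kap N (h - f) = - 1" using kap_uminus[of N "f - h"] by simp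
          moreover have "(- 1) mod (2 * int N) = 2 * int N - 1" using N by (simp add: zmod_minus1)
          ultimately show False using 3 e assms by simp
        qed
      qed
    qed
  qed
  finally show ?thesis using pos by simp
qed

lemma cod_dvd:
  assumes "x \<in> P" "y \<in> P" "x' \<in> P" "y' \<in> P" "2 \<le> n" "n dvd N" "N > 0"
    and "cod N x y = cod N x' y'"
  shows "cod n x y = cod n x' y'"
proof -
  from assms(6) obtain k where "N = n * k" by (rule dvdE)
  then have k: "N = k * n" "k > 0" using assms(7) by auto
  have nN: "n \<le> N" using assms(6,7) by (rule dvd_imp_le)
  then have N: "2 \<le> N" "n \<le> N" using assms(5) by linarith+
  have "\<exists>d. int (cod N x y) = kap N d \<and> int (cod n x y) = kap n d" if xy: "x \<in> P" "y \<in> P" for x y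
  proof -
    obtain s where s: "shadow N (length [x, y]) ((!) [x, y]) s" using shadow_list[of "[x,y]" N] xy by auto
    show ?thesis
      using shadow_cod_frac[OF s, of 0 1 N] shadow_cod_frac[OF s, of 0 1 n] N assms
      by (intro exI[of _ "frac (s 1 - s 0)"]) simp
  qed
  then obtain d d' where "int (cod N x y) = kap N d" "int (cod n x y) = kap n d"
    "int (cod N x' y') = kap N d'" "int (cod n x' y') = kap n d'" using assms by metis
  then have "int (cod n x y) = int (cod n x' y')" using kap_dvd[OF k, of d] kap_dvd[OF k, of d'] assms(8) by simp
  then show ?thesis by simp
qed

end

text \<open>Totality and transitivity are asked on \<open>A\<close> only: being at most one code
  step ahead is an order within a short arc, not on the whole circle.\<close>

lemma finite_greatest:
  assumes "finite A" "A \<noteq> {}" and tot: "\<And>x y. x \<in> A \<Longrightarrow> y \<in> A \<Longrightarrow> R x y \<or> R y x"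
    and tr: "\<And>x y z. x \<in> A \<Longrightarrow> y \<in> A \<Longrightarrow> z \<in> A \<Longrightarrow> R x y \<Longrightarrow> R y z \<Longrightarrow> R x z"
  shows "\<exists>u\<in>A. \<forall>x\<in>A. R x u"
  using assms
proof (induction A rule: finite_ne_induct)
  case (singleton x) then show ?case by blast
next
  case (insert x F)
  have "\<exists>u\<in>F. \<forall>x\<in>F. R x u"
    by (rule insert.IH) (use insert.prems in blast)+
  then obtain u where u: "u \<in> F" "\<forall>y\<in>F. R y u" by blast
  show ?case
  proof (cases "R x u")
    case True then show ?thesis using u by blast
  next
    case False
    then have "R u x" "R x x" using insert.prems(1) u(1) by blast+
    then have "\<forall>y\<in>insert x F. R y x" using u insert.prems(2) by blast
    then show ?thesis by blast
  qed
qed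

lemma frac_diff_small:
  fixes a b :: real
  assumes "frac b \<le> frac a" shows "frac (a - b) = frac a - frac b"
proof (subst frac_unique_iff, intro conjI)
  have "a - b - (frac a - frac b) = of_int (\<lfloor>a\<rfloor> - \<lfloor>b\<rfloor>)" by (simp add: frac_def)
  then show "a - b - (frac a - frac b) \<in> \<int>" by (metis Ints_of_int)
  show "0 \<le> frac a - frac b" using assms by simp
  show "frac a - frac b < 1" using frac_lt_1[of a] frac_ge_0[of b] by linarith
qed

lemma frac_add_small:
  fixes a b :: real
  assumes "frac a + frac b < 1" shows "frac (a + b) = frac a + frac b"
  using assms by (simp add: frac_add)

section \<open>One-point extension of code-preserving maps\<close>

context circle_model
begin

text \<open>A sentence that holds on the unit circle because of midpoints of arcs.\<close>

lemma dense:
  assumes "x \<in> P" "y \<in> P" "x \<noteq> y" shows "\<exists>z\<in>P. circ M x z y"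
proof -
  define \<phi> where "\<phi> = FNot (FExs [0, 1] (FAnd (FNot (FEq (Var 0) (Var 1)))
     (FNot (FEx 2 (FS (Var 0) (Var 2) (Var 1))))))"
  have "sat M (\<lambda>_. x) \<phi>"
  proof (rule transfer_sentence)
    show "fv \<phi> = {}" by (auto simp: \<phi>_def fv_FExs)
    show "range (\<lambda>_::nat. x) \<subseteq> P" using assms by auto
    fix v :: "nat \<Rightarrow> complex"
    have "\<exists>z\<in>points unit_circle. circ unit_circle (w 0) z (w 1)"
      if w: "\<forall>i\<in>{0,1}. w i \<in> points unit_circle" "w 0 \<noteq> w 1" for w :: "nat \<Rightarrow> complex"
    proof -
      from w obtain a b where ab: "w 0 = cpt a" "w 1 = cpt b" by (auto simp: points_unit)
      let ?f = "frac (b - a)"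
      have f: "0 < ?f" using w(2) ab by (simp add: cpt_eq_iff)
      have "frac (?f / 2) = ?f / 2" using f frac_lt_1[of "b - a"] by (subst frac_eq) auto
      then have "frac (a + ?f / 2 - a) = ?f / 2" by simp
      then have "cyc a (a + ?f / 2) b" unfolding cyc_def using f by (intro conjI; linarith)
      then have "circ unit_circle (w 0) (cpt (a + ?f / 2)) (w 1)" unfolding ab by (simp only: circ_unit)
      then show ?thesis by (auto simp: points_unit)
    qed
    then show "sat unit_circle v \<phi>" by (auto simp: \<phi>_def sat_FExs)
  qed
  then show ?thesis using assms unfolding \<phi>_def
    by (auto simp: sat_FExs dest!: spec[of _ "\<lambda>i. if i = 0 then x else if i = 1 then y else x"])
qed

lemma shadow_near:
  assumes s: "shadow K k x s" and ij: "i < k" "j < k" and N: "2 \<le> N" "N \<le> K"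
  shows "cod N (x i) (x j) \<le> 1 \<longleftrightarrow> frac (s j - s i) < 1 / N"
    and "cod N (x i) (x j) = 1 \<longleftrightarrow> 0 < frac (s j - s i) \<and> frac (s j - s i) < 1 / N"
proof -
  have c: "int (cod N (x i) (x j)) = kap N (frac (s j - s i))" by (rule shadow_cod_frac[OF assms])
  have N0: "N > 0" using N by simp
  show 1: "cod N (x i) (x j) = 1 \<longleftrightarrow> 0 < frac (s j - s i) \<and> frac (s j - s i) < 1 / N"
    using kap_1_iff[OF N0, of "s j - s i"] c by linarith
  have "cod N (x i) (x j) = 0 \<longleftrightarrow> frac (s j - s i) = 0"
    using kap_0_iff[OF N0, of "s j - s i"] c by linarith
  moreover have "cod N (x i) (x j) \<le> 1 \<longleftrightarrow> cod N (x i) (x j) = 0 \<or> cod N (x i) (x j) = 1" by linarith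
  moreover have "0 < 1 / real N" using N0 by simp
  ultimately show "cod N (x i) (x j) \<le> 1 \<longleftrightarrow> frac (s j - s i) < 1 / N"
    using 1 frac_ge_0[of "s j - s i"] by linarith
qed

text \<open>Both points precede \<open>x\<close> by less than \<open>1 / N\<close>, so the one
  farther from \<open>x\<close> precedes the other by less than \<open>1 / N\<close>.\<close>

lemma near_total:
  assumes "p \<in> P" "q \<in> P" "x \<in> P" "2 \<le> N" "cod N p x = 1" "cod N q x = 1"
  shows "cod N p q \<le> 1 \<or> cod N q p \<le> 1"
proof -
  obtain s where s: "shadow N (length [p, q, x]) ((!) [p, q, x]) s" using shadow_list[of "[p,q,x]" N] assms by auto
  have 1: "frac (s 2 - s 0) < 1 / N" using shadow_near(2)[OF s, of 0 2 N] assms by simp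
  have 2: "frac (s 2 - s 1) < 1 / N" using shadow_near(2)[OF s, of 1 2 N] assms by simp
  have "frac (s 1 - s 0) < 1 / N \<or> frac (s 0 - s 1) < 1 / N"
  proof (cases "frac (s 2 - s 1) \<le> frac (s 2 - s 0)")
    case True
    have "frac (s 1 - s 0) = frac (s 2 - s 0) - frac (s 2 - s 1)" using frac_diff_small[OF True] by simp
    then show ?thesis using 1 frac_ge_0[of "s 2 - s 1"] by linarith
  next
    case False
    then have "frac (s 2 - s 0) \<le> frac (s 2 - s 1)" by simp
    from frac_diff_small[OF this] have "frac (s 0 - s 1) = frac (s 2 - s 1) - frac (s 2 - s 0)" by simp
    then show ?thesis using 2 frac_ge_0[of "s 2 - s 0"] by linarith
  qed
  then show ?thesis using shadow_near(1)[OF s, of 0 1 N] shadow_near(1)[OF s, of 1 0 N] assms by simp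
qed

lemma two_over: "2 \<le> N \<Longrightarrow> 1 / real N + 1 / real N \<le> 1"
  by (simp add: field_simps)

text \<open>Two steps shorter than \<open>1 / N\<close> could add up to more. Here the way from
  \<open>p\<close> through \<open>q\<close> to \<open>r\<close> is part of the way from
  \<open>p\<close> to \<open>x\<close>, which is shorter than \<open>1 / N\<close>.\<close>

lemma near_trans:
  assumes "p \<in> P" "q \<in> P" "r \<in> P" "x \<in> P" "2 \<le> N" "cod N p x = 1" "cod N q x = 1" "cod N r x = 1"
    and "cod N p q \<le> 1" "cod N q r \<le> 1"
  shows "cod N p r \<le> 1"
proof -
  obtain s where s: "shadow N (length [p, q, r, x]) ((!) [p, q, r, x]) s"
    using shadow_list[of "[p,q,r,x]" N] assms by auto
  note N = two_over[OF \<open>2 \<le> N\<close>]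
  have pq: "frac (s 1 - s 0) < 1 / N" using shadow_near(1)[OF s, of 0 1 N] assms by simp
  have qr: "frac (s 2 - s 1) < 1 / N" using shadow_near(1)[OF s, of 1 2 N] assms by simp
  have px: "frac (s 3 - s 0) < 1 / N" using shadow_near(2)[OF s, of 0 3 N] assms by simp
  have qx: "frac (s 3 - s 1) < 1 / N" using shadow_near(2)[OF s, of 1 3 N] assms by simp
  have rx: "frac (s 3 - s 2) < 1 / N" using shadow_near(2)[OF s, of 2 3 N] assms by simp
  have "frac ((s 2 - s 1) + (s 3 - s 2)) = frac (s 2 - s 1) + frac (s 3 - s 2)"
    by (rule frac_add_small) (use qr rx N in linarith)
  moreover have "frac ((s 1 - s 0) + (s 3 - s 1)) = frac (s 1 - s 0) + frac (s 3 - s 1)"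
    by (rule frac_add_small) (use pq qx N in linarith)
  ultimately have "frac (s 3 - s 0) = frac (s 1 - s 0) + (frac (s 2 - s 1) + frac (s 3 - s 2))" by simp
  then have sum: "frac (s 1 - s 0) + frac (s 2 - s 1) < 1 / N"
    using px frac_ge_0[of "s 3 - s 2"] by linarith
  have "frac ((s 1 - s 0) + (s 2 - s 1)) = frac (s 1 - s 0) + frac (s 2 - s 1)"
    by (rule frac_add_small) (use pq qr N in linarith)
  then have "frac (s 2 - s 0) < 1 / N" using sum by simp
  then show ?thesis using shadow_near(1)[OF s, of 0 2 N] assms by simp
qed

text \<open>Going clockwise one meets \<open>w\<close>, \<open>p\<close>, \<open>u\<close>,
  \<open>y\<close> and then \<open>w\<close> rotated by \<open>1 / N\<close>. In
  \<open>Gd_extend\<close> the points \<open>w\<close> and \<open>u\<close> are the first and the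
  last of a finite set, so one \<open>y\<close> serves all members \<open>p\<close> at once.\<close>

lemma near_between:
  assumes "w \<in> P" "p \<in> P" "u \<in> P" "y \<in> P" "2 \<le> N"
    and "cod N w p \<le> 1" "cod N p u \<le> 1" "cod N w u \<le> 1" "circ M u y (G N 1 w)"
  shows "cod N p y = 1"
proof -
  obtain s where s: "shadow N (length [w, p, u, y, G N 1 w]) ((!) [w, p, u, y, G N 1 w]) s"
    using shadow_list[of "[w,p,u,y,G N 1 w]" N] assms by auto
  note N = two_over[OF \<open>2 \<le> N\<close>]
  have wp: "frac (s 1 - s 0) < 1 / N" using shadow_near(1)[OF s, of 0 1 N] assms by simp
  have pu: "frac (s 2 - s 1) < 1 / N" using shadow_near(1)[OF s, of 1 2 N] assms by simp
  have wu: "frac (s 2 - s 0) < 1 / N" using shadow_near(1)[OF s, of 0 2 N] assms by simp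
  have g: "s 4 - (s 0 + 1 / N) \<in> \<int>" using shadow_rots[OF s, of 0 4 N 1] assms by simp
  have c: "0 < frac (s 3 - s 2)" "frac (s 3 - s 2) < frac (s 4 - s 2)"
    using shadow_circ[OF s, of 2 3 4] assms by (auto simp: cyc_def)
  have "frac ((s 1 - s 0) + (s 2 - s 1)) = frac (s 1 - s 0) + frac (s 2 - s 1)"
    by (rule frac_add_small) (use wp pu N in linarith)
  then have wu': "frac (s 2 - s 0) = frac (s 1 - s 0) + frac (s 2 - s 1)" by simp
  have "frac (s 4 - s 2) = 1 / N - frac (s 2 - s 0)"
  proof (subst frac_unique_iff, intro conjI)
    have "s 4 - s 2 - (1 / N - frac (s 2 - s 0)) = (s 4 - (s 0 + 1 / N)) - of_int \<lfloor>s 2 - s 0\<rfloor>"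
      by (simp add: frac_def)
    then show "s 4 - s 2 - (1 / N - frac (s 2 - s 0)) \<in> \<int>" using g by (metis Ints_diff Ints_of_int)
    show "0 \<le> 1 / N - frac (s 2 - s 0)" using wu by simp
    have "0 < 1 / real N" using assms(5) by simp
    then show "1 / N - frac (s 2 - s 0) < 1" using frac_ge_0[of "s 2 - s 0"] N by linarith
  qed
  then have u: "frac (s 2 - s 1) + frac (s 3 - s 2) < 1 / N" using c wu' frac_ge_0[of "s 1 - s 0"] by linarith
  moreover have "1 / real N \<le> 1" using assms(5) by simp
  ultimately have "frac ((s 2 - s 1) + (s 3 - s 2)) = frac (s 2 - s 1) + frac (s 3 - s 2)"
    by (intro frac_add_small) linarith
  then have "frac (s 3 - s 1) = frac (s 2 - s 1) + frac (s 3 - s 2)" by simp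
  then have "0 < frac (s 3 - s 1) \<and> frac (s 3 - s 1) < 1 / N"
    using u c frac_ge_0[of "s 2 - s 1"] by (intro conjI; linarith)
  then show ?thesis using shadow_near(2)[OF s, of 1 3 N] assms by simp
qed

text \<open>Finite partial isomorphisms of level \<open>N\<close>: by \<open>circ_cod\<close> and
  the rotation rules, pairs suffice. Taking relations rather than functions makes converse and
  composition available directly.\<close>

definition Gd :: "nat \<Rightarrow> ('a \<times> 'a) set \<Rightarrow> bool" where
  "Gd N H \<longleftrightarrow> finite H \<and> H \<subseteq> P \<times> P \<and> (\<forall>(x, x')\<in>H. \<forall>(y, y')\<in>H. cod N x y = cod N x' y')"

lemma GdD: "Gd N H \<Longrightarrow> (x, x') \<in> H \<Longrightarrow> (y, y') \<in> H \<Longrightarrow> cod N x y = cod N x' y'"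
  by (fastforce simp: Gd_def)

lemma Gd_in: "Gd N H \<Longrightarrow> (x, x') \<in> H \<Longrightarrow> x \<in> P \<and> x' \<in> P"
  by (auto simp: Gd_def)

lemma Gd_converse: "Gd N H \<Longrightarrow> Gd N (H\<inverse>)"
  by (fastforce simp: Gd_def)

lemma Gd_comp:
  assumes "Gd N H" "Gd N H'" shows "Gd N (H O H')"
proof -
  have "cod N x y = cod N x' y'" if "(x, x') \<in> H O H'" "(y, y') \<in> H O H'" for x x' y y'
  proof -
    from that obtain u w where "(x, u) \<in> H" "(u, x') \<in> H'" "(y, w) \<in> H" "(w, y') \<in> H'" by blast
    then show ?thesis using GdD[OF assms(1), of x u y w] GdD[OF assms(2), of u x' w y'] by simp
  qed
  moreover have "finite (H O H')" using assms by (auto simp: Gd_def intro: finite_relcomp)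
  moreover have "H O H' \<subseteq> P \<times> P" using assms by (auto simp: Gd_def)
  ultimately show ?thesis unfolding Gd_def by blast
qed

lemma Gd_Id_on: "finite D \<Longrightarrow> D \<subseteq> P \<Longrightarrow> Gd N (Id_on D)"
  by (auto simp: Gd_def Id_on_def)

lemma Gd_dvd: "Gd N H \<Longrightarrow> 2 \<le> n \<Longrightarrow> n dvd N \<Longrightarrow> N > 0 \<Longrightarrow> Gd n H"
  unfolding Gd_def by (auto intro!: cod_dvd[of _ _ _ _ n N])

lemma cod_swap_eq:
  assumes "x \<in> P" "y \<in> P" "x' \<in> P" "y' \<in> P" "2 \<le> N" "cod N x y = cod N x' y'"
  shows "cod N y x = cod N y' x'"
  using cod_swap[of x y N] cod_swap[of x' y' N] assms by simp

lemma Gd_insertI: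
  assumes "Gd N H" "2 \<le> N" "x \<in> P" "x' \<in> P" "\<And>z z'. (z, z') \<in> H \<Longrightarrow> cod N z x = cod N z' x'"
  shows "Gd N (insert (x, x') H)"
proof -
  have "cod N x z = cod N x' z'" if "(z, z') \<in> H" for z z'
    using cod_swap_eq[of z x z' x' N] assms Gd_in[OF assms(1) that] that by simp
  moreover have "cod N x x = cod N x' x'" using cod_eq_0[of x x N] cod_eq_0[of x' x' N] assms by simp
  ultimately show ?thesis using assms unfolding Gd_def by auto
qed

lemma cod_rot_cong:
  assumes "x \<in> P" "y \<in> P" "x' \<in> P" "y' \<in> P" "2 \<le> N" "n dvd N" "n' dvd N" "cod N x y = cod N x' y'"
  shows "cod N (G n m x) (G n' m' y) = cod N (G n m x') (G n' m' y')"
proof -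
  have "int (cod N (G n m x) (G n' m' y)) = int (cod N (G n m x') (G n' m' y'))"
    using assms by (simp add: cod_rot_left cod_rot_right)
  then show ?thesis by simp
qed

lemma cod_rot_left_cancel:
  assumes "x \<in> P" "y \<in> P" "x' \<in> P" "y' \<in> P" "2 \<le> N" "cod N (G N m x) y = cod N (G N m x') y'"
  shows "cod N x y = cod N x' y'"
proof -
  have "(int (cod N x y) - 2 * int (m * (N div N))) mod (2 * int N) =
      (int (cod N x' y') - 2 * int (m * (N div N))) mod (2 * int N)"
    using assms cod_rot_left[of x y N N m] cod_rot_left[of x' y' N N m] by simp
  then have "int (cod N x y) mod (2 * int N) = int (cod N x' y') mod (2 * int N)"
    by (simp add: mod_eq_dvd_iff)
  moreover have "cod N x y < 2 * N" "cod N x' y' < 2 * N" using cod_lt assms by auto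
  ultimately show ?thesis by simp
qed

text \<open>If \<open>x\<close> is a domain point rotated by a multiple of \<open>1 / N\<close>, its
  image is forced. Otherwise every domain point is rotated to the last division point before
  \<open>x\<close>. These lie in an arc shorter than \<open>1 / N\<close>, and the image of
  \<open>x\<close> may be any point after all of their images and before the next division point of
  each. Density supplies one.\<close>

lemma Gd_extend:
  assumes H: "Gd N H" and N: "2 \<le> N" and x: "x \<in> P"
  shows "\<exists>x'\<in>P. Gd N (insert (x, x') H)"
proof (cases "H = {}")
  case True
  then show ?thesis using x by (intro bexI[of _ x]) (auto simp: Gd_def)
next
  case ne: False
  note inP = Gd_in[OF H]
  show ?thesis
  proof (cases "\<exists>(z, z')\<in>H. even (cod N z x)")
    case True
    then obtain z z' where z: "(z, z') \<in> H" "even (cod N z x)" by auto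
    define m where "m = cod N z x div 2"
    have "cod N (G N m z) x = 0" by (rule cod_unrot) (use inP[OF z(1)] N x z(2) in \<open>auto simp: m_def\<close>)
    then have xm: "x = G N m z" using cod_eq_0[of "G N m z" x N] inP[OF z(1)] N x by auto
    have "Gd N (insert (x, G N m z') H)"
    proof (rule Gd_insertI[OF H N x])
      show "G N m z' \<in> P" using inP[OF z(1)] by simp
      fix w w' assume w: "(w, w') \<in> H"
      show "cod N w x = cod N w' (G N m z')"
        using cod_rot_cong[of w z w' z' N N N 0 m] inP[OF z(1)] inP[OF w] GdD[OF H w z(1)] N
        by (simp add: xm)
    qed
    then show ?thesis using inP[OF z(1)] by (intro bexI[of _ "G N m z'"]) auto
  next
    case False
    then have odd: "odd (cod N z x)" if "(z, z') \<in> H" for z z' using that by auto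
    define m where "m = (\<lambda>z. cod N z x div 2)"
    define q where "q = (\<lambda>(z, z' :: 'a). G N (m z) z)"
    define q' where "q' = (\<lambda>(z, z'). G N (m z) z')"
    have qP: "q a \<in> P" "q' a \<in> P" if "a \<in> H" for a
      using that inP by (auto simp: q_def q'_def split: prod.splits)
    have qx: "cod N (q a) x = 1" if "a \<in> H" for a
    proof -
      obtain z z' where a: "a = (z, z')" by (cases a)
      have "cod N (G N (m z) z) x = 1"
        by (rule cod_unrot) (use odd[of z z'] inP[of z z'] that a N x in \<open>auto simp: m_def elim: oddE\<close>)
      then show ?thesis using a by (simp add: q_def)
    qed
    have qq: "cod N (q a) (q b) = cod N (q' a) (q' b)" if "a \<in> H" "b \<in> H" for a b
    proof -
      obtain z z' w w' where a: "a = (z, z')" "b = (w, w')" by (cases a, cases b)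
      show ?thesis unfolding a q_def q'_def prod.case
        using that inP[of z z'] inP[of w w'] a N by (intro cod_rot_cong) (auto intro: GdD[OF H])
    qed
    have fin: "finite H" using H by (simp add: Gd_def)
    have "\<exists>u\<in>H. \<forall>a\<in>H. cod N (q a) (q u) \<le> 1"
      using fin ne
    proof (rule finite_greatest)
      fix a b assume "a \<in> H" "b \<in> H"
      then show "cod N (q a) (q b) \<le> 1 \<or> cod N (q b) (q a) \<le> 1"
        by (intro near_total[OF qP(1) qP(1) x N qx qx])
    next
      fix a b c assume "a \<in> H" "b \<in> H" "c \<in> H" "cod N (q a) (q b) \<le> 1" "cod N (q b) (q c) \<le> 1"
      then show "cod N (q a) (q c) \<le> 1"
        by (intro near_trans[OF qP(1)[of a] qP(1)[of b] qP(1)[of c] x N qx qx qx])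
    qed
    then obtain u where u: "u \<in> H" "\<And>a. a \<in> H \<Longrightarrow> cod N (q a) (q u) \<le> 1" by blast
    have "\<exists>w\<in>H. \<forall>a\<in>H. cod N (q w) (q a) \<le> 1"
      using fin ne
    proof (rule finite_greatest)
      fix a b assume "a \<in> H" "b \<in> H"
      then show "cod N (q b) (q a) \<le> 1 \<or> cod N (q a) (q b) \<le> 1"
        by (intro near_total[OF qP(1) qP(1) x N qx qx])
    next
      fix a b c assume "a \<in> H" "b \<in> H" "c \<in> H" "cod N (q b) (q a) \<le> 1" "cod N (q c) (q b) \<le> 1"
      then show "cod N (q c) (q a) \<le> 1"
        by (intro near_trans[OF qP(1)[of c] qP(1)[of b] qP(1)[of a] x N qx qx qx])
    qed
    then obtain w where w: "w \<in> H" "\<And>a. a \<in> H \<Longrightarrow> cod N (q w) (q a) \<le> 1" by blast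
    \<comment> \<open>The arc for the new point is not empty: otherwise the code from
      \<open>q' w\<close> to \<open>q' u\<close> would be 2, while the code from \<open>q w\<close>
      to \<open>q u\<close> is at most 1.\<close>
    have "q' u \<noteq> G N 1 (q' w)"
    proof
      assume e: "q' u = G N 1 (q' w)"
      have "cod N (q' w) (q' u) = 2" using cod_rots_self[of "q' w" N 1] qP w(1) N e by simp
      then show False using qq[OF w(1) u(1)] u(2)[OF w(1)] by simp
    qed
    then obtain y where y: "y \<in> P" "circ M (q' u) y (G N 1 (q' w))"
      using dense[of "q' u" "G N 1 (q' w)"] qP u w by auto
    have "Gd N (insert (x, y) H)"
    proof (rule Gd_insertI[OF H N x y(1)])
      fix z z' assume z: "(z, z') \<in> H"
      have "cod N (q' (z, z')) y = 1"
      proof (rule near_between[OF qP(2)[OF w(1)] qP(2)[OF z] qP(2)[OF u(1)] y(1) N _ _ _ y(2)])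
        show "cod N (q' w) (q' (z, z')) \<le> 1" using qq[OF w(1) z] w(2)[OF z] by simp
        show "cod N (q' (z, z')) (q' u) \<le> 1" using qq[OF z u(1)] u(2)[OF z] by simp
        show "cod N (q' w) (q' u) \<le> 1" using qq[OF w(1) u(1)] w(2)[OF u(1)] by simp
      qed
      then have "cod N (G N (m z) z') y = cod N (G N (m z) z) x"
        using qx[OF z] by (simp add: q_def q'_def)
      then show "cod N z x = cod N z' y"
        using cod_rot_left_cancel[of z' y z x N "m z"] inP[OF z] x y N by simp
    qed
    then show ?thesis using y(1) by blast
  qed
qed

lemma Gd_extend_list:
  assumes "Gd N H" "2 \<le> N" "set xs \<subseteq> P"
  shows "\<exists>xs' H'. Gd N H' \<and> H \<subseteq> H' \<and> list_all2 (\<lambda>x x'. (x, x') \<in> H') xs xs'"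
  using assms(3)
proof (induction xs)
  case Nil then show ?case using assms by auto
next
  case (Cons x xs)
  then obtain xs' H' where IH: "Gd N H'" "H \<subseteq> H'" "list_all2 (\<lambda>x x'. (x, x') \<in> H') xs xs'" by auto
  obtain x' where "Gd N (insert (x, x') H')" using Gd_extend[OF IH(1) assms(2)] Cons.prems by auto
  then show ?case using IH
    by (intro exI[of _ "x' # xs'"] exI[of _ "insert (x, x') H'"]) (auto elim!: list_all2_mono)
qed


section \<open>Standard angles\<close>

text \<open>In full turns; level \<open>n\<close> has \<open>2 * n\<close> codes, hence the
  denominator. A point with code \<open>2 * n - 1\<close> at every level is infinitely close before
  \<open>x\<close> and gets angle 1, so values are meaningful modulo 1 only.\<close>

definition ang :: "'a \<Rightarrow> 'a \<Rightarrow> real" where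
  "ang x y = lim (\<lambda>n. real (cod n x y) / (2 * real n))"

lemma shadow_cod_approx:
  assumes "shadow K k x s" "i < k" "j < k" "2 \<le> N" "N \<le> K"
  shows "\<bar>real (cod N (x i) (x j)) / (2 * real N) - frac (s j - s i)\<bar> \<le> 1 / (2 * real N)"
proof -
  let ?d = "frac (s j - s i)"
  have "real (cod N (x i) (x j)) = of_int (kap N ?d)"
    using shadow_cod_frac[OF assms] by (metis of_int_of_nat_eq)
  then have "\<bar>real (cod N (x i) (x j)) - 2 * real N * ?d\<bar> \<le> 1"
    using kap_bounds[of N ?d] by linarith
  then have "\<bar>real (cod N (x i) (x j)) - 2 * real N * ?d\<bar> / (2 * real N) \<le> 1 / (2 * real N)"
    by (rule divide_right_mono) simp
  moreover have "\<bar>real (cod N (x i) (x j)) - 2 * real N * ?d\<bar> / (2 * real N) =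
      \<bar>(real (cod N (x i) (x j)) - 2 * real N * ?d) / (2 * real N)\<bar>" by simp
  moreover have "(real (cod N (x i) (x j)) - 2 * real N * ?d) / (2 * real N) =
      real (cod N (x i) (x j)) / (2 * real N) - ?d" using assms(4) by (simp add: field_simps)
  ultimately show ?thesis by simp
qed

text \<open>Both levels are read off from one shadow, whose offset is within half a cell of
  either.\<close>

lemma cod_cauchy:
  assumes "x \<in> P" "y \<in> P" "2 \<le> n" "2 \<le> m"
  shows "\<bar>real (cod n x y) / (2 * real n) - real (cod m x y) / (2 * real m)\<bar> \<le> 1 / (2 * real n) + 1 / (2 * real m)"
proof -
  obtain s where s: "shadow (n + m) (length [x, y]) ((!) [x, y]) s" using shadow_list[of "[x,y]"] assms by auto
  show ?thesis
    using shadow_cod_approx[OF s, of 0 1 n] shadow_cod_approx[OF s, of 0 1 m] assms by simp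
qed

lemma ang_lim:
  assumes "x \<in> P" "y \<in> P"
  shows "(\<lambda>n. real (cod n x y) / (2 * real n)) \<longlonglongrightarrow> ang x y"
proof -
  have "Cauchy (\<lambda>n. real (cod n x y) / (2 * real n))"
    unfolding Cauchy_def
  proof (intro allI impI)
    fix e :: real assume e: "e > 0"
    obtain k :: nat where k: "1 / e < k" using reals_Archimedean2 by blast
    show "\<exists>L. \<forall>m\<ge>L. \<forall>n\<ge>L. dist (real (cod m x y) / (2 * real m)) (real (cod n x y) / (2 * real n)) < e"
    proof (intro exI[of _ "k + 2"] allI impI)
      fix m n assume mn: "k + 2 \<le> m" "k + 2 \<le> n"
      have *: "1 / (2 * real l) < e / 2" if "k + 2 \<le> l" for l
      proof -
        have "1 / e < real l" using k that by linarith
        then show ?thesis using e that by (simp add: field_simps)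
      qed
      have "2 \<le> m" "2 \<le> n" using mn by linarith+
      then show "dist (real (cod m x y) / (2 * real m)) (real (cod n x y) / (2 * real n)) < e"
        using cod_cauchy[OF assms \<open>2 \<le> m\<close> \<open>2 \<le> n\<close>] *[OF mn(1)] *[OF mn(2)]
        unfolding dist_real_def by linarith
    qed
  qed
  then show ?thesis unfolding ang_def by (simp add: Cauchy_convergent_iff convergent_LIMSEQ_iff)
qed

lemma ang_approx:
  assumes "x \<in> P" "y \<in> P" "2 \<le> n"
  shows "\<bar>real (cod n x y) / (2 * real n) - ang x y\<bar> \<le> 1 / (2 * real n)"
proof (rule LIMSEQ_le)
  show "(\<lambda>m. \<bar>real (cod n x y) / (2 * real n) - real (cod m x y) / (2 * real m)\<bar>)
      \<longlonglongrightarrow> \<bar>real (cod n x y) / (2 * real n) - ang x y\<bar>"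
    by (intro tendsto_intros ang_lim assms)
  have "(\<lambda>m. 1 / (2 * real m)) \<longlonglongrightarrow> 0"
    using tendsto_mult[OF tendsto_const[of "1/2"] lim_1_over_n] by simp
  from tendsto_add[OF tendsto_const this]
  show "(\<lambda>m. 1 / (2 * real n) + 1 / (2 * real m)) \<longlonglongrightarrow> 1 / (2 * real n)" by simp
  show "\<exists>N. \<forall>m\<ge>N. \<bar>real (cod n x y) / (2 * real n) - real (cod m x y) / (2 * real m)\<bar>
      \<le> 1 / (2 * real n) + 1 / (2 * real m)"
    using cod_cauchy[OF assms] by blast
qed

lemma shadow_ang:
  assumes "shadow K k x s" "i < k" "j < k" "2 \<le> K" "x i \<in> P" "x j \<in> P"
  shows "\<bar>frac (s j - s i) - ang (x i) (x j)\<bar> \<le> 1 / K"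
proof -
  have "\<bar>frac (s j - s i) - ang (x i) (x j)\<bar> \<le> 1 / (2 * real K) + 1 / (2 * real K)"
    using shadow_cod_approx[OF assms(1-4)] ang_approx[OF assms(5,6,4)] by simp
  also have "\<dots> = 1 / K" by simp
  finally show ?thesis .
qed

text \<open>Congruences modulo 1 are proved through real copies with error \<open>c / K\<close> at
  level \<open>K\<close>; a non-integer has positive distance from the integers.\<close>

lemma ints_if_close:
  fixes t :: real
  assumes "\<And>K. K \<ge> (2::nat) \<Longrightarrow> \<exists>z\<in>\<int>. \<bar>t - z\<bar> \<le> c / K"
  shows "t \<in> \<int>"
proof (rule ccontr)
  assume t: "t \<notin> \<int>"
  define \<delta> where "\<delta> = min (frac t) (1 - frac t)"
  have \<delta>: "\<delta> > 0" using t frac_lt_1[of t] by (simp add: \<delta>_def)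
  obtain k :: nat where k: "c / \<delta> < k" using reals_Archimedean2 by blast
  define K where "K = k + 2"
  have "c < K * \<delta>" using k \<delta> by (simp add: K_def field_simps)
  then have K: "c / K < \<delta>" by (simp add: K_def field_simps)
  obtain z where z: "z \<in> \<int>" "\<bar>t - z\<bar> \<le> c / K" using assms[of K] by (auto simp: K_def)
  then obtain m where m: "z = of_int m" by (auto elim: Ints_cases)
  have "\<bar>t - of_int m\<bar> \<ge> \<delta>"
  proof (cases "m \<le> \<lfloor>t\<rfloor>")
    case True
    then have "real_of_int m \<le> of_int \<lfloor>t\<rfloor>" by simp
    then show ?thesis unfolding \<delta>_def frac_def by linarith
  next
    case False
    then have "real_of_int m \<ge> of_int \<lfloor>t\<rfloor> + 1" by linarith
    then show ?thesis unfolding \<delta>_def frac_def by linarith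
  qed
  then show False using z K m by linarith
qed

text \<open>In every shadow the sum is exactly an integer. Three angles, each off by at most
  \<open>1 / K\<close>, give the constant 3.\<close>

lemma ang_add:
  assumes "x \<in> P" "y \<in> P" "z \<in> P"
  shows "ang x y + ang y z - ang x z \<in> \<int>"
proof (rule ints_if_close[where c = 3])
  fix K :: nat assume K: "2 \<le> K"
  obtain s where s: "shadow K (length [x, y, z]) ((!) [x, y, z]) s" using shadow_list[of "[x,y,z]" K] assms by auto
  have "frac (s 1 - s 0) + frac (s 2 - s 1) - frac (s 2 - s 0) =
      of_int (- \<lfloor>s 1 - s 0\<rfloor> - \<lfloor>s 2 - s 1\<rfloor> + \<lfloor>s 2 - s 0\<rfloor>)" by (simp add: frac_def)
  then have "frac (s 1 - s 0) + frac (s 2 - s 1) - frac (s 2 - s 0) \<in> \<int>" by (metis Ints_of_int)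
  moreover have "\<bar>frac (s 1 - s 0) - ang x y\<bar> \<le> 1 / K" "\<bar>frac (s 2 - s 1) - ang y z\<bar> \<le> 1 / K"
    "\<bar>frac (s 2 - s 0) - ang x z\<bar> \<le> 1 / K"
    using shadow_ang[OF s, of 0 1] shadow_ang[OF s, of 1 2] shadow_ang[OF s, of 0 2] assms K by auto
  moreover have "3 / real K = 1 / K + 1 / K + 1 / K" by simp
  ultimately show "\<exists>w\<in>\<int>. \<bar>ang x y + ang y z - ang x z - w\<bar> \<le> 3 / K"
    by (intro bexI[of _ "frac (s 1 - s 0) + frac (s 2 - s 1) - frac (s 2 - s 0)"]) linarith+
qed

lemma ang_range:
  assumes "x \<in> P" "y \<in> P" shows "0 \<le> ang x y" "ang x y \<le> 1"
proof -
  have b: "0 \<le> real (cod n x y) / (2 * real n)" "real (cod n x y) / (2 * real n) \<le> 1" if "2 \<le> n" for n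
    using cod_lt[OF assms that] that by (auto simp: field_simps)
  show "0 \<le> ang x y" by (rule LIMSEQ_le_const[OF ang_lim[OF assms]]) (use b in blast)
  show "ang x y \<le> 1" by (rule LIMSEQ_le_const2[OF ang_lim[OF assms]]) (use b in blast)
qed

lemma ang_cong:
  assumes "x \<in> P" "y \<in> P" "x' \<in> P" "y' \<in> P" "\<And>n. 2 \<le> n \<Longrightarrow> cod n x y = cod n x' y'"
  shows "ang x y = ang x' y'"
proof -
  have "\<forall>\<^sub>F n in sequentially. real (cod n x y) / (2 * real n) = real (cod n x' y') / (2 * real n)"
    using eventually_ge_at_top[of 2] by eventually_elim (simp add: assms(5))
  then have "(\<lambda>n. real (cod n x' y') / (2 * real n)) \<longlonglongrightarrow> ang x y"
    using ang_lim[OF assms(1,2)] by (rule Lim_transform_eventually[rotated])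
  then show ?thesis using ang_lim[OF assms(3,4)] LIMSEQ_unique by blast
qed

lemma ang_rots:
  assumes "x \<in> P" "1 \<le> n" shows "ang x (G n m x) - m / n \<in> \<int>"
proof (rule ints_if_close[where c = 1])
  fix K :: nat assume K: "2 \<le> K"
  obtain s where s: "shadow (K + n + m) (length [x, G n m x]) ((!) [x, G n m x]) s"
    using shadow_list[of "[x, G n m x]" "K + n + m"] assms by auto
  have i: "s 1 - (s 0 + m / n) \<in> \<int>" using shadow_rots[OF s, of 0 1 n m] assms by simp
  have "\<bar>frac (s 1 - s 0) - ang x (G n m x)\<bar> \<le> 1 / real (K + n + m)"
    using shadow_ang[OF s, of 0 1] assms K by simp
  moreover have "1 / real (K + n + m) \<le> 1 / K" using K by (simp add: field_simps)
  moreover have "frac (s 1 - s 0) - m / n = (s 1 - (s 0 + m / n)) - of_int \<lfloor>s 1 - s 0\<rfloor>"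
    by (simp add: frac_def)
  then have "frac (s 1 - s 0) - m / n \<in> \<int>" using i by (metis Ints_diff Ints_of_int)
  ultimately show "\<exists>z\<in>\<int>. \<bar>ang x (G n m x) - m / n - z\<bar> \<le> 1 / K"
    by (intro bexI[of _ "frac (s 1 - s 0) - m / n"]) linarith+
qed

lemma eq_rots_if_even:
  assumes "x \<in> P" "y \<in> P" "2 \<le> N" "cod N x y = 2 * m" shows "y = G N m x"
  using cod_unrot[of x y N m 0] cod_eq_0[of "G N m x" y N] assms by simp

lemma odd_if_irrational:
  assumes "x \<in> P" "y \<in> P" "2 \<le> N" "ang x y \<notin> \<rat>" shows "odd (cod N x y)"
proof
  assume "even (cod N x y)"
  then obtain m where "cod N x y = 2 * m" by blast
  then have "ang x y - m / N \<in> \<int>" using ang_rots[OF assms(1), of N m] eq_rots_if_even[of x y N m] assms by simp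
  then have "ang x y - m / N + m / N \<in> \<rat>" using Ints_subset_Rats by (intro Rats_add) auto
  then show False using assms by simp
qed

text \<open>An irrational angle rules out even codes, and \<open>N * ang x y\<close> lies strictly
  inside a single cell, so the odd code can be read off from the angle. A rational angle would leave
  a division point and both of its neighbouring cells possible.\<close>

lemma cod_eq_if_irrational:
  assumes "x \<in> P" "y \<in> P" "x' \<in> P" "y' \<in> P" "2 \<le> N"
    and irr: "ang x y \<notin> \<rat>" and eq: "ang x' y' - ang x y \<in> \<int>"
  shows "cod N x y = cod N x' y'"
proof -
  have irr': "ang x' y' \<notin> \<rat>"
  proof
    assume "ang x' y' \<in> \<rat>"
    then have "ang x' y' - (ang x' y' - ang x y) \<in> \<rat>"
      by (rule Rats_diff[OF _ subsetD[OF Ints_subset_Rats eq]])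
    then show False using irr by simp
  qed
  have "t \<noteq> 0 \<and> t \<noteq> 1" if "t \<notin> \<rat>" for t :: real using that by auto
  then have r: "0 < ang x y" "ang x y < 1" "0 < ang x' y'" "ang x' y' < 1"
    using ang_range[of x y] ang_range[of x' y'] assms irr irr' by (metis order_le_less)+
  \<comment> \<open>Both angles lie strictly between 0 and 1, so congruence modulo 1 is
    equality.\<close>
  obtain z where z: "ang x' y' - ang x y = of_int z" using eq by (auto elim: Ints_cases)
  have "real_of_int z < 1" "- 1 < real_of_int z" using r z by linarith+
  then have "z = 0" by linarith
  then have e: "ang x' y' = ang x y" using z by simp
  have *: "\<bar>real (cod N u v) - 2 * N * ang u v\<bar> \<le> 1" if "u \<in> P" "v \<in> P" for u v
  proof -
    have "\<bar>real (cod N u v) / (2 * real N) - ang u v\<bar> * (2 * real N) \<le> 1 / (2 * real N) * (2 * real N)"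
      using ang_approx[OF that assms(5)] by (intro mult_right_mono) auto
    also have "\<dots> = 1" using assms(5) by simp
    also have "\<bar>real (cod N u v) / (2 * real N) - ang u v\<bar> * (2 * real N) =
        \<bar>(real (cod N u v) / (2 * real N) - ang u v) * (2 * real N)\<bar>" by (simp add: abs_mult)
    also have "(real (cod N u v) / (2 * real N) - ang u v) * (2 * real N) = real (cod N u v) - 2 * N * ang u v"
      using assms(5) by (simp add: field_simps)
    finally show ?thesis .
  qed
  obtain a b where ab: "cod N x y = 2 * a + 1" "cod N x' y' = 2 * b + 1"
    using odd_if_irrational[OF assms(1,2,5) irr] odd_if_irrational[OF assms(3,4,5) irr'] by (auto elim!: oddE)
  let ?t = "N * ang x y"
  have "real N * ang x y \<notin> \<int>"
  proof
    assume "real N * ang x y \<in> \<int>"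
    then have "real N * ang x y / real N \<in> \<rat>" using Ints_subset_Rats by (intro Rats_divide) auto
    then show False using irr assms(5) by simp
  qed
  then have ne: "real N * ang x y \<noteq> of_int k" for k by auto
  have "\<bar>(2 * real a + 1) - 2 * (real N * ang x y)\<bar> \<le> 1" using *[OF assms(1,2)] ab by (simp add: algebra_simps)
  then have "real a \<le> real N * ang x y" "real N * ang x y \<le> real a + 1" by linarith+
  moreover have "real N * ang x y \<noteq> real a" "real N * ang x y \<noteq> real a + 1"
    using ne[of "int a"] ne[of "int a + 1"] by auto
  moreover have "\<bar>(2 * real b + 1) - 2 * (real N * ang x y)\<bar> \<le> 1" using *[OF assms(3,4)] ab e by (simp add: algebra_simps)
  then have "real b \<le> real N * ang x y" "real N * ang x y \<le> real b + 1" by linarith+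
  moreover have "real N * ang x y \<noteq> real b" "real N * ang x y \<noteq> real b + 1"
    using ne[of "int b"] ne[of "int b + 1"] by auto
  ultimately have "real a < real b + 1" "real b < real a + 1" by linarith+
  then show ?thesis using ab by simp
qed

lemma circ_rots_iff:
  assumes "x \<in> P" "y \<in> P" "2 \<le> N" "m < N"
  shows "circ M (G N m x) y (G N (Suc m) x) \<longleftrightarrow> cod N x y = 2 * m + 1"
proof -
  let ?u = "G N m x"
  have Suc: "G N (Suc m) x = G N 1 ?u" by (simp add: rots_def)
  have u: "?u \<in> P" using assms by simp
  have c2: "cod N ?u (G N 1 ?u) = 2" using cod_rots_self[OF u, of N 1] assms by simp
  have eq: "cod N y (G N 1 ?u) = 0" if "cod N ?u y = 2"
    using eq_rots_if_even[OF u assms(2,3), of 1] that cod_self assms by simp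
  have "circ M ?u y (G N 1 ?u) \<longleftrightarrow> cod N ?u y = 1"
    using circ_cod[of ?u y "G N 1 ?u" N] assms eq c2 by auto
  also have "\<dots> \<longleftrightarrow> cod N x y = 2 * m + 1"
  proof
    assume "cod N ?u y = 1"
    then have "1 = (int (cod N x y) - 2 * int m) mod (2 * int N)"
      using cod_rot_left[of x y N N m] assms by simp
    then have "1 mod (2 * int N) = (int (cod N x y) - 2 * int m) mod (2 * int N)" using assms by simp
    then have "(2 * int m + 1) mod (2 * int N) = int (cod N x y) mod (2 * int N)"
      by (simp add: mod_eq_dvd_iff algebra_simps)
    then show "cod N x y = 2 * m + 1" using cod_lt[of x y N] assms by simp
  qed (use cod_unrot[of x y N m 1] assms in simp)
  finally show ?thesis unfolding Suc .
qed

lemma infinite_points: "infinite P"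
proof
  assume fin: "finite P"
  obtain x where x: "x \<in> P" using points_ne by blast
  \<comment> \<open>More rotations than points, and at least 2 as codes require.\<close>
  define N where "N = card P + 2"
  have N: "2 \<le> N" by (simp add: N_def)
  have "inj_on (\<lambda>m. G N m x) {..<N}"
  proof (rule inj_onI)
    fix a b assume ab: "a \<in> {..<N}" "b \<in> {..<N}" "G N a x = G N b x"
    have "2 * a = cod N x (G N a x)" using cod_rots_self[OF x N] ab(1) by simp
    also have "\<dots> = 2 * b" unfolding ab(3) using cod_rots_self[OF x N] ab(2) by simp
    finally show "a = b" by simp
  qed
  then have "card {..<N} \<le> card P" using fin x by (intro card_inj_on_le) auto
  then show False by (simp add: N_def)
qed

end

section \<open>Realising angles by saturation\<close>

lemma ex_irrational: "\<exists>c::real. c \<notin> \<rat>"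
proof (rule ccontr)
  assume "\<not> (\<exists>c::real. c \<notin> \<rat>)"
  then have "(UNIV :: real set) = \<rat>" by blast
  then show False using uncountable_UNIV_real countable_rat by metis
qed

locale sat_circle = circle_model +
  assumes sat: "saturated M"
begin

text \<open>The type over \<open>x\<close> says, for each level, which open cell contains the new
  point. Finitely many levels are satisfied by a rational rotation of \<open>x\<close> slightly
  beyond \<open>t\<close>, so saturation realises all of them.\<close>

lemma ex_ang_irrational:
  assumes x: "x \<in> P" and t: "t \<notin> \<rat>" "0 < t" "t < 1"
  shows "\<exists>y\<in>P. ang x y - t \<in> \<int>"
proof -
  define f where "f = (\<lambda>n::nat. nat \<lfloor>real n * t\<rfloor>)"
  have f: "real (f n) < real n * t" "real n * t < real (f n) + 1" "f n < n" if "2 \<le> n" for n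
  proof -
    have "0 \<le> real n * t" "real n * t < n" using t that by auto
    then have r: "real (f n) = of_int \<lfloor>real n * t\<rfloor>" by (simp add: f_def)
    have "real n * t \<noteq> real (f n)"
    proof
      assume "real n * t = real (f n)"
      then have "t = real (f n) / real n" using that by (simp add: field_simps)
      then show False using t by simp
    qed
    then show "real (f n) < real n * t" "real n * t < real (f n) + 1" using r by linarith+
    then have "real (f n) < real n" using \<open>real n * t < n\<close> by linarith
    then show "f n < n" by simp
  qed
  \<comment> \<open>\<open>Var 1\<close> is the parameter \<open>x\<close>; \<open>Var 0\<close> is
    to lie in the open cell of level \<open>n\<close> that contains the angle
    \<open>t\<close>.\<close>
  define \<phi> where "\<phi> = (\<lambda>n. FS (rot_tm n (f n) 1) (Var 0) (rot_tm n (Suc (f n)) 1))"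
  define \<Gamma> where "\<Gamma> = (\<lambda>n. (\<phi> n, \<lambda>_::nat. x)) ` {2..}"
  have sat\<phi>: "sat M ((\<lambda>_. x)(0 := y)) (\<phi> n) \<longleftrightarrow> cod n x y = 2 * f n + 1" if "y \<in> P" "2 \<le> n" for y n
    using circ_rots_iff[OF x that f(3)[OF that(2)]] by (simp add: \<phi>_def)
  have "realized M \<Gamma>'" if \<Gamma>': "finite \<Gamma>'" "\<Gamma>' \<subseteq> \<Gamma>" for \<Gamma>'
  proof -
    obtain F where F: "F \<subseteq> {2..}" "finite F" "\<Gamma>' = (\<lambda>n. (\<phi> n, \<lambda>_::nat. x)) ` F"
      using finite_subset_image[OF \<Gamma>'(1)] \<Gamma>'(2) unfolding \<Gamma>_def by blast
    \<comment> \<open>Least distance from \<open>t\<close> to the upper end of its cell over the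
      levels in \<open>F\<close>; the additional 1 keeps the set nonempty.\<close>
    define \<delta> where "\<delta> = Min (insert 1 ((\<lambda>n. (real (f n) + 1) / n - t) ` F))"
    have "0 < \<delta>" using F f by (auto simp: \<delta>_def field_simps subset_eq)
    define \<delta>' where "\<delta>' = min \<delta> (1 - t)"
    have "0 < \<delta>'" using \<open>0 < \<delta>\<close> t by (simp add: \<delta>'_def)
    then obtain q where q: "q \<in> \<rat>" "t < q" "q < t + \<delta>'" using Rats_dense_in_real[of t "t + \<delta>'"] by auto
    then obtain k l where kl: "q = of_int k / of_int l" "l > 0" by (auto elim: Rats_cases')
    have "k > 0" 
    proof -
      have "0 < real_of_int k / of_int l" using q(2) t(2) kl by linarith
      then show ?thesis using kl(2) by (simp add: zero_less_divide_iff)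
    qed
    define y where "y = G (nat l) (nat k) x"
    have y: "y \<in> P" using x by (simp add: y_def)
    have "cod n x y = 2 * f n + 1" if n: "n \<in> F" for n
    proof -
      have n2: "2 \<le> n" using n F by auto
      obtain s where s: "shadow (n + nat l + nat k) (length [x, y]) ((!) [x, y]) s"
        using shadow_list[of "[x,y]" "n + nat l + nat k"] x y by auto
      have "s 1 - (s 0 + real (nat k) / real (nat l)) \<in> \<int>"
        using shadow_rots[OF s, of 0 1 "nat l" "nat k"] kl by (simp add: y_def)
      then have i: "(s 1 - s 0) - q \<in> \<int>" using kl \<open>k > 0\<close> by (simp add: algebra_simps)
      have "int (cod n x y) = kap n (s 1 - s 0) mod (2 * int n)" using shadow_cod[OF s, of 0 1 n] n2 by simp
      also have "\<dots> = kap n q mod (2 * int n)" by (rule kap_mod) (use i n2 in auto)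
      also have "kap n q = 2 * int (f n) + 1"
      proof -
        have "\<delta>' \<le> (real (f n) + 1) / n - t" using F n by (auto simp: \<delta>'_def \<delta>_def min_le_iff_disj intro!: Min_le)
        then have "q < (real (f n) + 1) / n" using q by linarith
        then have u: "real n * q < real (f n) + 1" using n2 by (simp add: field_simps)
        have "real n * t < real n * q" using q n2 by simp
        then have l: "real (f n) < real n * q" using f(1)[OF n2] by linarith
        have "\<lfloor>real n * q\<rfloor> = int (f n)" "\<lceil>real n * q\<rceil> = int (f n) + 1" using u l by linarith+
        then show ?thesis by (simp add: kap_def)
      qed
      finally show ?thesis using f(3)[OF n2] by simp
    qed
    then have "\<forall>(\<psi>, v)\<in>\<Gamma>'. sat M (v(0 := y)) \<psi>" using sat\<phi>[OF y] F by auto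
    then show ?thesis using y unfolding realized_def by blast
  qed
  moreover have "\<Gamma> \<subseteq> param_formulas {x}" by (auto simp: \<Gamma>_def param_formulas_def)
  moreover have "{x} \<prec> P" using infinite_points by (simp add: finite_lesspoll_infinite)
  ultimately have "realized M \<Gamma>" using sat x unfolding saturated_def
    by (elim allE[of _ "{x}"] allE[of _ \<Gamma>]) auto
  then obtain y where y: "y \<in> P" "\<forall>n\<ge>2. sat M ((\<lambda>_. x)(0 := y)) (\<phi> n)" by (auto simp: realized_def \<Gamma>_def)
  then have c: "cod n x y = 2 * f n + 1" if "2 \<le> n" for n using sat\<phi> that by blast
  have "ang x y - t \<in> \<int>"
  proof (rule ints_if_close[where c = 1])
    fix K :: nat assume K: "2 \<le> K"
    have "\<bar>(2 * real (f K) + 1) / (2 * real K) - ang x y\<bar> \<le> 1 / (2 * real K)"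
      using ang_approx[OF x y(1) K] c[OF K] by (simp add: add.commute)
    moreover have "\<bar>(2 * real (f K) + 1) / (2 * real K) - t\<bar> \<le> 1 / (2 * real K)"
    proof -
      have "\<bar>(2 * real (f K) + 1) - 2 * real K * t\<bar> \<le> 1" using f[OF K] by linarith
      then have "\<bar>(2 * real (f K) + 1) - 2 * real K * t\<bar> / (2 * real K) \<le> 1 / (2 * real K)"
        by (rule divide_right_mono) simp
      moreover have "\<bar>(2 * real (f K) + 1) - 2 * real K * t\<bar> / (2 * real K) =
        \<bar>((2 * real (f K) + 1) - 2 * real K * t) / (2 * real K)\<bar>" by simp
      moreover have "((2 * real (f K) + 1) - 2 * real K * t) / (2 * real K) =
        (2 * real (f K) + 1) / (2 * real K) - t" using K by (simp add: field_simps)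
      ultimately show ?thesis by simp
    qed
    moreover have "1 / real K = 1 / (2 * real K) + 1 / (2 * real K)" by simp
    ultimately have "\<bar>ang x y - t - 0\<bar> \<le> 1 / K" by linarith
    then show "\<exists>z\<in>\<int>. \<bar>ang x y - t - z\<bar> \<le> 1 / K" by (intro bexI[of _ 0]) auto
  qed
  then show ?thesis using y by blast
qed

lemma ex_ang:
  assumes x: "x \<in> P" shows "\<exists>y\<in>P. ang x y - t \<in> \<int>"
proof -
  have irr: "\<exists>y\<in>P. ang x y - t \<in> \<int>" if tx: "t \<notin> \<rat>" "x \<in> P" for t x
  proof -
    have "frac t \<notin> \<rat>"
    proof
      assume "frac t \<in> \<rat>"
      then have "frac t + of_int \<lfloor>t\<rfloor> \<in> \<rat>" by (intro Rats_add) auto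
      then show False using tx by (simp add: frac_def)
    qed
    moreover have "frac t \<noteq> 0" using calculation by force
    then have "0 < frac t" using frac_ge_0[of t] by linarith
    ultimately obtain y where y: "y \<in> P" "ang x y - frac t \<in> \<int>"
      using ex_ang_irrational[OF tx(2), of "frac t"] frac_lt_1[of t] by blast
    have "ang x y - t = (ang x y - frac t) - of_int \<lfloor>t\<rfloor>" by (simp add: frac_def)
    then show ?thesis using y by (metis Ints_diff Ints_of_int)
  qed
  show ?thesis
  proof (cases "t \<in> \<rat>")
    case False then show ?thesis using irr x by blast
  next
    case True
    \<comment> \<open>A rational turn is made in two irrational ones, by \<open>t - c\<close> and
      then by \<open>c\<close>.\<close>
    obtain c :: real where s2: "c \<notin> \<rat>" using ex_irrational by blast
    have "t - c \<notin> \<rat>"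
    proof
      assume "t - c \<in> \<rat>"
      from Rats_diff[OF True this] show False using s2 by simp
    qed
    then obtain y where y: "y \<in> P" "ang x y - (t - c) \<in> \<int>" using irr x by blast
    obtain z where z: "z \<in> P" "ang y z - c \<in> \<int>" using irr[OF s2 y(1)] by blast
    have "ang x z - t = (ang x y - (t - c)) + (ang y z - c) - (ang x y + ang y z - ang x z)" by simp
    also have "\<dots> \<in> \<int>" by (intro Ints_add Ints_diff y z ang_add x)
    finally show ?thesis using z by blast
  qed
qed

text \<open>Angles from one point, shifted by integers, already exhaust the reals.\<close>

lemma uncountable_points: "uncountable P"
proof
  assume c: "countable P"
  obtain x where x: "x \<in> P" using points_ne by blast
  have "UNIV \<subseteq> (\<lambda>(y, z). ang x y - of_int z) ` (P \<times> (UNIV :: int set))"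
  proof
    fix t :: real
    obtain y where y: "y \<in> P" "ang x y - t \<in> \<int>" using ex_ang[OF x] by blast
    then obtain z where "ang x y - t = of_int z" by (auto elim: Ints_cases)
    then have "t = ang x y - of_int z" by simp
    then show "t \<in> (\<lambda>(y, z). ang x y - of_int z) ` (P \<times> UNIV)" using y by auto
  qed
  moreover have "countable (P \<times> (UNIV :: int set))" using c by blast
  ultimately have "countable (UNIV :: real set)" by (meson countable_image countable_subset)
  then show False using uncountable_UNIV_real by blast
qed

text \<open>The sets built later are countable, so this settles the smallness conditions of the
  category and of the independence axioms.\<close>

lemma countable_lesspoll: "countable A \<Longrightarrow> A \<prec> P"
proof -
  assume A: "countable A"
  have "A \<lesssim> (UNIV :: nat set)" using A by (auto simp: countable_def lepoll_def)
  moreover have "(UNIV :: nat set) \<lesssim> P" using infinite_points infinite_le_lepoll by blast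
  moreover have "\<not> P \<lesssim> A"
    using uncountable_points A by (meson countable_lepoll)
  ultimately show ?thesis unfolding lesspoll_def
    using eqpoll_imp_lepoll eqpoll_sym lepoll_trans by blast
qed

end

section \<open>Back and forth at a finite level\<close>

text \<open>The product of the denominators of the rotations. A formula whose level divides
  \<open>N \<ge> 2\<close> is decided by codes of level \<open>N\<close>; products in place of least
  common multiples keep divisibility elementary.\<close>

primrec tlv :: "tm \<Rightarrow> nat" where
  "tlv (Var i) = 1"
| "tlv (Rot n t) = Suc n * tlv t"

primrec lv :: "fm \<Rightarrow> nat" where
  "lv (FEq t u) = tlv t * tlv u"
| "lv (FS t u w) = tlv t * tlv u * tlv w"
| "lv (FNot \<phi>) = lv \<phi>"
| "lv (FAnd \<phi> \<psi>) = lv \<phi> * lv \<psi>"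
| "lv (FEx i \<phi>) = lv \<phi>"

primrec slv :: "srt \<Rightarrow> nat" where
  "slv Home_sort = 1"
| "slv (Imag_sort n \<phi>) = lv \<phi>"

text \<open>Equality with a class is expressed by the formula defining the equivalence relation,
  hence is decided at the level of this formula.\<close>

primrec elv :: "'a meq \<Rightarrow> nat" where
  "elv (Home x) = 1"
| "elv (Imag n \<phi> X) = lv \<phi>"

primrec qlv :: "qfm \<Rightarrow> nat" where
  "qlv (QEq i j) = 1"
| "qlv (QS i j k) = 1"
| "qlv (QRot n i j) = Suc n"
| "qlv (QProj n \<phi> js j) = lv \<phi>"
| "qlv (QNot \<psi>) = qlv \<psi>"
| "qlv (QAnd \<psi> \<chi>) = qlv \<psi> * qlv \<chi>"
| "qlv (QEx s i \<psi>) = slv s * qlv \<psi>"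

lemma tlv_pos [simp]: "tlv t > 0" by (induction t) auto
lemma lv_pos [simp]: "lv \<phi> > 0" by (induction \<phi>) auto
lemma slv_pos [simp]: "slv s > 0" by (cases s) auto
lemma elv_pos [simp]: "elv c > 0" by (cases c) auto
lemma qlv_pos [simp]: "qlv \<psi> > 0" by (induction \<psi>) auto

lemma finite_qfv [simp]: "finite (qfv \<psi>)" by (induction \<psi>) auto

lemma qsat_cong: "\<forall>i\<in>qfv \<psi>. v i = w i \<Longrightarrow> qsat M v \<psi> = qsat M w \<psi>"
proof (induction \<psi> arbitrary: v w)
  case (QEx s i \<psi>)
  have "qsat M (v(i := x)) \<psi> = qsat M (w(i := x)) \<psi>" for x
    by (rule QEx.IH) (use QEx.prems in auto)
  then show ?case by simp
next
  case (QProj n \<phi> js j)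
  have 1: "map v js = map w js" and 2: "v j = w j" using QProj by auto
  show ?case unfolding qsat.simps 1 2 ..
next
  case (QAnd \<psi> \<chi>)
  have "qsat M v \<psi> = qsat M w \<psi>" by (rule QAnd.IH) (use QAnd.prems in auto)
  moreover have "qsat M v \<chi> = qsat M w \<chi>" by (rule QAnd.IH) (use QAnd.prems in auto)
  ultimately show ?case by simp
next
  case (QNot \<psi>)
  have "qsat M v \<psi> = qsat M w \<psi>" by (rule QNot.IH) (use QNot.prems in auto)
  then show ?case by simp
qed auto

lemma dvd_multD: "(a * b :: nat) dvd N \<Longrightarrow> a dvd N \<and> b dvd N"
  using dvd_mult_left dvd_mult_right by blast

context circle_model
begin

lemma rot_rots: "rot M n x = G (Suc n) 1 x"
  by (simp add: rots_def)

lemma Gd_rot: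
  assumes "Gd N H" "2 \<le> N" "(x, x') \<in> H" "Suc n dvd N"
  shows "Gd N (insert (rot M n x, rot M n x') H)"
proof (rule Gd_insertI[OF assms(1,2)])
  note xP = Gd_in[OF assms(1,3)]
  show "rot M n x \<in> P" "rot M n x' \<in> P" using xP by auto
  fix z z' assume z: "(z, z') \<in> H"
  show "cod N z (rot M n x) = cod N z' (rot M n x')"
    using cod_rot_cong[of z x z' x' N "Suc n" "Suc n" 0 1] Gd_in[OF assms(1) z] xP assms GdD[OF assms(1) z assms(3)]
    by (simp add: rot_rots)
qed

lemma Gd_tm:
  assumes "Gd N H" "2 \<le> N" "tlv t dvd N" "\<forall>i\<in>tm_vars t. (v i, v' i) \<in> H"
  shows "\<exists>H'. Gd N H' \<and> H \<subseteq> H' \<and> (tm_val M v t, tm_val M v' t) \<in> H'"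
  using assms(3,4)
proof (induction t)
  case (Var i) then show ?case using assms(1) by auto
next
  case (Rot n t)
  then have d: "Suc n dvd N" "tlv t dvd N" using dvd_multD[of "Suc n" "tlv t" N] by simp_all
  then obtain H' where H': "Gd N H'" "H \<subseteq> H'" "(tm_val M v t, tm_val M v' t) \<in> H'" using Rot by auto
  show ?case using Gd_rot[OF H'(1) assms(2) H'(3) d(1)] H'(2)
    by (intro exI[of _ "insert (rot M n (tm_val M v t), rot M n (tm_val M v' t)) H'"]) auto
qed

lemma Gd_eq_iff:
  assumes "Gd N H" "2 \<le> N" "(x, x') \<in> H" "(y, y') \<in> H" shows "x = y \<longleftrightarrow> x' = y'"
proof -
  have "x \<in> P" "y \<in> P" "x' \<in> P" "y' \<in> P" using Gd_in[OF assms(1)] assms(3,4) by auto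
  then show ?thesis using cod_eq_0[of x y N] cod_eq_0[of x' y' N] GdD[OF assms(1,3,4)] assms(2) by simp
qed

lemma Gd_circ_iff:
  assumes "Gd N H" "2 \<le> N" "(x, x') \<in> H" "(y, y') \<in> H" "(z, z') \<in> H"
  shows "circ M x y z \<longleftrightarrow> circ M x' y' z'"
proof -
  have "x \<in> P" "y \<in> P" "z \<in> P" "x' \<in> P" "y' \<in> P" "z' \<in> P" using Gd_in[OF assms(1)] assms(3-5) by auto
  then show ?thesis
    using circ_cod[of x y z N] circ_cod[of x' y' z' N] assms(2)
      GdD[OF assms(1,3,4)] GdD[OF assms(1,3,5)] GdD[OF assms(1,4,5)] by simp
qed

text \<open>Back and forth without raising the level: quantifiers use \<open>Gd_extend\<close> at
  the same \<open>N\<close>. One implication suffices for the induction, as negation passes to the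
  converse relation.\<close>

lemma sat_Gd_imp:
  assumes "Gd N H" "2 \<le> N" "lv \<phi> dvd N" "\<forall>i\<in>fv \<phi>. (v i, v' i) \<in> H" "sat M v \<phi>"
  shows "sat M v' \<phi>"
  using assms
proof (induction \<phi> arbitrary: v v' H)
  case (FEq t u)
  have d: "tlv t dvd N" "tlv u dvd N" using dvd_multD[of "tlv t" "tlv u" N] FEq(3) by auto
  obtain H' where H': "Gd N H'" "H \<subseteq> H'" "(tm_val M v t, tm_val M v' t) \<in> H'"
    using Gd_tm[OF FEq(1,2) d(1), of v v'] FEq by auto
  obtain H'' where H'': "Gd N H''" "H' \<subseteq> H''" "(tm_val M v u, tm_val M v' u) \<in> H''"
    using Gd_tm[OF H'(1) FEq(2) d(2), of v v'] FEq H' by auto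
  have "(tm_val M v t, tm_val M v' t) \<in> H''" using H' H'' by blast
  from Gd_eq_iff[OF H''(1) FEq(2) this H''(3)] show ?case using FEq(5) by simp
next
  case (FS t u w)
  have "tlv t * tlv u dvd N" "tlv w dvd N" using FS(3) dvd_multD[of "tlv t * tlv u" "tlv w" N] by simp_all
  then have d: "tlv t dvd N" "tlv u dvd N" "tlv w dvd N" using dvd_multD[of "tlv t" "tlv u" N] by auto
  obtain K1 where K1: "Gd N K1" "H \<subseteq> K1" "(tm_val M v t, tm_val M v' t) \<in> K1"
    using Gd_tm[OF FS(1,2) d(1), of v v'] FS by auto
  obtain K2 where K2: "Gd N K2" "K1 \<subseteq> K2" "(tm_val M v u, tm_val M v' u) \<in> K2"
    using Gd_tm[OF K1(1) FS(2) d(2), of v v'] FS K1 by auto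
  obtain K3 where K3: "Gd N K3" "K2 \<subseteq> K3" "(tm_val M v w, tm_val M v' w) \<in> K3"
    using Gd_tm[OF K2(1) FS(2) d(3), of v v'] FS K1 K2 by auto
  have "(tm_val M v t, tm_val M v' t) \<in> K3" "(tm_val M v u, tm_val M v' u) \<in> K3" using K1 K2 K3 by auto
  from Gd_circ_iff[OF K3(1) FS(2) this K3(3)] show ?case using FS(5) by simp
next
  case (FNot \<phi>)
  have "\<forall>i\<in>fv \<phi>. (v' i, v i) \<in> H\<inverse>" using FNot(5) by auto
  then show ?case using FNot.IH[OF Gd_converse[OF FNot(2)] FNot(3), of v' v] FNot(4,6) by auto
next
  case (FAnd \<phi> \<psi>)
  have d: "lv \<phi> dvd N" "lv \<psi> dvd N" using dvd_multD[of "lv \<phi>" "lv \<psi>" N] FAnd(5) by simp_all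
  show ?case using FAnd.IH(1)[OF FAnd(3,4) d(1), of v v'] FAnd.IH(2)[OF FAnd(3,4) d(2), of v v'] FAnd(6,7) by auto
next
  case (FEx i \<phi>)
  then obtain x where x: "x \<in> P" "sat M (v(i := x)) \<phi>" by auto
  obtain x' where x': "x' \<in> P" "Gd N (insert (x, x') H)" using Gd_extend[OF FEx(2,3) x(1)] by blast
  have "sat M (v'(i := x')) \<phi>" by (rule FEx.IH[OF x'(2) FEx(3) _ _ x(2)]) (use FEx(4,5) in auto)
  then show ?case using x' by auto
qed

lemma sat_Gd:
  assumes "Gd N H" "2 \<le> N" "lv \<phi> dvd N" "\<forall>i\<in>fv \<phi>. (v i, v' i) \<in> H"
  shows "sat M v \<phi> \<longleftrightarrow> sat M v' \<phi>"
  using sat_Gd_imp[OF assms] sat_Gd_imp[OF Gd_converse[OF assms(1)] assms(2,3), of v' v] assms(4) by auto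

section \<open>Partial maps on imaginaries\<close>

definition imag_ok :: "nat \<Rightarrow> fm \<Rightarrow> bool" where
  "imag_ok n \<phi> \<longleftrightarrow> 0 < n \<and> fv \<phi> \<subseteq> {..<2 * n} \<and> equiv (tuples M n) (imag_rel M n \<phi>)"

abbreviation Cls :: "nat \<Rightarrow> fm \<Rightarrow> 'a list \<Rightarrow> 'a meq" where
  "Cls n \<phi> xs \<equiv> Imag n \<phi> (imag_rel M n \<phi> `` {xs})"

text \<open>Extends a partial map to imaginaries through representing tuples. Different tuples may
  represent one class, so this is a relation; it becomes functional at levels divisible by
  \<open>elv\<close>.\<close>

definition rel :: "('a \<times> 'a) set \<Rightarrow> 'a meq \<Rightarrow> 'a meq \<Rightarrow> bool" where
  "rel H c c' \<longleftrightarrow> (\<exists>x x'. (x, x') \<in> H \<and> c = Home x \<and> c' = Home x') \<or>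
    (\<exists>n \<phi> xs xs'. imag_ok n \<phi> \<and> length xs = n \<and> list_all2 (\<lambda>x x'. (x, x') \<in> H) xs xs' \<and>
        c = Cls n \<phi> xs \<and> c' = Cls n \<phi> xs')"

lemma rel_cases:
  assumes "rel H c c'"
  obtains (Home) x x' where "(x, x') \<in> H" "c = Home x" "c' = Home x'"
  | (Cls) n \<phi> xs xs' where "imag_ok n \<phi>" "length xs = n" "list_all2 (\<lambda>x x'. (x, x') \<in> H) xs xs'"
      "c = Cls n \<phi> xs" "c' = Cls n \<phi> xs'"
  using assms unfolding rel_def by blast

lemma rel_Home: "(x, x') \<in> H \<Longrightarrow> rel H (Home x) (Home x')"
  by (auto simp: rel_def)

lemma rel_Cls: "imag_ok n \<phi> \<Longrightarrow> length xs = n \<Longrightarrow> list_all2 (\<lambda>x x'. (x, x') \<in> H) xs xs' \<Longrightarrow>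
    rel H (Cls n \<phi> xs) (Cls n \<phi> xs')"
  unfolding rel_def by blast

lemma rel_mono: "rel H c c' \<Longrightarrow> H \<subseteq> H' \<Longrightarrow> rel H' c c'"
  by (erule rel_cases) (auto intro!: rel_Home rel_Cls elim: list_all2_mono)

lemma rel_converse: "rel H c c' \<Longrightarrow> rel (H\<inverse>) c' c"
proof (erule rel_cases)
  fix n \<phi> xs xs' assume *: "imag_ok n \<phi>" "length xs = n" "list_all2 (\<lambda>x x'. (x, x') \<in> H) xs xs'"
      "c = Cls n \<phi> xs" "c' = Cls n \<phi> xs'"
  have "list_all2 (\<lambda>x x'. (x, x') \<in> H\<inverse>) xs' xs" using *(3) by (auto simp: list_all2_conv_all_nth)
  moreover have "length xs' = n" using *(2,3) list_all2_lengthD by force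
  ultimately show ?thesis using rel_Cls[OF *(1)] *(4,5) by simp
qed (auto intro: rel_Home)

lemma rel_elv: "rel H c c' \<Longrightarrow> elv c' = elv c"
  by (erule rel_cases) auto

lemma list_all2_H_tuples:
  assumes "Gd N H" "list_all2 (\<lambda>x x'. (x, x') \<in> H) xs xs'" "length xs = n"
  shows "xs \<in> tuples M n" "xs' \<in> tuples M n"
proof -
  have l: "length xs' = n" using assms(2,3) list_all2_lengthD by force
  have "xs ! i \<in> P \<and> xs' ! i \<in> P" if "i < n" for i
    using Gd_in[OF assms(1)] list_all2_nthD[OF assms(2)] that assms(3) by blast
  then show "xs \<in> tuples M n" "xs' \<in> tuples M n" using l assms(3) by (auto simp: tuples_def in_set_conv_nth)
qed

lemma Cls_in_sort: "imag_ok n \<phi> \<Longrightarrow> xs \<in> tuples M n \<Longrightarrow> Cls n \<phi> xs \<in> sort_set M (Imag_sort n \<phi>)"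
  by (auto simp: imag_ok_def quotientI)

lemma rel_sort:
  assumes "Gd N H" "rel H c c'" shows "c \<in> sort_set M s \<longleftrightarrow> c' \<in> sort_set M s"
  using assms(2)
proof (cases rule: rel_cases)
  case (Home x x')
  then show ?thesis using Gd_in[OF assms(1)] by (cases s) auto
next
  case (Cls n \<phi> xs xs')
  note t = list_all2_H_tuples[OF assms(1) Cls(3,2)]
  show ?thesis
  proof (cases s)
    case Home_sort then show ?thesis using Cls by auto
  next
    case (Imag_sort n' \<phi>')
    show ?thesis
    proof (cases "n' = n \<and> \<phi>' = \<phi>")
      case True
      then show ?thesis using Cls_in_sort[OF Cls(1)] t Imag_sort Cls by auto
    next
      case False then show ?thesis using Imag_sort Cls by (auto split: if_splits)
    qed
  qed
qed

lemma rel_Meq: "Gd N H \<Longrightarrow> rel H c c' \<Longrightarrow> c \<in> Meq M \<and> c' \<in> Meq M"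
proof (erule rel_cases)
  fix x x' assume *: "Gd N H" "(x, x') \<in> H" "c = Home x" "c' = Home x'"
  then have "Home x \<in> sort_set M Home_sort" "Home x' \<in> sort_set M Home_sort" using Gd_in by auto
  then show ?thesis using * unfolding Meq_def by blast
next
  fix n \<phi> xs xs' assume *: "Gd N H" "imag_ok n \<phi>" "length xs = n" "list_all2 (\<lambda>x x'. (x, x') \<in> H) xs xs'"
      "c = Cls n \<phi> xs" "c' = Cls n \<phi> xs'"
  show ?thesis using Cls_in_sort[OF *(2)] list_all2_H_tuples[OF *(1,4,3)] * unfolding Meq_def by blast
qed

lemma Meq_cases:
  assumes "c \<in> Meq M"
  obtains (Home) x where "x \<in> P" "c = Home x"
  | (Cls) n \<phi> xs where "imag_ok n \<phi>" "length xs = n" "set xs \<subseteq> P" "c = Cls n \<phi> xs"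
proof -
  obtain s where s: "c \<in> sort_set M s" using assms by (auto simp: Meq_def)
  show ?thesis
  proof (cases s)
    case Home_sort then show ?thesis using s Home by auto
  next
    case (Imag_sort n \<phi>)
    then have "imag_ok n \<phi>" "c \<in> Imag n \<phi> ` (tuples M n // imag_rel M n \<phi>)"
      using s by (auto simp: imag_ok_def split: if_splits)
    then show ?thesis using Cls by (auto simp: quotient_def tuples_def)
  qed
qed

lemma Cls_eq_iff:
  assumes "imag_ok n \<phi>" "xs \<in> tuples M n" "ys \<in> tuples M n"
  shows "Cls n \<phi> xs = Cls n \<phi> ys \<longleftrightarrow> sat M (\<lambda>i. (xs @ ys) ! i) \<phi>"
proof -
  have "Cls n \<phi> xs = Cls n \<phi> ys \<longleftrightarrow> (xs, ys) \<in> imag_rel M n \<phi>"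
    using eq_equiv_class_iff[of "tuples M n" "imag_rel M n \<phi>" xs ys] assms by (auto simp: imag_ok_def)
  then show ?thesis using assms by (simp add: imag_rel_def)
qed

lemma Cls_Gd:
  assumes "Gd N H" "2 \<le> N" "lv \<phi> dvd N" "imag_ok n \<phi>" "length xs = n" "length ys = n"
    "list_all2 (\<lambda>x x'. (x, x') \<in> H) xs xs'" "list_all2 (\<lambda>x x'. (x, x') \<in> H) ys ys'"
  shows "Cls n \<phi> xs = Cls n \<phi> ys \<longleftrightarrow> Cls n \<phi> xs' = Cls n \<phi> ys'"
proof -
  note t = list_all2_H_tuples[OF assms(1,7,5)] list_all2_H_tuples[OF assms(1,8,6)]
  have a: "list_all2 (\<lambda>x x'. (x, x') \<in> H) (xs @ ys) (xs' @ ys')" using assms by (intro list_all2_appendI)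
  have "((xs @ ys) ! i, (xs' @ ys') ! i) \<in> H" if "i \<in> fv \<phi>" for i
    using list_all2_nthD[OF a] that assms(4-6) by (auto simp: imag_ok_def)
  then have "sat M (\<lambda>i. (xs @ ys) ! i) \<phi> \<longleftrightarrow> sat M (\<lambda>i. (xs' @ ys') ! i) \<phi>"
    by (intro sat_Gd[OF assms(1-3)]) auto
  then show ?thesis using Cls_eq_iff[OF assms(4)] t by simp
qed

text \<open>Equality of two classes of the same sort is a formula in their representatives, and its
  level divides \<open>N\<close>. This makes \<open>rel H\<close> single-valued and
  injective.\<close>

lemma rel_eq_iff:
  assumes "Gd N H" "2 \<le> N" "elv c dvd N" "rel H c c'" "rel H d d'"
  shows "c = d \<longleftrightarrow> c' = d'"
  using assms(4)
proof (cases rule: rel_cases)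
  case (Home x x')
  show ?thesis using assms(5)
  proof (cases rule: rel_cases)
    case (Home y y')
    then show ?thesis using Gd_eq_iff[OF assms(1,2) \<open>(x, x') \<in> H\<close> Home(1)] \<open>c = Home x\<close> \<open>c' = Home x'\<close> by simp
  qed (use Home in auto)
next
  case 1: (Cls n \<phi> xs xs')
  show ?thesis using assms(5)
  proof (cases rule: rel_cases)
    case 2: (Cls m \<psi> ys ys')
    show ?thesis
    proof (cases "m = n \<and> \<psi> = \<phi>")
      case True
      then show ?thesis using Cls_Gd[OF assms(1,2) _ 1(1,2) _ 1(3), of ys ys'] 1 2 assms(3) by simp
    qed (use 1 2 in auto)
  qed (use 1 in auto)
qed

lemma rel_total_finite:
  assumes "finite C" "C \<subseteq> Meq M" "Gd N H" "2 \<le> N"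
  shows "\<exists>H'. Gd N H' \<and> H \<subseteq> H' \<and> (\<forall>c\<in>C. \<exists>c'. rel H' c c')"
  using assms(1,2)
proof (induction C)
  case empty then show ?case using assms by auto
next
  case (insert c C)
  then obtain H' where H': "Gd N H'" "H \<subseteq> H'" "\<forall>c\<in>C. \<exists>c'. rel H' c c'" by auto
  have "c \<in> Meq M" using insert by auto
  then have "\<exists>H''. Gd N H'' \<and> H' \<subseteq> H'' \<and> (\<exists>c'. rel H'' c c')"
  proof (cases rule: Meq_cases)
    case (Home x)
    then show ?thesis using Gd_extend[OF H'(1) assms(4) Home(1)] rel_Home by blast
  next
    case (Cls n \<phi> xs)
    then show ?thesis using Gd_extend_list[OF H'(1) assms(4) Cls(3)] rel_Cls by blast
  qed
  then obtain H'' c' where H'': "Gd N H''" "H' \<subseteq> H''" "rel H'' c c'" by blast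
  have "\<forall>d\<in>insert c C. \<exists>d'. rel H'' d d'" using H'(3) H'' rel_mono[OF _ H''(2)] by blast
  then show ?case using H'(2) H'' by blast
qed

lemma rel_total:
  assumes "c \<in> Meq M" "Gd N H" "2 \<le> N"
  obtains H' c' where "Gd N H'" "H \<subseteq> H'" "rel H' c c'"
  using rel_total_finite[of "{c}" N H] assms by auto

text \<open>The two relations may reach \<open>d\<close> through different representing tuples. The
  tuple coming from \<open>H\<close> is therefore moved by an enlargement of the second map, and
  \<open>rel_eq_iff\<close> identifies the resulting class with \<open>e\<close>; hence the enlarged
  relation in the conclusion.\<close>

lemma rel_trans:
  assumes "Gd N H" "Gd N H'" "2 \<le> N" "elv c dvd N" "rel H c d" "rel H' d e"
  shows "\<exists>H''. Gd N H'' \<and> H O H' \<subseteq> H'' \<and> rel H'' c e"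
  using assms(5)
proof (cases rule: rel_cases)
  case (Home x x')
  have "rel (H O H') c e" using assms(6) by (cases rule: rel_cases) (use Home in \<open>auto intro!: rel_Home\<close>)
  then show ?thesis using Gd_comp[OF assms(1,2)] by blast
next
  case (Cls n \<phi> xs xs')
  have "set xs' \<subseteq> P" using list_all2_H_tuples[OF assms(1) Cls(3,2)] by (auto simp: tuples_def)
  then obtain xs'' K1 where K1: "Gd N K1" "H' \<subseteq> K1" "list_all2 (\<lambda>x x'. (x, x') \<in> K1) xs' xs''"
    using Gd_extend_list[OF assms(2,3)] by blast
  have "length xs' = n" using Cls by (simp add: list_all2_lengthD)
  then have r1: "rel K1 d (Cls n \<phi> xs'')" using rel_Cls[OF Cls(1) _ K1(3)] Cls by simp
  have r2: "rel K1 d e" using rel_mono[OF assms(6) K1(2)] .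
  have "elv d dvd N" using rel_elv[OF assms(5)] assms(4) by simp
  from rel_eq_iff[OF K1(1) assms(3) this r2 r1] have e: "e = Cls n \<phi> xs''" by simp
  have "list_all2 (\<lambda>x x'. (x, x') \<in> H O K1) xs xs''"
    by (rule list_all2_trans[OF _ Cls(3) K1(3)]) auto
  then have "rel (H O K1) c e" using rel_Cls[OF Cls(1,2)] Cls e by simp
  then show ?thesis using Gd_comp[OF assms(1) K1(1)] K1(2) by blast
qed

lemma qsat_proj_rel:
  assumes "Gd N H" "2 \<le> N" "lv \<phi> dvd N" "\<forall>i\<in>insert j (set js). rel H (v i) (v' i)"
    and "qsat M v (QProj n \<phi> js j)"
  shows "qsat M v' (QProj n \<phi> js j)"
proof -
  have vj: "v j \<in> sort_set M (Imag_sort n \<phi>)" using assms(5) by simp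
  then have ok: "imag_ok n \<phi>" by (auto simp: imag_ok_def split: if_splits)
  from assms(5) obtain xs where xs: "xs \<in> tuples M n" "map v js = map Home xs" "v j = Cls n \<phi> xs" by auto
  have len: "length js = length xs" using xs(2) by (metis length_map)
  have "\<exists>x'. (xs ! k, x') \<in> H \<and> v' (js ! k) = Home x'" if "k < length xs" for k
  proof -
    have "v (js ! k) = Home (xs ! k)" using xs(2) that len by (metis nth_map)
    moreover have "rel H (v (js ! k)) (v' (js ! k))" using assms(4) that len by simp
    ultimately show ?thesis by (auto elim: rel_cases)
  qed
  then obtain f where f: "\<And>k. k < length xs \<Longrightarrow> (xs ! k, f k) \<in> H \<and> v' (js ! k) = Home (f k)" by metis
  define xs' where "xs' = map f [0..<length xs]"
  have l2: "list_all2 (\<lambda>x x'. (x, x') \<in> H) xs xs'" using f by (auto simp: xs'_def list_all2_conv_all_nth)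
  have n: "length xs = n" using xs(1) by (simp add: tuples_def)
  have "map v' js = map Home xs'" using f len by (auto simp: xs'_def intro: nth_equalityI)
  moreover have "xs' \<in> tuples M n" using list_all2_H_tuples[OF assms(1) l2 n] by simp
  moreover have "v' j = Cls n \<phi> xs'"
  proof -
    have "rel H (v j) (v' j)" using assms(4) by simp
    moreover have "rel H (v j) (Cls n \<phi> xs')" using rel_Cls[OF ok n l2] xs(3) by simp
    ultimately show ?thesis using rel_eq_iff[OF assms(1,2), of "v j" "v' j" "v j"] assms(3) xs(3) by simp
  qed
  ultimately show ?thesis using Cls_in_sort[OF ok, of xs'] by auto
qed

lemma qsat_rel_imp:
  assumes "Gd N H" "2 \<le> N" "qlv \<psi> dvd N" "\<forall>i\<in>qfv \<psi>. rel H (v i) (v' i) \<and> elv (v i) dvd N" "qsat M v \<psi>"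
  shows "qsat M v' \<psi>"
  using assms
proof (induction \<psi> arbitrary: v v' H)
  case (QEq i j)
  then show ?case using rel_eq_iff[OF QEq(1,2), of "v i" "v' i" "v j" "v' j"] by simp
next
  case (QS i j k)
  then obtain a b c where abc: "v i = Home a" "v j = Home b" "v k = Home c" "circ M a b c" by auto
  have "rel H (v i) (v' i)" "rel H (v j) (v' j)" "rel H (v k) (v' k)" using QS(4) by auto
  then obtain a' b' c' where "(a, a') \<in> H" "v' i = Home a'" "(b, b') \<in> H" "v' j = Home b'"
    "(c, c') \<in> H" "v' k = Home c'" using abc by (auto elim!: rel_cases)
  then show ?case using Gd_circ_iff[OF QS(1,2)] Gd_in[OF QS(1)] abc by auto
next
  case (QRot n i j)
  then obtain a where a: "v i = Home a" "v j = Home (rot M n a)" by auto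
  have "rel H (v i) (v' i)" "rel H (v j) (v' j)" using QRot(4) by auto
  then obtain a' b' where ab: "(a, a') \<in> H" "v' i = Home a'" "(rot M n a, b') \<in> H" "v' j = Home b'"
    using a by (auto elim!: rel_cases)
  have H': "Gd N (insert (rot M n a, rot M n a') H)" using Gd_rot[OF QRot(1,2) ab(1)] QRot(3) by simp
  have "b' = rot M n a'" using Gd_eq_iff[OF H' QRot(2), of "rot M n a" "rot M n a'" "rot M n a" b'] ab by auto
  then show ?case using ab Gd_in[OF QRot(1) ab(1)] by auto
next
  case (QProj n \<phi> js j)
  show ?case by (rule qsat_proj_rel[OF QProj(1,2) _ _ QProj(5)]) (use QProj(3,4) in auto)
next
  case (QNot \<psi>)
  have "\<forall>i\<in>qfv \<psi>. rel (H\<inverse>) (v' i) (v i) \<and> elv (v' i) dvd N"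
    using QNot(5) rel_converse rel_elv by (metis qfv.simps(5))
  then show ?case using QNot.IH[OF Gd_converse[OF QNot(2)] QNot(3), of v' v] QNot(4,6) by auto
next
  case (QAnd \<psi> \<chi>)
  have d: "qlv \<psi> dvd N" "qlv \<chi> dvd N" using dvd_multD[of "qlv \<psi>" "qlv \<chi>" N] QAnd(5) by simp_all
  show ?case using QAnd.IH(1)[OF QAnd(3,4) d(1), of v v'] QAnd.IH(2)[OF QAnd(3,4) d(2), of v v'] QAnd(6,7) by auto
next
  case (QEx s i \<psi>)
  have d: "slv s dvd N" "qlv \<psi> dvd N" using dvd_multD[of "slv s" "qlv \<psi>" N] QEx(4) by simp_all
  obtain x where x: "x \<in> sort_set M s" "qsat M (v(i := x)) \<psi>" using QEx(6) by auto
  have "x \<in> Meq M" using x(1) by (auto simp: Meq_def)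
  then obtain H' x' where H': "Gd N H'" "H \<subseteq> H'" "rel H' x x'" using rel_total QEx(2,3) by blast
  \<comment> \<open>The factor \<open>slv s\<close> in \<open>qlv\<close> is there for this: the
    witness of the quantifier is decided at level \<open>N\<close> too.\<close>
  have "elv x dvd N" using x(1) d(1) by (cases s) (auto split: if_splits)
  then have "\<forall>j\<in>qfv \<psi>. rel H' ((v(i := x)) j) ((v'(i := x')) j) \<and> elv ((v(i := x)) j) dvd N"
    using QEx(5) H'(3) rel_mono[OF _ H'(2)] by auto
  from QEx.IH[OF H'(1) QEx(3) d(2) this x(2)] have "qsat M (v'(i := x')) \<psi>" .
  then show ?case using rel_sort[OF H'(1,3), of s] x(1) unfolding qsat.simps by blast
qed

lemma qsat_rel:
  assumes "Gd N H" "2 \<le> N" "qlv \<psi> dvd N" "\<forall>i\<in>qfv \<psi>. rel H (v i) (v' i) \<and> elv (v i) dvd N"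
  shows "qsat M v \<psi> \<longleftrightarrow> qsat M v' \<psi>"
proof -
  have "\<forall>i\<in>qfv \<psi>. rel (H\<inverse>) (v' i) (v i) \<and> elv (v' i) dvd N" using assms(4) rel_converse rel_elv by metis
  then show ?thesis using qsat_rel_imp[OF assms] qsat_rel_imp[OF Gd_converse[OF assms(1)] assms(2,3)] by blast
qed

section \<open>Finite orbits\<close>

text \<open>The finite-level form of being fixed by all automorphisms over \<open>D\<close>; finite
  partial maps take the place of automorphisms.\<close>

definition fixd :: "nat \<Rightarrow> 'a set \<Rightarrow> 'a meq \<Rightarrow> bool" where
  "fixd N D c \<longleftrightarrow> (\<forall>H d. Gd N H \<and> Id_on D \<subseteq> H \<and> rel H c d \<longrightarrow> d = c)"

definition orbit :: "nat \<Rightarrow> 'a set \<Rightarrow> 'a meq \<Rightarrow> 'a meq set" where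
  "orbit N D c = {d. \<exists>H. Gd N H \<and> Id_on D \<subseteq> H \<and> rel H c d}"

lemma fixdD: "fixd N D c \<Longrightarrow> Gd N H \<Longrightarrow> Id_on D \<subseteq> H \<Longrightarrow> rel H c d \<Longrightarrow> d = c"
  by (auto simp: fixd_def)

lemma fixd_mono: "fixd N D c \<Longrightarrow> D \<subseteq> D' \<Longrightarrow> fixd N D' c"
  unfolding fixd_def Id_on_def by blast

text \<open>Maps preserving codes of level \<open>N\<close> preserve those of the divisor
  \<open>n\<close>, so fewer maps have to fix \<open>c\<close> at level \<open>N\<close>.\<close>

lemma fixd_dvd: "fixd n D c \<Longrightarrow> 2 \<le> n \<Longrightarrow> n dvd N \<Longrightarrow> N > 0 \<Longrightarrow> fixd N D c"
  unfolding fixd_def using Gd_dvd by blast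

lemma orbit_mono: "D \<subseteq> D' \<Longrightarrow> orbit N D' c \<subseteq> orbit N D c"
  unfolding orbit_def by blast

text \<open>Two maps that agree on \<open>D\<close> differ by a map over \<open>D\<close>: the first
  followed by the converse of the second fixes \<open>D\<close> pointwise, and so it fixes
  \<open>c\<close>.\<close>

lemma unique_image:
  assumes "fixd N D c" "2 \<le> N" "elv c dvd N" "Gd N K1" "Gd N K2" "rel K1 c e1" "rel K2 c e2"
    and "\<And>x. x \<in> D \<Longrightarrow> \<exists>y. (x, y) \<in> K1 \<and> (x, y) \<in> K2"
  shows "e1 = e2"
proof -
  have e1: "e1 \<in> Meq M" using rel_Meq assms by blast
  obtain K3 c1 where K3: "Gd N K3" "K2\<inverse> \<subseteq> K3" "rel K3 e1 c1"
    using rel_total[OF e1 Gd_converse[OF assms(5)] assms(2)] by blast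
  obtain H' where H': "Gd N H'" "K1 O K3 \<subseteq> H'" "rel H' c c1"
    using rel_trans[OF assms(4) K3(1) assms(2,3,6) K3(3)] by blast
  have "Id_on D \<subseteq> H'" using assms(8) K3(2) H'(2) by fastforce
  then have "c1 = c" using fixdD[OF assms(1) H'(1) _ H'(3)] by blast
  moreover have "rel K3 e2 c" using rel_mono[OF rel_converse[OF assms(7)] K3(2)] .
  ultimately show ?thesis
    using rel_eq_iff[OF K3(1) assms(2) _ K3(3), of e2 c] rel_elv[OF assms(6)] assms(3) by simp
qed

lemma fixd_support:
  assumes "c \<in> Meq M" "2 \<le> N" "elv c dvd N"
  shows "\<exists>D. finite D \<and> D \<subseteq> P \<and> fixd N D c"
  using assms(1)
proof (cases rule: Meq_cases)
  case (Home x)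
  have "d = c" if "Gd N H" "Id_on {x} \<subseteq> H" "rel H c d" for H d
    using rel_eq_iff[OF that(1) assms(2,3) that(3), of c c] rel_Home[of x x H] that Home by auto
  then show ?thesis using Home unfolding fixd_def by (intro exI[of _ "{x}"]) auto
next
  case (Cls n \<phi> xs)
  have "d = c" if "Gd N H" "Id_on (set xs) \<subseteq> H" "rel H c d" for H d
  proof -
    have "list_all2 (\<lambda>x x'. (x, x') \<in> H) xs xs" using that(2) by (auto simp: list_all2_conv_all_nth Id_on_def)
    then show ?thesis using rel_eq_iff[OF that(1) assms(2,3) that(3), of c c] rel_Cls[OF Cls(1,2)] Cls by auto
  qed
  then show ?thesis using Cls unfolding fixd_def by (intro exI[of _ "set xs"]) auto
qed

text \<open>If \<open>c\<close> depends on \<open>x\<close> only, its value is the same for any \<open>y\<close>, \<open>z\<close> that look like two members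
  of an infinite indiscernible sequence: by finiteness two members of the sequence give the same value.\<close>

lemma finite_orbit_const:
  fixes f :: "nat \<Rightarrow> 'a"
  assumes N: "2 \<le> N" "elv c dvd N" and D: "finite D" "D \<subseteq> P" and x: "x \<in> P" and fx: "fixd N (insert x D) c"
    and fin: "finite (orbit N D c)"
    and f: "\<And>i. f i \<in> P" "\<And>i a. a \<in> D \<Longrightarrow> cod N a (f i) = cod N a x" "\<And>i j. i < j \<Longrightarrow> cod N (f i) (f j) = 1"
    and yz: "y \<in> P" "z \<in> P" "\<And>a. a \<in> D \<Longrightarrow> cod N a y = cod N a x" "\<And>a. a \<in> D \<Longrightarrow> cod N a z = cod N a x"
      "cod N y z = 1"
    and H: "Gd N Hy" "Id_on D \<subseteq> Hy" "(x, y) \<in> Hy" "rel Hy c ey" "Gd N Hz" "Id_on D \<subseteq> Hz" "(x, z) \<in> Hz" "rel Hz c ez"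
  shows "ey = ez"
proof -
  have c: "c \<in> Meq M" using rel_Meq H by blast
  have Gi: "Gd N (insert (u, w) (Id_on D))" if "u \<in> P" "w \<in> P" "\<And>a. a \<in> D \<Longrightarrow> cod N a u = cod N a w" for u w
    by (rule Gd_insertI[OF Gd_Id_on[OF D] N(1)]) (use that in auto)
  have "\<exists>e H. Gd N H \<and> Id_on D \<subseteq> H \<and> (x, f i) \<in> H \<and> rel H c e" for i
  proof -
    have "Gd N (insert (x, f i) (Id_on D))" by (rule Gi) (use x f in auto)
    then show ?thesis using rel_total[OF c _ N(1)] by (metis insert_subset)
  qed
  then obtain e Hf where e: "\<And>i. Gd N (Hf i) \<and> Id_on D \<subseteq> Hf i \<and> (x, f i) \<in> Hf i \<and> rel (Hf i) c (e i)" by metis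
  have "range e \<subseteq> orbit N D c" using e by (auto simp: orbit_def)
  \<comment> \<open>Infinitely many positions \<open>f i\<close> for \<open>x\<close>, but finitely
    many values: two positions share one.\<close>
  then have "\<not> inj e" using fin by (meson finite_imageD finite_subset infinite_UNIV_nat)
  then obtain i j where ij: "i < j" "e i = e j" by (metis injI linorder_neqE_nat)
  \<comment> \<open>The pair \<open>f i\<close>, \<open>f j\<close> is sent to \<open>y\<close>,
    \<open>z\<close> over \<open>D\<close>. The common value \<open>e i = e j\<close> has one image
    \<open>d\<close>, which is then the value at \<open>y\<close> as well as at
    \<open>z\<close>.\<close>
  have "Gd N (insert (f j, z) (insert (f i, y) (Id_on D)))"
  proof (rule Gd_insertI[OF Gi N(1)])
    fix a a' assume "(a, a') \<in> insert (f i, y) (Id_on D)"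
    then show "cod N a (f j) = cod N a' z" using f yz ij by auto
  qed (use f yz in auto)
  then obtain H' d where H': "Gd N H'" "insert (f j, z) (insert (f i, y) (Id_on D)) \<subseteq> H'" "rel H' (e i) d"
    using rel_total[of "e i", OF _ _ N(1)] rel_Meq e by metis
  have D': "(a, a) \<in> H'" if "a \<in> D" for a using H'(2) that by auto
  obtain K1 where K1: "Gd N K1" "Hf i O H' \<subseteq> K1" "rel K1 c d"
    using rel_trans[of N "Hf i" H' c "e i" d] e H' N by blast
  obtain K2 where K2: "Gd N K2" "Hf j O H' \<subseteq> K2" "rel K2 c d"
    using rel_trans[of N "Hf j" H' c "e j" d] e H' N ij by auto
  have "ey = d"
  proof (rule unique_image[OF fx N H(1) K1(1) H(4) K1(3)])
    fix u assume "u \<in> insert x D"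
    then show "\<exists>w. (u, w) \<in> Hy \<and> (u, w) \<in> K1"
    proof
      assume "u = x"
      then have "(u, y) \<in> K1" using e[of i] H'(2) K1(2) by blast
      then show ?thesis using H \<open>u = x\<close> by blast
    next
      assume "u \<in> D"
      then have "(u, u) \<in> K1" using e[of i] K1(2) D' by blast
      then show ?thesis using H \<open>u \<in> D\<close> by blast
    qed
  qed
  moreover have "ez = d"
  proof (rule unique_image[OF fx N H(5) K2(1) H(8) K2(3)])
    fix u assume "u \<in> insert x D"
    then show "\<exists>w. (u, w) \<in> Hz \<and> (u, w) \<in> K2"
    proof
      assume "u = x"
      then have "(u, z) \<in> K2" using e[of j] H'(2) K2(2) by blast
      then show ?thesis using H \<open>u = x\<close> by blast
    next
      assume "u \<in> D"
      then have "(u, u) \<in> K2" using e[of j] K2(2) D' by blast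
      then show ?thesis using H \<open>u \<in> D\<close> by blast
    qed
  qed
  ultimately show ?thesis by simp
qed

lemma circ_trans:
  assumes "a \<in> P" "p \<in> P" "q \<in> P" "r \<in> P" "circ M a p q" "circ M a q r" shows "circ M a p r"
proof -
  obtain s where s: "shadow 1 (length [a, p, q, r]) ((!) [a, p, q, r]) s"
    using shadow_list[of "[a,p,q,r]" 1] assms by auto
  show ?thesis
    using shadow_circ[OF s, of 0 1 2] shadow_circ[OF s, of 0 2 3] shadow_circ[OF s, of 0 1 3] assms
    by (simp add: cyc_def)
qed

lemma circ_total:
  assumes "a \<in> P" "p \<in> P" "q \<in> P" "a \<noteq> p" "a \<noteq> q" "p \<noteq> q" shows "circ M a p q \<or> circ M a q p"
proof -
  obtain s where s: "shadow 1 (length [a, p, q]) ((!) [a, p, q]) s"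
    using shadow_list[of "[a,p,q]" 1] assms by auto
  have ne: "s 1 - s 0 \<notin> \<int>" "s 2 - s 0 \<notin> \<int>" "s 2 - s 1 \<notin> \<int>"
    using shadow_rots[OF s, of 0 1 1 0] shadow_rots[OF s, of 0 2 1 0] shadow_rots[OF s, of 1 2 1 0] assms by auto
  have "frac (s 1 - s 0) \<noteq> frac (s 2 - s 0)"
  proof
    assume "frac (s 1 - s 0) = frac (s 2 - s 0)"
    then have "s 2 - s 1 = of_int (\<lfloor>s 2 - s 0\<rfloor> - \<lfloor>s 1 - s 0\<rfloor>)" by (simp add: frac_def)
    then show False using ne(3) by (metis Ints_of_int)
  qed
  then show ?thesis
    using shadow_circ[OF s, of 0 1 2] shadow_circ[OF s, of 0 2 1] ne by (auto simp: cyc_def)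
qed

text \<open>The step from \<open>x\<close> to \<open>x'\<close> is copied to start at any point in
  the same position over \<open>D\<close>, and then iterated. All these points have the same
  positive code from \<open>a0\<close>, so code 1 between two of them is the order seen from
  \<open>a0\<close>, which is transitive.\<close>

lemma increasing_sequence:
  assumes N: "2 \<le> N" and D: "finite D" "D \<subseteq> P" "a0 \<in> D" and xx: "x \<in> P" "x' \<in> P" "\<And>a. a \<in> D \<Longrightarrow> cod N a x' = cod N a x"
    and 1: "cod N x x' = 1" and 2: "cod N a0 x > 0"
  shows "\<exists>f :: nat \<Rightarrow> 'a. (\<forall>i. f i \<in> P) \<and> (\<forall>i. \<forall>a\<in>D. cod N a (f i) = cod N a x) \<and> (\<forall>i j. i < j \<longrightarrow> cod N (f i) (f j) = 1)"
proof -
  define gap where "gap = (\<lambda>q. q \<in> P \<and> (\<forall>a\<in>D. cod N a q = cod N a x))"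
  have "\<exists>r. gap r \<and> cod N q r = 1" if q: "gap q" for q
  proof -
    have "Gd N (insert (x, q) (Id_on D))"
      by (rule Gd_insertI[OF Gd_Id_on[OF D(1,2)] N]) (use q xx in \<open>auto simp: gap_def\<close>)
    then obtain r where r: "r \<in> P" "Gd N (insert (x', r) (insert (x, q) (Id_on D)))" using Gd_extend[OF _ N xx(2)] by blast
    have "cod N a r = cod N a x" if "a \<in> D" for a using GdD[OF r(2), of a a x' r] xx(3)[OF that] that by (simp add: Id_on_def)
    moreover have "cod N q r = 1" using GdD[OF r(2), of x q x' r] 1 by auto
    ultimately show ?thesis using r(1) by (auto simp: gap_def)
  qed
  moreover have "gap x" using xx by (auto simp: gap_def)
  ultimately obtain f where f: "\<And>n. gap (f n)" "\<And>n. cod N (f n) (f (Suc n)) = 1"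
    using dependent_nat_choice[of "\<lambda>_. gap" "\<lambda>_ p q. cod N p q = 1"] by metis
  have a0: "a0 \<in> P" using D by auto
  have circ: "circ M a0 p q \<longleftrightarrow> cod N p q = 1" if "gap p" "gap q" for p q
    using circ_cod[OF a0 _ _ N, of p q] that D(3) 2 by (auto simp: gap_def)
  have "circ M a0 (f i) (f (Suc (i + k)))" for i k
  proof (induction k)
    case 0 then show ?case using circ f by simp
  next
    case (Suc k)
    have "circ M a0 (f (Suc (i + k))) (f (Suc (i + Suc k)))" using circ f by simp
    then show ?case using circ_trans[OF a0] Suc f by (meson gap_def)
  qed
  then have "cod N (f i) (f j) = 1" if "i < j" for i j
    using circ f less_imp_Suc_add[OF that] by metis
  then show ?thesis using f(1) by (intro exI[of _ f]) (auto simp: gap_def)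
qed

text \<open>A map over \<open>D\<close> taking \<open>c\<close> to \<open>d\<close> also moves
  \<open>x\<close> to some \<open>x'\<close> in the same position over \<open>D\<close>. The
  identity realises the value \<open>c\<close> at \<open>x\<close>, the given map the value
  \<open>d\<close> at \<open>x'\<close>, and an increasing sequence shows that both values
  agree.\<close>

lemma fixd_drop:
  assumes N: "2 \<le> N" "elv c dvd N" and D: "finite D" "D \<subseteq> P" "D \<noteq> {}" and x: "x \<in> P" and fx: "fixd N (insert x D) c"
    and fin: "finite (orbit N D c)"
  shows "fixd N D c"
  unfolding fixd_def
proof (intro allI impI, elim conjE)
  fix H0 d assume H0: "Gd N H0" "Id_on D \<subseteq> H0" "rel H0 c d"
  have c: "c \<in> Meq M" using rel_Meq H0 by blast
  obtain x' where x': "x' \<in> P" "Gd N (insert (x, x') H0)" using Gd_extend[OF H0(1) N(1) x] by blast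
  define H where "H = insert (x, x') H0"
  have H: "Gd N H" "Id_on D \<subseteq> H" "(x, x') \<in> H" "rel H c d"
    using x' H0 by (auto simp: H_def intro: rel_mono)
  have g: "cod N a x' = cod N a x" if "a \<in> D" for a using GdD[OF H(1), of a a x x'] H that by auto
  show "d = c"
  proof (cases "x' = x")
    case True
    then show ?thesis using fixdD[OF fx H(1) _ H(4)] H by auto
  next
    case ne: False
    obtain a0 where a0: "a0 \<in> D" using D by blast
    then have a0P: "a0 \<in> P" using D by blast
    have pos: "cod N a0 x > 0"
    proof (rule ccontr)
      assume "\<not> cod N a0 x > 0"
      then have "a0 = x" "a0 = x'" using cod_eq_0[of a0 x N] cod_eq_0[of a0 x' N] g[OF a0] a0P x x' N by auto
      then show False using ne by simp
    qed
    have "a0 \<noteq> x" "a0 \<noteq> x'"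
      using cod_eq_0[of a0 x N] cod_eq_0[of a0 x' N] g[OF a0] a0P x x' N pos by auto
    then have "circ M a0 x x' \<or> circ M a0 x' x" using circ_total a0P x x' ne by metis
    then have or: "cod N x x' = 1 \<or> cod N x' x = 1"
      using circ_cod[OF a0P x x'(1) N(1)] circ_cod[OF a0P x'(1) x N(1)] g[OF a0] by auto
    obtain Hx d' where Hx: "Gd N Hx" "insert (x, x) (Id_on D) \<subseteq> Hx" "rel Hx c d'"
    proof -
      have "Gd N (Id_on (insert x D))" by (rule Gd_Id_on) (use D x in auto)
      moreover have "Id_on (insert x D) = insert (x, x) (Id_on D)" by auto
      ultimately show ?thesis using rel_total[OF c _ N(1)] that by metis
    qed
    have "Id_on (insert x D) \<subseteq> Hx" using Hx(2) by auto
    then have d': "d' = c" using fixdD[OF fx Hx(1) _ Hx(3)] by blast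
    have Hx': "Id_on D \<subseteq> Hx" "(x, x) \<in> Hx" "rel Hx c c" using Hx d' by auto
    show "d = c"
    proof (cases "cod N x x' = 1")
      case True
      obtain f :: "nat \<Rightarrow> 'a" where f: "\<And>i. f i \<in> P" "\<And>i a. a \<in> D \<Longrightarrow> cod N a (f i) = cod N a x"
          "\<And>i j. i < j \<Longrightarrow> cod N (f i) (f j) = 1"
        using increasing_sequence[OF N(1) D(1,2) a0 x x'(1) g True pos] by metis
      have "c = d"
        by (rule finite_orbit_const[OF N D(1,2) x fx fin f x x'(1) refl g True Hx(1) Hx' H])
      then show ?thesis by simp
    next
      case False
      \<comment> \<open>Now \<open>x'\<close> precedes \<open>x\<close>; the sequence starts at
        \<open>x'\<close> and the roles are exchanged.\<close>
      then have 1: "cod N x' x = 1" using or by blast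
      have pos': "cod N a0 x' > 0" using pos g[OF a0] by simp
      obtain f :: "nat \<Rightarrow> 'a" where f: "\<And>i. f i \<in> P" "\<And>i a. a \<in> D \<Longrightarrow> cod N a (f i) = cod N a x'"
          "\<And>i j. i < j \<Longrightarrow> cod N (f i) (f j) = 1"
        using increasing_sequence[OF N(1) D(1,2) a0 x'(1) x g[symmetric] 1 pos'] by metis
      have f': "cod N a (f i) = cod N a x" if "a \<in> D" for a i using f(2) g that by simp
      show ?thesis
        by (rule finite_orbit_const[OF N D(1,2) x fx fin f(1) f' f(3) x'(1) x g refl 1 H Hx(1) Hx'])
    qed
  qed
qed

text \<open>The points of a support are dropped one at a time; \<open>D\<close> stays nonempty and
  so offers the base point that \<open>fixd_drop\<close> needs.\<close>

lemma fixd_if_finite_orbit_nonempty: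
  assumes N: "2 \<le> N" "elv c dvd N" and c: "c \<in> Meq M" and D: "finite D" "D \<subseteq> P" "D \<noteq> {}"
    and fin: "finite (orbit N D c)"
  shows "fixd N D c"
proof -
  obtain A where A: "finite A" "A \<subseteq> P" "fixd N A c" using fixd_support[OF c N] by blast
  have "fixd N D c" if "finite A" "A \<subseteq> P" "fixd N (A \<union> D) c" for A
    using that
  proof (induction A)
    case empty then show ?case by simp
  next
    case (insert x A)
    have "fixd N (insert x (A \<union> D)) c" using insert.prems by simp
    moreover have "finite (orbit N (A \<union> D) c)" using fin orbit_mono[of D "A \<union> D" N c] by (simp add: finite_subset)
    ultimately have "fixd N (A \<union> D) c"
      by (intro fixd_drop[OF N, of "A \<union> D" x]) (use insert D in auto)
    then show ?case using insert by simp
  qed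
  then show ?thesis using A fixd_mono[OF A(3), of "A \<union> D"] by blast
qed

text \<open>Without a base point there is no linear order to use. Instead \<open>c\<close> is first
  made to depend on a single point \<open>b\<close>, and \<open>b\<close> is carried around the
  circle in steps of code 1, along which the value of \<open>c\<close> stays constant.\<close>

lemma fixd_if_finite_orbit_empty:
  assumes N: "2 \<le> N" "elv c dvd N" and c: "c \<in> Meq M" and fin: "finite (orbit N {} c)"
  shows "fixd N {} c"
  unfolding fixd_def
proof (intro allI impI, elim conjE)
  fix H0 d assume H0: "Gd N H0" "rel H0 c d"
  obtain b where b: "b \<in> P" using points_ne by blast
  have fb: "fixd N {b} c"
    by (rule fixd_if_finite_orbit_nonempty[OF N c]) (use b finite_subset[OF orbit_mono[of "{}" "{b}"] fin] in auto)
  \<comment> \<open>\<open>F y e\<close>: moving \<open>b\<close> to \<open>y\<close> can move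
    \<open>c\<close> to \<open>e\<close>.\<close>
  define F where "F = (\<lambda>y e. \<exists>H. Gd N H \<and> (b, y) \<in> H \<and> rel H c e)"
  \<comment> \<open>A rotation by \<open>1 / N\<close> has code 2, so it is split at an intermediate
    point into two steps of code 1.\<close>
  have mid: "\<exists>z\<in>P. cod N u z = 1 \<and> cod N z (G N 1 u) = 1" if u: "u \<in> P" for u
  proof -
    have c2: "cod N u (G N 1 u) = 2" using cod_rots_self[OF u N(1), of 1] N by simp
    then have "u \<noteq> G N 1 u" using cod_eq_0[OF u u N(1)] by auto
    then obtain z where z: "z \<in> P" "circ M u z (G N 1 u)" using dense[OF u, of "G N 1 u"] u by auto
    then have lt: "0 < cod N u z" "cod N u z < 2 \<or> cod N u z = 2 \<and> cod N z (G N 1 u) = 1"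
      using circ_cod[of u z "G N 1 u" N] u N c2 by auto
    have "cod N u z \<noteq> 2"
    proof
      assume "cod N u z = 2"
      then have "z = G N 1 u" using eq_rots_if_even[of u z N 1] u z N by simp
      then show False using lt \<open>cod N u z = 2\<close> cod_self z N by simp
    qed
    then have 1: "cod N u z = 1" using lt by linarith
    have "int (cod N z (G N 1 u)) = (int (cod N z u) + 2 * int (1 * (N div N))) mod (2 * int N)"
      by (rule cod_rot_right) (use u z N in auto)
    also have "int (cod N z u) = (- 1) mod (2 * int N)" using cod_swap[of u z N] u z N 1 by simp
    finally have "int (cod N z (G N 1 u)) = (- 1 + 2) mod (2 * int N)" using N by (simp add: mod_add_left_eq)
    then show ?thesis using z 1 N by auto
  qed
  obtain w where w: "w \<in> P" "cod N b w = 1" using mid[OF b] by blast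
  then have "b \<noteq> w" using cod_self[OF b N(1)] by auto
  then obtain x' where x': "x' \<in> P" "circ M b x' w" using dense b w by blast
  then have "cod N b x' = 1" "cod N x' w = 1" using circ_cod[OF b x'(1) w(1) N(1)] w(2) by auto
  then have "\<exists>f :: nat \<Rightarrow> 'a. (\<forall>i. f i \<in> P) \<and> (\<forall>i j. i < j \<longrightarrow> cod N (f i) (f j) = 1)"
    using increasing_sequence[of N "{b}" b x' w] N b x' w by auto
  then obtain f :: "nat \<Rightarrow> 'a" where f: "\<And>i. f i \<in> P" "\<And>i j. i < j \<Longrightarrow> cod N (f i) (f j) = 1" by blast
  have Fex: "\<exists>e. F y e" if y: "y \<in> P" for y
  proof -
    have "Gd N {(b, y)}" using Gd_insertI[of N "{}" b y] b y N by (auto simp: Gd_def)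
    then show ?thesis unfolding F_def using rel_total[OF c _ N(1)] by (metis insert_subset)
  qed
  have step: "ey = ez" if "y \<in> P" "z \<in> P" "cod N y z = 1" "F y ey" "F z ez" for y z ey ez
  proof -
    from that obtain Hy Hz where "Gd N Hy" "(b, y) \<in> Hy" "rel Hy c ey" "Gd N Hz" "(b, z) \<in> Hz" "rel Hz c ez"
      by (auto simp: F_def)
    then show ?thesis using finite_orbit_const[OF N, of "{}" b f y z Hy ey Hz ez] b fb fin f that by simp
  qed
  have Gb: "e = c" if "F (G N k b) e" for k e
    using that
  proof (induction k arbitrary: e)
    case 0
    then obtain H where "Gd N H" "(b, b) \<in> H" "rel H c e" by (auto simp: F_def)
    then show ?case using fixdD[OF fb] by auto
  next
    case (Suc k)
    let ?u = "G N k b"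
    have u: "?u \<in> P" using b by simp
    obtain z where z: "z \<in> P" "cod N ?u z = 1" "cod N z (G N 1 ?u) = 1" using mid[OF u] by blast
    have G: "G N 1 ?u = G N (Suc k) b" by (simp add: rots_def)
    obtain eu ez where "F ?u eu" "F z ez" using Fex u z by meson
    then have "eu = c" "eu = ez" "ez = e"
      using Suc step[OF u z(1,2)] step[OF z(1) _ z(3), of ez e] u G b by auto
    then show ?case by simp
  qed
  obtain b' where b': "b' \<in> P" "Gd N (insert (b, b') H0)" using Gd_extend[OF H0(1) N(1) b] by blast
  then have Fd: "F b' d" using rel_mono[OF H0(2), of "insert (b, b') H0"] by (auto simp: F_def)
  show "d = c"
  proof (cases "even (cod N b b')")
    case True
    then obtain m where "cod N b b' = 2 * m" by blast
    then have "b' = G N m b" using eq_rots_if_even b b' N by blast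
    then show ?thesis using Gb Fd by blast
  next
    case False
    then obtain m where m: "cod N b b' = 2 * m + 1" by (auto elim: oddE)
    have 1: "cod N (G N m b) b' = 1" by (rule cod_unrot) (use b b' N m in auto)
    obtain e where "F (G N m b) e" using Fex[of "G N m b"] b by auto
    then show ?thesis using step[OF _ b'(1) 1 _ Fd] Gb b by auto
  qed
qed

lemma fixd_if_finite_orbit:
  assumes "2 \<le> N" "elv c dvd N" "c \<in> Meq M" "finite D" "D \<subseteq> P" "finite (orbit N D c)"
  shows "fixd N D c"
  using assms fixd_if_finite_orbit_nonempty fixd_if_finite_orbit_empty by (cases "D = {}") auto

end

section \<open>Algebraic closure and canonical elementary maps\<close>

instance tm :: countable by countable_datatype
instance fm :: countable by countable_datatype
instance srt :: countable by countable_datatype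
instance qfm :: countable by countable_datatype

definition QExs :: "nat list \<Rightarrow> qfm \<Rightarrow> qfm" where
  "QExs js \<psi> = foldr (QEx Home_sort) js \<psi>"

lemma qfv_QExs: "qfv (QExs js \<psi>) = qfv \<psi> - set js"
  unfolding QExs_def by (induction js) auto

lemma qsat_QExs:
  "qsat M v (QExs js \<psi>) \<longleftrightarrow>
    (\<exists>w. (\<forall>i. i \<notin> set js \<longrightarrow> w i = v i) \<and> (\<forall>i\<in>set js. w i \<in> Home ` points M) \<and> qsat M w \<psi>)"
  unfolding QExs_def by (rule foldr_ex) (simp add: fun_upd_def)

fun QConj :: "qfm list \<Rightarrow> qfm" where
  "QConj [] = QEq 0 0"
| "QConj (\<psi> # \<psi>s) = QAnd \<psi> (QConj \<psi>s)"

lemma qsat_QConj [simp]: "qsat M v (QConj \<psi>s) \<longleftrightarrow> (\<forall>\<psi>\<in>set \<psi>s. qsat M v \<psi>)"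
  by (induction \<psi>s) auto

lemma qfv_QConj: "qfv (QConj \<psi>s) = insert 0 (\<Union>\<psi>\<in>set \<psi>s. qfv \<psi>)"
  by (induction \<psi>s) auto

text \<open>Rotations are available as graphs only, so iterating them needs bound variables;
  \<open>i + j + 1\<close> is a fresh one. For \<open>m = 0\<close> the quantifier over the home
  sort excludes imaginaries.\<close>

primrec qrots :: "nat \<Rightarrow> nat \<Rightarrow> nat \<Rightarrow> nat \<Rightarrow> qfm" where
  "qrots n 0 i j = QAnd (QEq i j) (QEx Home_sort (i + j + 1) (QEq i (i + j + 1)))"
| "qrots n (Suc m) i j = QEx Home_sort (i + j + 1) (QAnd (qrots n m i (i + j + 1)) (QRot (n - 1) (i + j + 1) j))"

lemma qfv_qrots: "qfv (qrots n m i j) \<subseteq> {i, j}"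
proof (induction m arbitrary: j)
  case (Suc m) show ?case using Suc[of "i + j + 1"] by auto
qed auto

definition qcod :: "nat \<Rightarrow> nat \<Rightarrow> nat \<Rightarrow> nat \<Rightarrow> qfm" where
  "qcod N c i j = (if even c then qrots N (c div 2) i j
     else QEx Home_sort (i + j + 1) (QEx Home_sort (i + j + 2)
       (QAnd (QAnd (qrots N (c div 2) i (i + j + 1)) (qrots N (Suc (c div 2)) i (i + j + 2)))
         (QS (i + j + 1) j (i + j + 2)))))"

lemma qfv_qcod: "qfv (qcod N c i j) \<subseteq> {i, j}"
  using qfv_qrots[of N "c div 2" i j] qfv_qrots[of N "c div 2" i "i + j + 1"]
    qfv_qrots[of N "Suc (c div 2)" i "i + j + 2"]
  unfolding qcod_def by (auto simp del: qrots.simps)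

lemma acl_mono: "A \<subseteq> A' \<Longrightarrow> acl M A \<subseteq> acl M A'"
  unfolding acl_def by blast

lemma acl_Meq: "acl M A \<subseteq> Meq M"
  by (auto simp: acl_def Meq_def)

lemma acl_increasing: "A \<subseteq> Meq M \<Longrightarrow> A \<subseteq> acl M A"
proof
  fix c assume "A \<subseteq> Meq M" "c \<in> A"
  then obtain s where s: "c \<in> sort_set M s" by (auto simp: Meq_def)
  have "{x \<in> sort_set M s. qsat M ((\<lambda>_. c)(0 := x)) (QEq 0 1)} \<subseteq> {c}" by auto
  then have "finite {x \<in> sort_set M s. qsat M ((\<lambda>_. c)(0 := x)) (QEq 0 1)}"
    by (rule finite_subset) simp
  then show "c \<in> acl M A" using s \<open>c \<in> A\<close> unfolding acl_def
    by (intro CollectI exI[of _ s] exI[of _ "QEq 0 1"] exI[of _ "\<lambda>_. c"]) auto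
qed

text \<open>Countably many formulas and finite parameter lists, each contributing a finite solution
  set. Assignments are cut down to lists because only finitely many variables occur.\<close>

lemma countable_acl:
  assumes "countable A" shows "countable (acl M A)"
proof -
  define S where "S = (\<lambda>(s, \<psi>, xs). {x \<in> sort_set M s. qsat M ((\<lambda>i. xs ! i)(0 := x)) \<psi>})"
  define S' where "S' = (\<lambda>p. if finite (S p) then S p else {})"
  have "acl M A \<subseteq> (\<Union>p\<in>UNIV \<times> UNIV \<times> lists (insert undefined A). S' p)"
  proof
    fix c assume "c \<in> acl M A"
    then obtain s \<psi> v where c: "c \<in> sort_set M s" "\<forall>i\<in>qfv \<psi> - {0}. v i \<in> A"
      "qsat M (v(0 := c)) \<psi>" "finite {x \<in> sort_set M s. qsat M (v(0 := x)) \<psi>}" by (auto simp: acl_def)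
    obtain n where n: "qfv \<psi> \<subseteq> {..<n}" using finite_nat_bounded[OF finite_qfv] by blast
    define xs where "xs = map (\<lambda>i. if i \<in> qfv \<psi> - {0} then v i else undefined) [0..<n]"
    have "qsat M ((\<lambda>i. xs ! i)(0 := x)) \<psi> = qsat M (v(0 := x)) \<psi>" for x
      by (rule qsat_cong) (use n in \<open>auto simp: xs_def\<close>)
    then have "S (s, \<psi>, xs) = {x \<in> sort_set M s. qsat M (v(0 := x)) \<psi>}" by (simp add: S_def)
    then have "c \<in> S' (s, \<psi>, xs)" using c by (simp add: S'_def)
    moreover have "xs \<in> lists (insert undefined A)" using c(2) by (auto simp: xs_def)
    ultimately show "c \<in> (\<Union>p\<in>UNIV \<times> UNIV \<times> lists (insert undefined A). S' p)" by blast
  qed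
  moreover have "countable (\<Union>p\<in>(UNIV :: srt set) \<times> (UNIV :: qfm set) \<times> lists (insert undefined A). S' p)"
    using assms by (intro countable_UN countable_SIGMA countable_lists) (auto simp: S'_def intro: countable_finite)
  ultimately show ?thesis by (rule countable_subset)
qed

lemma elementary_sort:
  assumes "elementary_on M A h" "c \<in> A" "c \<in> sort_set M s" shows "h c \<in> sort_set M s"
proof -
  \<comment> \<open>This formula says that variable 0 has sort \<open>s\<close>.\<close>
  have "qsat M (\<lambda>_. c) (QEx s 1 (QEq 0 1))" using assms(3) by simp
  then have "qsat M (\<lambda>i. h ((\<lambda>_. c) i)) (QEx s 1 (QEq 0 1))"
    using assms(1,2) unfolding elementary_on_def by fast
  then show ?thesis by simp
qed

section \<open>The algebraic closure of finitely many points\<close>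

context circle_model
begin

lemma qsat_qrots:
  assumes "n > 0"
  shows "qsat M v (qrots n m i j) \<longleftrightarrow> (\<exists>a\<in>P. v i = Home a \<and> v j = Home (G n m a))"
proof (induction m arbitrary: j v)
  case 0
  then show ?case by auto
next
  case (Suc m)
  have "qsat M v (qrots n (Suc m) i j) \<longleftrightarrow>
      (\<exists>x\<in>Home ` P. (\<exists>a\<in>P. v i = Home a \<and> x = Home (G n m a)) \<and> (\<exists>a\<in>P. x = Home a \<and> v j = Home (rot M (n - 1) a)))"
    by (simp add: Suc)
  also have "\<dots> \<longleftrightarrow> (\<exists>a\<in>P. v i = Home a \<and> v j = Home (G n (Suc m) a))"
    by (auto simp: rots_def) (metis rots_def rots_in One_nat_def)
  finally show ?case .
qed

lemma qsat_qcod: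
  assumes "2 \<le> N" "c < 2 * N" "v i = Home a" "v j = Home b" "a \<in> P" "b \<in> P"
  shows "qsat M v (qcod N c i j) \<longleftrightarrow> cod N a b = c"
proof (cases "even c")
  case True
  then obtain m where m: "c = 2 * m" by blast
  have "qsat M v (qcod N c i j) \<longleftrightarrow> b = G N m a"
    using assms qsat_qrots[of N v m i j] m by (auto simp: qcod_def)
  also have "\<dots> \<longleftrightarrow> cod N a b = c"
    using eq_rots_if_even[of a b N m] cod_rots_self[of a N m] assms m by auto
  finally show ?thesis .
next
  case False
  then obtain m where m: "c = 2 * m + 1" by (auto elim: oddE)
  have "qsat M v (qcod N c i j) \<longleftrightarrow> circ M (G N m a) b (G N (Suc m) a)"
  proof -
    have *: "qsat M v (qcod N c i j) \<longleftrightarrow> (\<exists>p\<in>P. \<exists>q\<in>P.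
       (\<exists>a\<in>P. v i = Home a \<and> Home p = Home (G N m a)) \<and> (\<exists>a\<in>P. v i = Home a \<and> Home q = Home (G N (Suc m) a)) \<and>
       circ M p b q)"
      using False m assms by (auto simp: qcod_def qsat_qrots simp del: qrots.simps)
    show ?thesis unfolding * using assms by auto
  qed
  also have "\<dots> \<longleftrightarrow> cod N a b = c" using circ_rots_iff[of a b N m] assms m by simp
  finally show ?thesis .
qed

text \<open>The level-free form of \<open>fixd\<close>: by \<open>fixd_dvd\<close>, every positive
  multiple of a good level is good.\<close>

definition efix :: "'a set \<Rightarrow> 'a meq \<Rightarrow> bool" where
  "efix D c \<longleftrightarrow> c \<in> Meq M \<and> (\<exists>N\<ge>2. elv c dvd N \<and> fixd N D c)"

lemma efix_mono: "efix D c \<Longrightarrow> D \<subseteq> D' \<Longrightarrow> efix D' c"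
  unfolding efix_def using fixd_mono by blast

lemma common_level:
  assumes "finite I" "\<And>i. i \<in> I \<Longrightarrow> efix D (v i)" "0 < L"
  obtains N where "2 \<le> N" "L dvd N" "\<And>i. i \<in> I \<Longrightarrow> fixd N D (v i) \<and> elv (v i) dvd N"
proof -
  have "\<forall>i\<in>I. \<exists>N\<ge>2. elv (v i) dvd N \<and> fixd N D (v i)" using assms(2) by (auto simp: efix_def)
  then obtain n where n: "\<And>i. i \<in> I \<Longrightarrow> 2 \<le> n i \<and> elv (v i) dvd n i \<and> fixd (n i) D (v i)" by metis
  \<comment> \<open>The factor 2 gives \<open>N \<ge> 2\<close> also when \<open>I\<close> is
    empty.\<close>
  define N where "N = 2 * L * (\<Prod>i\<in>I. n i)"
  have "0 < (\<Prod>i\<in>I. n i)" by (rule prod_pos) (use n in fastforce)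
  then have Npos: "N > 0" using assms(3) by (simp add: N_def)
  have "2 dvd N" by (simp add: N_def)
  then have N2: "2 \<le> N" using Npos by (auto intro: dvd_imp_le)
  have "fixd N D (v i) \<and> elv (v i) dvd N" if "i \<in> I" for i
  proof -
    have "n i dvd (\<Prod>i\<in>I. n i)" by (rule dvd_prodI[OF assms(1) that])
    then have "n i dvd N" by (simp add: N_def)
    then show ?thesis using n[OF that] fixd_dvd[of "n i" D "v i" N] Npos dvd_trans by blast
  qed
  then show thesis using that[OF N2] by (simp add: N_def)
qed

text \<open>At a level where all parameters are fixed over \<open>D\<close>, the orbit of
  \<open>c\<close> stays inside the finite solution set, so it is finite. As \<open>A\<close> need
  not consist of points, iterated closures are covered too.\<close>

lemma efix_acl:
  assumes A: "\<And>a. a \<in> A \<Longrightarrow> efix D a" and D: "finite D" "D \<subseteq> P" and c: "c \<in> acl M A"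
  shows "efix D c"
proof -
  from c obtain s \<psi> v where c: "c \<in> sort_set M s" "\<forall>i\<in>qfv \<psi> - {0}. v i \<in> A"
    "qsat M (v(0 := c)) \<psi>" and fin: "finite {x \<in> sort_set M s. qsat M (v(0 := x)) \<psi>}" by (auto simp: acl_def)
  have "efix D (v i)" if "i \<in> qfv \<psi> - {0}" for i using A c(2) that by blast
  then obtain N where N2: "2 \<le> N" and L: "elv c * qlv \<psi> dvd N"
    and N: "\<And>i. i \<in> qfv \<psi> - {0} \<Longrightarrow> fixd N D (v i) \<and> elv (v i) dvd N"
    using common_level[of "qfv \<psi> - {0}" D v "elv c * qlv \<psi>"] by auto
  have d: "elv c dvd N" "qlv \<psi> dvd N" using dvd_multD[OF L] by auto
  have fx: "fixd N D (v i)" "elv (v i) dvd N" if "i \<in> qfv \<psi> - {0}" for i using N[OF that] by auto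
  have cM: "c \<in> Meq M" using c(1) by (auto simp: Meq_def)
  have "orbit N D c \<subseteq> {x \<in> sort_set M s. qsat M (v(0 := x)) \<psi>}"
  proof
    fix d assume "d \<in> orbit N D c"
    then obtain H where H: "Gd N H" "Id_on D \<subseteq> H" "rel H c d" by (auto simp: orbit_def)
    have "v ` (qfv \<psi> - {0}) \<subseteq> Meq M" using A c(2) by (auto simp: efix_def)
    then obtain H' where H': "Gd N H'" "H \<subseteq> H'" "\<forall>a\<in>v ` (qfv \<psi> - {0}). \<exists>b. rel H' a b"
      using rel_total_finite[OF _ _ H(1) N2, of "v ` (qfv \<psi> - {0})"] by auto
    have Hv: "rel H' (v i) (v i)" if "i \<in> qfv \<psi> - {0}" for i
    proof -
      from that have "v i \<in> v ` (qfv \<psi> - {0})" by (rule imageI)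
      from bspec[OF H'(3) this] obtain b where b: "rel H' (v i) b" ..
      have "Id_on D \<subseteq> H'" using H(2) H'(2) by (rule order.trans)
      then have "b = v i" using fixdD[OF fx(1)[OF that] H'(1) _ b] by simp
      then show ?thesis using b by simp
    qed
    have rc: "rel H' c d" using rel_mono[OF H(3) H'(2)] .
    have "qsat M (v(0 := c)) \<psi> \<longleftrightarrow> qsat M (v(0 := d)) \<psi>"
      by (rule qsat_rel[OF H'(1) N2 d(2)]) (use Hv rc fx d(1) in auto)
    then show "d \<in> {x \<in> sort_set M s. qsat M (v(0 := x)) \<psi>}"
      using c rel_sort[OF H(1,3)] by simp
  qed
  then have "finite (orbit N D c)" using fin by (rule finite_subset)
  then have "fixd N D c" using fixd_if_finite_orbit[OF N2 d(1) cM D] by blast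
  then show ?thesis using cM N2 d(1) by (auto simp: efix_def)
qed

lemma efix_Home:
  assumes "x \<in> D" "D \<subseteq> P" shows "efix D (Home x)"
proof -
  have "d = Home x" if "Gd 2 H" "Id_on D \<subseteq> H" "rel H (Home x) d" for H d
    using rel_eq_iff[OF that(1) _ _ that(3), of "Home x" "Home x"] rel_Home[of x x H] that(2) assms by auto
  moreover have "Home x \<in> sort_set M Home_sort" using assms by auto
  then have "Home x \<in> Meq M" unfolding Meq_def by blast
  ultimately show ?thesis unfolding efix_def fixd_def by (intro conjI exI[of _ 2]) auto
qed

lemma efix_acl_Home: "finite D \<Longrightarrow> D \<subseteq> P \<Longrightarrow> c \<in> acl M (Home ` D) \<Longrightarrow> efix D c"
  using efix_acl[of "Home ` D" D c] efix_Home by auto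

text \<open>An element fixed over a nonempty set of points is isolated by the statement that it is the class
  of a tuple with the same codes over these points.\<close>

lemma isolating_formula:
  assumes c: "efix D c" and D: "finite D" "D \<subseteq> P" "D \<noteq> {}"
  obtains (isolated) s \<psi> v where "c \<in> sort_set M s" "\<forall>i\<in>qfv \<psi> - {0}. v i \<in> Home ` D"
    "{x \<in> sort_set M s. qsat M (v(0 := x)) \<psi>} = {c}"
proof -
  from c obtain N where N: "2 \<le> N" "elv c dvd N" "fixd N D c" and cM: "c \<in> Meq M" by (auto simp: efix_def)
  obtain ds where ds: "set ds = D" using D(1) finite_list by blast
  \<comment> \<open>Common to points and classes: variables from 1 to \<open>length xs\<close> hold
    a representing tuple, the next ones the points of \<open>D\<close>, and \<open>\<theta>\<close>
    ties variable 0 to the representative.\<close>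
  have main: thesis
    if s: "c \<in> sort_set M s" and xs: "set xs \<subseteq> P" and \<theta>: "qfv \<theta> \<subseteq> insert 0 {1..length xs}"
      "qsat M ((\<lambda>i. Home ((xs @ ds) ! (i - 1)))(0 := c)) \<theta>"
      and \<theta>': "\<And>H x ys w. x \<in> sort_set M s \<Longrightarrow> Gd N H \<Longrightarrow> list_all2 (\<lambda>x x'. (x, x') \<in> H) xs ys \<Longrightarrow>
        \<forall>i<length xs. w (Suc i) = Home (ys ! i) \<Longrightarrow> w 0 = x \<Longrightarrow> qsat M w \<theta> \<Longrightarrow> rel H c x" for s xs \<theta>
  proof -
    define zs where "zs = xs @ ds"
    have zsP: "set zs \<subseteq> P" using xs ds D by (auto simp: zs_def)
    define L where "L = length zs"
    define \<delta> where "\<delta> = QConj [qcod N (cod N (zs ! i) (zs ! j)) (Suc i) (Suc j). i \<leftarrow> [0..<L], j \<leftarrow> [0..<L]]"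
    define \<psi> where "\<psi> = QExs [1..<Suc (length xs)] (QAnd \<theta> \<delta>)"
    define v where "v = (\<lambda>i. Home (zs ! (i - 1)))"
    have \<delta>: "qsat M w \<delta> \<longleftrightarrow> (\<forall>i<L. \<forall>j<L. cod N (us ! i) (us ! j) = cod N (zs ! i) (zs ! j))"
      if "length us = L" "set us \<subseteq> P" "\<forall>i<L. w (Suc i) = Home (us ! i)" for w us
    proof -
      have "qsat M w (qcod N (cod N (zs ! i) (zs ! j)) (Suc i) (Suc j)) \<longleftrightarrow>
          cod N (us ! i) (us ! j) = cod N (zs ! i) (zs ! j)" if "i < L" "j < L" for i j
        by (rule qsat_qcod) (use \<open>length us = L\<close> \<open>set us \<subseteq> P\<close> \<open>\<forall>i<L. w (Suc i) = Home (us ! i)\<close> that zsP N nth_mem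
            in \<open>auto simp: L_def intro!: cod_lt\<close>)
      then show ?thesis unfolding \<delta>_def by auto
    qed
    have fv\<delta>: "qfv \<delta> \<subseteq> insert 0 {1..L}" using qfv_qcod unfolding \<delta>_def qfv_QConj by fastforce
    have "\<forall>i\<in>qfv \<psi> - {0}. v i \<in> Home ` D"
    proof
      fix i assume "i \<in> qfv \<psi> - {0}"
      then have i: "i \<in> {1..L}" "\<not> i \<le> length xs" using fv\<delta> \<theta> by (auto simp: \<psi>_def qfv_QExs L_def zs_def)
      then have "zs ! (i - 1) = ds ! (i - 1 - length xs)" "i - 1 - length xs < length ds"
        by (auto simp: zs_def nth_append L_def)
      then show "v i \<in> Home ` D" using ds by (auto simp: v_def)
    qed
    moreover have "{x \<in> sort_set M s. qsat M (v(0 := x)) \<psi>} = {c}"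
    proof (intro equalityI subsetI)
      fix x assume "x \<in> {c}"
      then have x: "x = c" by simp
      have "qsat M (v(0 := c)) \<delta>" by (subst \<delta>[of zs]) (use zsP in \<open>auto simp: v_def L_def\<close>)
      moreover have "qsat M (v(0 := c)) \<theta>" using \<theta>(2) by (simp add: v_def zs_def)
      moreover have "\<forall>i\<in>set [1..<Suc (length xs)]. (v(0 := c)) i \<in> Home ` P"
      proof
        fix i assume "i \<in> set [1..<Suc (length xs)]"
        then have "i - 1 < length zs" "i \<noteq> 0" by (auto simp: zs_def)
        then have "zs ! (i - 1) \<in> set zs" "i \<noteq> 0" using nth_mem by blast+
        then show "(v(0 := c)) i \<in> Home ` P" using zsP by (auto simp: v_def)
      qed
      ultimately have "qsat M (v(0 := c)) \<psi>" unfolding \<psi>_def qsat_QExs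
        by (intro exI[of _ "v(0 := c)"]) auto
      then show "x \<in> {x \<in> sort_set M s. qsat M (v(0 := x)) \<psi>}" using s x by simp
    next
      fix x assume "x \<in> {x \<in> sort_set M s. qsat M (v(0 := x)) \<psi>}"
      then have x: "x \<in> sort_set M s" "qsat M (v(0 := x)) \<psi>" by auto
      then obtain w where w: "\<forall>i. i \<notin> set [1..<Suc (length xs)] \<longrightarrow> w i = (v(0 := x)) i"
        "\<forall>i\<in>set [1..<Suc (length xs)]. w i \<in> Home ` P" "qsat M w \<theta>" "qsat M w \<delta>"
        unfolding \<psi>_def qsat_QExs by auto
      have "\<exists>y\<in>P. w (Suc i) = Home y" if "i < length xs" for i
      proof -
        have "Suc i \<in> set [1..<Suc (length xs)]" using that by (simp del: upt_Suc)
        then have "w (Suc i) \<in> Home ` P" using w(2) by blast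
        then show ?thesis by blast
      qed
      then obtain f where f: "\<And>i. i < length xs \<Longrightarrow> f i \<in> P \<and> w (Suc i) = Home (f i)" by metis
      define ys where "ys = map f [0..<length xs]"
      have ys: "length ys = length xs" "set ys \<subseteq> P" "\<And>i. i < length xs \<Longrightarrow> w (Suc i) = Home (ys ! i)"
        using f by (auto simp: ys_def)
      define us where "us = ys @ ds"
      have us: "length us = L" "set us \<subseteq> P" using ys ds D by (auto simp: us_def L_def zs_def)
      have wus: "w (Suc i) = Home (us ! i)" if "i < L" for i
      proof (cases "i < length xs")
        case True then show ?thesis using ys by (simp add: us_def nth_append)
      next
        case False
        then have "w (Suc i) = v (Suc i)" using w(1) by simp
        also have "\<dots> = Home (us ! i)" using False ys(1) by (simp add: v_def us_def zs_def nth_append)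
        finally show ?thesis .
      qed
      have eq: "cod N (us ! i) (us ! j) = cod N (zs ! i) (zs ! j)" if "i < L" "j < L" for i j
        using \<delta>[OF us, of w] wus w(4) that by blast
      \<comment> \<open>The codes imposed by \<open>\<delta>\<close> make this a partial map; it is
        the identity on \<open>D\<close>, so it fixes \<open>c\<close>.\<close>
      define H where "H = set (zip zs us)"
      have nthP: "zs ! i \<in> P" "us ! i \<in> P" if "i < L" for i
        using that us zsP nth_mem[of i zs] nth_mem[of i us] by (auto simp: L_def)
      have Heq: "H = (\<lambda>i. (zs ! i, us ! i)) ` {..<L}"
        using us(1) by (auto simp: H_def L_def set_zip)
      have "Gd N H" unfolding Gd_def Heq using nthP eq by auto
      moreover have "list_all2 (\<lambda>x x'. (x, x') \<in> H) xs ys"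
        using ys(1) unfolding H_def zs_def us_def by (auto simp: list_all2_conv_all_nth in_set_zip)
      moreover have "0 \<notin> set [1..<Suc (length xs)]" by (simp del: upt_Suc)
      then have "w 0 = x" using w(1) by (metis fun_upd_same)
      ultimately have "rel H c x" using \<theta>'[OF x(1), of H ys w] ys(3) w(3) by blast
      moreover have "Id_on D \<subseteq> H" using ds ys(1) by (auto simp: H_def zs_def us_def zip_append zip_same)
      ultimately show "x \<in> {c}" using fixdD[OF N(3) \<open>Gd N H\<close>] by blast
    qed
    ultimately show thesis using isolated[OF s] by blast
  qed
  show thesis using cM
  proof (cases rule: Meq_cases)
    case (Home x)
    show thesis
    proof (rule main[of Home_sort "[x]" "QEq 1 0"])
      fix H y ys and w :: "nat \<Rightarrow> 'a meq"
      assume *: "list_all2 (\<lambda>x x'. (x, x') \<in> H) [x] ys" "\<forall>i<length [x]. w (Suc i) = Home (ys ! i)" "w 0 = y"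
        "qsat M w (QEq 1 0)"
      then obtain x' where "ys = [x']" "(x, x') \<in> H" by (auto simp: list_all2_Cons1)
      moreover from this have "y = Home x'" using *(2-4) by simp
      ultimately show "rel H c y" using Home(2) rel_Home by simp
    qed (use Home in auto)
  next
    case (Cls n \<phi> xs)
    have ok: "c \<in> sort_set M (Imag_sort n \<phi>)" using Cls_in_sort[OF Cls(1)] Cls by (simp add: tuples_def)
    have m: "map (\<lambda>i. Home ((xs @ ds) ! (i - 1))) [1..<Suc n] = map Home xs"
      by (rule nth_equalityI) (use Cls in \<open>auto simp: nth_append simp del: upt_Suc\<close>)
    have m': "map ((\<lambda>i. Home ((xs @ ds) ! (i - 1)))(0 := c)) [1..<Suc n] = map Home xs"
      unfolding m[symmetric] by (rule map_cong) auto
    show thesis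
    proof (rule main[of "Imag_sort n \<phi>" xs "QProj n \<phi> [1..<Suc n] 0"])
      show "c \<in> sort_set M (Imag_sort n \<phi>)" by (rule ok)
      show "set xs \<subseteq> P" by (rule Cls)
      show "qfv (QProj n \<phi> [1..<Suc n] 0) \<subseteq> insert 0 {1..length xs}" using Cls by auto
      show "qsat M ((\<lambda>i. Home ((xs @ ds) ! (i - 1)))(0 := c)) (QProj n \<phi> [1..<Suc n] 0)"
        unfolding qsat.simps m' using ok Cls by (auto simp: tuples_def simp del: sort_set.simps)
      fix H y ys and w :: "nat \<Rightarrow> 'a meq"
      assume *: "list_all2 (\<lambda>x x'. (x, x') \<in> H) xs ys" "\<forall>i<length xs. w (Suc i) = Home (ys ! i)" "w 0 = y"
        "qsat M w (QProj n \<phi> [1..<Suc n] 0)"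
      have l: "length ys = n" using * Cls list_all2_lengthD by force
      have "map w [1..<Suc n] = map Home ys"
        by (rule nth_equalityI) (use *(2) l Cls in \<open>auto simp del: upt_Suc\<close>)
      moreover obtain us where us: "map w [1..<Suc n] = map Home us" "w 0 = Cls n \<phi> us" using *(4) by auto
      ultimately have "map Home ys = map Home us" by simp
      then have "ys = us" by (auto dest: map_injective intro!: injI)
      then show "rel H c y" using rel_Cls[OF Cls(1,2) *(1)] us Cls *(3) by simp
    qed
  qed
qed

text \<open>One inclusion is the finiteness of orbits. For the other, the isolating formula has a
  single solution, so the closure is the definable closure.\<close>

lemma acl_Home_eq:
  assumes "finite D" "D \<subseteq> P" "D \<noteq> {}" shows "acl M (Home ` D) = {c. efix D c}"
proof (intro equalityI subsetI)
  fix c assume "c \<in> {c. efix D c}"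
  then have "efix D c" by simp
  then obtain s \<psi> v where iso: "c \<in> sort_set M s" "\<forall>i\<in>qfv \<psi> - {0}. v i \<in> Home ` D"
    "{x \<in> sort_set M s. qsat M (v(0 := x)) \<psi>} = {c}" using isolating_formula assms by blast
  then have "qsat M (v(0 := c)) \<psi>" by blast
  moreover have "finite {x \<in> sort_set M s. qsat M (v(0 := x)) \<psi>}" unfolding iso(3) by simp
  ultimately show "c \<in> acl M (Home ` D)" using iso(1,2) unfolding acl_def by blast
qed (use efix_acl_Home assms in auto)

lemma efix_acl_empty: "c \<in> acl_empty M \<Longrightarrow> efix {} c"
  using efix_acl[of "{}" "{}" c] by auto

section \<open>Canonical maps\<close>

text \<open>Equality of the types of two tuples indexed by \<open>u\<close>, expressed by all codes
  at all levels.\<close>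

definition ctp :: "nat set \<Rightarrow> (nat \<Rightarrow> 'a) \<Rightarrow> (nat \<Rightarrow> 'a) \<Rightarrow> bool" where
  "ctp u b b' \<longleftrightarrow> finite u \<and> (\<forall>i\<in>u. b i \<in> P \<and> b' i \<in> P) \<and>
     (\<forall>N\<ge>2. \<forall>i\<in>u. \<forall>j\<in>u. cod N (b i) (b j) = cod N (b' i) (b' j))"

definition crel :: "nat \<Rightarrow> nat set \<Rightarrow> (nat \<Rightarrow> 'a) \<Rightarrow> (nat \<Rightarrow> 'a) \<Rightarrow> 'a meq \<Rightarrow> 'a meq \<Rightarrow> bool" where
  "crel N u b b' c c' \<longleftrightarrow> (\<exists>H. Gd N H \<and> (\<lambda>i. (b i, b' i)) ` u \<subseteq> H \<and> rel H c c')"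

text \<open>An element fixed over the tuple has exactly one image at a suitable level. Asking for
  all levels at once makes the value independent of such a choice.\<close>

definition can :: "nat set \<Rightarrow> (nat \<Rightarrow> 'a) \<Rightarrow> (nat \<Rightarrow> 'a) \<Rightarrow> 'a meq \<Rightarrow> 'a meq" where
  "can u b b' c = (THE c'. \<forall>N\<ge>2. crel N u b b' c c')"

lemma ctp_sym: "ctp u b b' \<Longrightarrow> ctp u b' b"
  by (auto simp: ctp_def)

lemma ctp_trans: "ctp u b b' \<Longrightarrow> ctp u b' b'' \<Longrightarrow> ctp u b b''"
  by (auto simp: ctp_def)

lemma ctp_subset: "ctp u b b' \<Longrightarrow> u' \<subseteq> u \<Longrightarrow> ctp u' b b'"
  unfolding ctp_def by (meson finite_subset subsetD)

lemma ctp_points: "ctp u b b' \<Longrightarrow> finite (b ` u) \<and> b ` u \<subseteq> P"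
  by (auto simp: ctp_def)

lemma ctp_Gd: "ctp u b b' \<Longrightarrow> 2 \<le> N \<Longrightarrow> Gd N ((\<lambda>i. (b i, b' i)) ` u)"
  by (auto simp: ctp_def Gd_def)

lemma crel_dvd: "crel N u b b' c c' \<Longrightarrow> 2 \<le> n \<Longrightarrow> n dvd N \<Longrightarrow> N > 0 \<Longrightarrow> crel n u b b' c c'"
  unfolding crel_def using Gd_dvd by blast

lemma crel_ex:
  assumes "ctp u b b'" "c \<in> Meq M" "2 \<le> N" shows "\<exists>c'. crel N u b b' c c'"
  using rel_total[OF assms(2) ctp_Gd[OF assms(1,3)] assms(3)] unfolding crel_def by metis

lemma crel_unique:
  assumes "fixd N (b ` u) c" "2 \<le> N" "elv c dvd N" "crel N u b b' c c1" "crel N u b b' c c2"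
  shows "c1 = c2"
proof -
  obtain K1 K2 where K: "Gd N K1" "(\<lambda>i. (b i, b' i)) ` u \<subseteq> K1" "rel K1 c c1"
     "Gd N K2" "(\<lambda>i. (b i, b' i)) ` u \<subseteq> K2" "rel K2 c c2" using assms(4,5) by (auto simp: crel_def)
  show ?thesis by (rule unique_image[OF assms(1-3) K(1,4,3,6)]) (use K in blast)
qed

text \<open>One level that fixes \<open>c\<close> is enough: an image at level \<open>n * N\<close>
  is also one at level \<open>N\<close>, hence equals \<open>c'\<close>, and restricts to level
  \<open>n\<close>.\<close>

lemma can_eqI:
  assumes "ctp u b b'" "fixd N (b ` u) c" "2 \<le> N" "elv c dvd N" "crel N u b b' c c'"
  shows "can u b b' c = c'"
  unfolding can_def
proof (rule the_equality)
  have c: "c \<in> Meq M" using assms(5) rel_Meq by (auto simp: crel_def)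
  show "\<forall>n\<ge>2. crel n u b b' c c'"
  proof (intro allI impI)
    fix n :: nat assume n: "2 \<le> n"
    have nN: "2 \<le> n * N" using n assms(3) by (simp add: order.trans[OF _ mult_le_mono[of 1 n 2 N]])
    obtain d where d: "crel (n * N) u b b' c d" using crel_ex[OF assms(1) c nN] by blast
    have "crel N u b b' c d" by (rule crel_dvd[OF d]) (use assms n in auto)
    then have "d = c'" using crel_unique[OF assms(2-4)] assms(5) by blast
    then show "crel n u b b' c c'" using crel_dvd[OF d n] n assms(3) by auto
  qed
  show "d = c'" if "\<forall>n\<ge>2. crel n u b b' c d" for d
    using crel_unique[OF assms(2-4)] assms(3,5) that by blast
qed

lemma can_crel:
  assumes "ctp u b b'" "efix (b ` u) c" "2 \<le> N" shows "crel N u b b' c (can u b b' c)"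
proof -
  from assms(2) obtain n where n: "2 \<le> n" "elv c dvd n" "fixd n (b ` u) c" and c: "c \<in> Meq M" by (auto simp: efix_def)
  have nN: "2 \<le> n * N" using n assms(3) by (simp add: order.trans[OF _ mult_le_mono[of 1 n 2 N]])
  obtain d where d: "crel (n * N) u b b' c d" using crel_ex[OF assms(1) c nN] by blast
  have "crel n u b b' c d" by (rule crel_dvd[OF d]) (use assms n in auto)
  then have "can u b b' c = d" using can_eqI[OF assms(1) n(3,1,2)] by blast
  then show ?thesis using crel_dvd[OF d assms(3)] n assms(3) by auto
qed

lemma can_Home:
  assumes "ctp u b b'" "i \<in> u" shows "can u b b' (Home (b i)) = Home (b' i)"
proof -
  have "efix (b ` u) (Home (b i))" using efix_Home[of "b i" "b ` u"] ctp_points[OF assms(1)] assms(2) by auto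
  then obtain N where N: "2 \<le> N" "elv (Home (b i)) dvd N" "fixd N (b ` u) (Home (b i))" by (auto simp: efix_def)
  have "crel N u b b' (Home (b i)) (Home (b' i))" unfolding crel_def
    using ctp_Gd[OF assms(1) N(1)] rel_Home[of "b i" "b' i" "(\<lambda>i. (b i, b' i)) ` u"] assms(2) by auto
  then show ?thesis using can_eqI[OF assms(1) N(3,1,2)] by blast
qed

lemma can_efix:
  assumes "ctp u b b'" "efix (b ` u) c" shows "efix (b' ` u) (can u b b' c)"
proof -
  from assms(2) obtain N where N: "2 \<le> N" "elv c dvd N" "fixd N (b ` u) c" by (auto simp: efix_def)
  obtain H where H: "Gd N H" "(\<lambda>i. (b i, b' i)) ` u \<subseteq> H" "rel H c (can u b b' c)"
    using can_crel[OF assms N(1)] by (auto simp: crel_def)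
  have "fixd N (b' ` u) (can u b b' c)" unfolding fixd_def
  proof (intro allI impI, elim conjE)
    fix K d assume K: "Gd N K" "Id_on (b' ` u) \<subseteq> K" "rel K (can u b b' c) d"
    obtain H' where H': "Gd N H'" "H O K \<subseteq> H'" "rel H' c d" using rel_trans[OF H(1) K(1) N(1,2) H(3) K(3)] by blast
    show "d = can u b b' c"
    proof (rule unique_image[OF N(3,1,2) H'(1) H(1) H'(3) H(3)])
      fix x assume "x \<in> b ` u"
      then obtain i where i: "i \<in> u" "x = b i" by blast
      then have "(b i, b' i) \<in> H" "(b' i, b' i) \<in> K" using H(2) K(2) by auto
      then show "\<exists>y. (x, y) \<in> H' \<and> (x, y) \<in> H" using i H'(2) by blast
    qed
  qed
  then show ?thesis using N rel_elv[OF H(3)] rel_Meq[OF H(1,3)] by (auto simp: efix_def)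
qed

lemma can_comp:
  assumes "ctp u b b'" "ctp u b' b''" "efix (b ` u) c"
  shows "can u b' b'' (can u b b' c) = can u b b'' c"
proof -
  from assms(3) obtain N where N: "2 \<le> N" "elv c dvd N" "fixd N (b ` u) c" by (auto simp: efix_def)
  obtain H where H: "Gd N H" "(\<lambda>i. (b i, b' i)) ` u \<subseteq> H" "rel H c (can u b b' c)"
    using can_crel[OF assms(1,3) N(1)] by (auto simp: crel_def)
  obtain K where K: "Gd N K" "(\<lambda>i. (b' i, b'' i)) ` u \<subseteq> K" "rel K (can u b b' c) (can u b' b'' (can u b b' c))"
    using can_crel[OF assms(2) can_efix[OF assms(1,3)] N(1)] by (auto simp: crel_def)
  obtain H' where H': "Gd N H'" "H O K \<subseteq> H'" "rel H' c (can u b' b'' (can u b b' c))"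
    using rel_trans[OF H(1) K(1) N(1,2) H(3) K(3)] by blast
  have "(\<lambda>i. (b i, b'' i)) ` u \<subseteq> H'" using H(2) K(2) H'(2) by blast
  then have "crel N u b b'' c (can u b' b'' (can u b b' c))" using H' unfolding crel_def by blast
  then show ?thesis using can_eqI[OF ctp_trans[OF assms(1,2)] N(3,1,2)] by simp
qed

lemma can_restrict:
  assumes "ctp u b b'" "u' \<subseteq> u" "efix (b ` u') c"
  shows "can u b b' c = can u' b b' c"
proof -
  have c: "efix (b ` u) c" using efix_mono[OF assms(3)] assms(2) by blast
  from assms(3) obtain N where N: "2 \<le> N" "elv c dvd N" "fixd N (b ` u') c" by (auto simp: efix_def)
  have "crel N u b b' c (can u b b' c)" by (rule can_crel[OF assms(1) c N(1)])
  then have "crel N u' b b' c (can u b b' c)" using assms(2) unfolding crel_def by blast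
  then show ?thesis using can_eqI[OF ctp_subset[OF assms(1,2)] N(3,1,2)] by simp
qed

lemma can_cong:
  assumes "\<And>i. i \<in> u \<Longrightarrow> b i = d i" "\<And>i. i \<in> u \<Longrightarrow> b' i = d' i" shows "can u b b' = can u d d'"
proof -
  have "(\<lambda>i. (b i, b' i)) ` u = (\<lambda>i. (d i, d' i)) ` u" using assms by auto
  then show ?thesis unfolding can_def crel_def by simp
qed

lemma can_empty:
  assumes "efix {} c" shows "can {} b b' c = c"
proof -
  from assms obtain N where N: "2 \<le> N" "elv c dvd N" "fixd N {} c" by (auto simp: efix_def)
  have "crel N {} b b' c (can {} b b' c)" by (rule can_crel) (use assms N in \<open>auto simp: ctp_def\<close>)
  then show ?thesis using fixdD[OF N(3)] by (auto simp: crel_def)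
qed

lemma can_acl_empty: "ctp u b b' \<Longrightarrow> c \<in> acl_empty M \<Longrightarrow> can u b b' c = c"
  using can_restrict[of u b b' "{}" c] can_empty efix_acl_empty[of c] by simp

lemma can_refl:
  assumes "ctp u b b" "efix (b ` u) c" shows "can u b b c = c"
proof -
  from assms(2) obtain N where N: "2 \<le> N" "elv c dvd N" "fixd N (b ` u) c" by (auto simp: efix_def)
  obtain H where H: "Gd N H" "(\<lambda>i. (b i, b i)) ` u \<subseteq> H" "rel H c (can u b b c)"
    using can_crel[OF assms N(1)] by (auto simp: crel_def)
  then show ?thesis using fixdD[OF N(3) H(1) _ H(3)] by (auto simp: Id_on_def)
qed

text \<open>A formula with its parameters lives at one level, and there one finite partial map moves
  all parameters at once.\<close>

lemma can_elementary:
  assumes "ctp u b b'" "\<And>c. c \<in> A \<Longrightarrow> efix (b ` u) c"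
  shows "elementary_on M A (can u b b')"
  unfolding elementary_on_def
proof (intro allI impI)
  fix \<psi> v assume v: "\<forall>i\<in>qfv \<psi>. v i \<in> A"
  have "efix (b ` u) (v i)" if "i \<in> qfv \<psi>" for i using assms(2) v that by blast
  then obtain N where N2: "2 \<le> N" and d: "qlv \<psi> dvd N"
    and N: "\<And>i. i \<in> qfv \<psi> \<Longrightarrow> fixd N (b ` u) (v i) \<and> elv (v i) dvd N"
    using common_level[of "qfv \<psi>" "b ` u" v "qlv \<psi>"] by auto
  have fx: "fixd N (b ` u) (v i)" "elv (v i) dvd N" if "i \<in> qfv \<psi>" for i using N[OF that] by auto
  have "v ` qfv \<psi> \<subseteq> Meq M" using assms(2) v by (auto simp: efix_def)
  then obtain H where H: "Gd N H" "(\<lambda>i. (b i, b' i)) ` u \<subseteq> H" "\<forall>a\<in>v ` qfv \<psi>. \<exists>d. rel H a d"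
    using rel_total_finite[OF _ _ ctp_Gd[OF assms(1) N2] N2, of "v ` qfv \<psi>"] by auto
  have Hv: "rel H (v i) (can u b b' (v i))" if "i \<in> qfv \<psi>" for i
  proof -
    from that have "v i \<in> v ` qfv \<psi>" by (rule imageI)
    from bspec[OF H(3) this] obtain d where d: "rel H (v i) d" ..
    then have "crel N u b b' (v i) d" using H unfolding crel_def by blast
    then show ?thesis using can_eqI[OF assms(1) fx(1)[OF that] N2 fx(2)[OF that]] d by simp
  qed
  show "qsat M v \<psi> \<longleftrightarrow> qsat M (\<lambda>i. can u b b' (v i)) \<psi>"
    by (rule qsat_rel[OF H(1) N2 d]) (use Hv fx in auto)
qed

lemma elementary_cod:
  assumes h: "elementary_on M A h" and A: "Home x \<in> A" "Home y \<in> A" and xy: "x \<in> P" "y \<in> P" and N: "2 \<le> N"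
    and x'y': "h (Home x) = Home x'" "h (Home y) = Home y'" "x' \<in> P" "y' \<in> P"
  shows "cod N x' y' = cod N x y"
proof -
  define v where "v = (\<lambda>i::nat. if i = 0 then Home x else Home y)"
  have c: "cod N x y < 2 * N" using cod_lt xy N by blast
  have "qsat M v (qcod N (cod N x y) 0 1)" using qsat_qcod[OF N c, of v 0 x 1 y] xy by (simp add: v_def)
  moreover have "\<forall>i\<in>qfv (qcod N (cod N x y) 0 1). v i \<in> A" using A by (auto simp: v_def)
  ultimately have "qsat M (\<lambda>i. h (v i)) (qcod N (cod N x y) 0 1)" using h unfolding elementary_on_def by blast
  then show ?thesis using qsat_qcod[OF N c, of "\<lambda>i. h (v i)" 0 x' 1 y'] x'y' by (simp add: v_def)
qed

lemma elementary_Home: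
  assumes "elementary_on M A h" "Home x \<in> A" "x \<in> P" obtains x' where "x' \<in> P" "h (Home x) = Home x'"
  using elementary_sort[OF assms(1,2), of Home_sort] assms(3) by auto

text \<open>The isolating formula of \<open>c\<close> holds of \<open>h c\<close> over the points
  \<open>b'\<close>. Carrying \<open>b'\<close> back to \<open>b\<close> by a partial map takes
  \<open>h c\<close> to a solution over \<open>b\<close>, and \<open>c\<close> is the only
  one.\<close>

lemma rigid:
  assumes h: "elementary_on M (acl M (Home ` b ` u)) h" and u: "finite u" "u \<noteq> {}" "b ` u \<subseteq> P"
    and b': "\<And>i. i \<in> u \<Longrightarrow> b' i \<in> P \<and> h (Home (b i)) = Home (b' i)"
  shows "ctp u b b'" "\<And>c. c \<in> acl M (Home ` b ` u) \<Longrightarrow> h c = can u b b' c"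
proof -
  let ?D = "b ` u"
  have D: "finite ?D" "?D \<subseteq> P" "?D \<noteq> {}" using u by auto
  have HD: "Home (b i) \<in> acl M (Home ` ?D)" if "i \<in> u" for i
    using acl_Home_eq[OF D] efix_Home[of "b i" ?D] that D by auto
  show ctp: "ctp u b b'" unfolding ctp_def
  proof (intro conjI allI impI ballI)
    show "finite u" by (rule u)
    fix i assume i: "i \<in> u"
    show "b i \<in> P" "b' i \<in> P" using i u(3) b' by auto
    fix N j assume N: "2 \<le> (N :: nat)" and j: "j \<in> u"
    have "b i \<in> P" "b j \<in> P" using i j u(3) by auto
    then show "cod N (b i) (b j) = cod N (b' i) (b' j)"
      using elementary_cod[OF h HD[OF i] HD[OF j] _ _ N, of "b' i" "b' j"] b'[OF i] b'[OF j] by simp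
  qed
  fix c assume c: "c \<in> acl M (Home ` ?D)"
  then have e: "efix ?D c" using acl_Home_eq[OF D] by blast
  then obtain s \<psi> v where s: "c \<in> sort_set M s" "\<forall>i\<in>qfv \<psi> - {0}. v i \<in> Home ` ?D"
    "{x \<in> sort_set M s. qsat M (v(0 := x)) \<psi>} = {c}" using isolating_formula D by blast
  have "Home ` ?D \<subseteq> acl M (Home ` ?D)" using HD by blast
  then have Pc: "\<forall>i\<in>qfv \<psi>. (v(0 := c)) i \<in> acl M (Home ` ?D)" using s(2) c by auto
  have "qsat M (v(0 := c)) \<psi>" using s(3) by blast
  then have hq: "qsat M (\<lambda>i. h ((v(0 := c)) i)) \<psi>" using h Pc unfolding elementary_on_def by blast
  have hs: "h c \<in> sort_set M s" by (rule elementary_sort[OF h c s(1)])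
  from e obtain n where n: "2 \<le> n" "elv c dvd n" "fixd n ?D c" by (auto simp: efix_def)
  define N where "N = n * qlv \<psi> * elv (h c)"
  have Npos: "N > 0" using n by (simp add: N_def)
  have d: "n dvd N" "qlv \<psi> dvd N" "elv (h c) dvd N" by (auto simp: N_def)
  have N2: "2 \<le> N" using dvd_imp_le[OF d(1) Npos] n(1) by simp
  have fx: "fixd N ?D c" "elv c dvd N" using fixd_dvd[OF n(3,1) d(1) Npos] n(2) d(1) dvd_trans by auto
  have hM: "h c \<in> Meq M" using hs by (auto simp: Meq_def)
  obtain H e where H: "Gd N H" "(\<lambda>i. (b' i, b i)) ` u \<subseteq> H" "rel H (h c) e"
    using rel_total[OF hM ctp_Gd[OF ctp_sym[OF ctp] N2] N2] by blast
  have "qsat M (\<lambda>i. h ((v(0 := c)) i)) \<psi> \<longleftrightarrow> qsat M (v(0 := e)) \<psi>"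
  proof (rule qsat_rel[OF H(1) N2 d(2)], rule ballI)
    fix i assume i: "i \<in> qfv \<psi>"
    show "rel H (h ((v(0 := c)) i)) ((v(0 := e)) i) \<and> elv (h ((v(0 := c)) i)) dvd N"
    proof (cases "i = 0")
      case True then show ?thesis using H d by simp
    next
      case False
      then obtain j where j: "j \<in> u" "v i = Home (b j)" using s(2) i by auto
      then have "rel H (Home (b' j)) (Home (b j))" using H(2) by (intro rel_Home) auto
      then show ?thesis using False j b' by simp
    qed
  qed
  then have "e \<in> {x \<in> sort_set M s. qsat M (v(0 := x)) \<psi>}" using hq hs rel_sort[OF H(1,3)] by simp
  then have "e = c" using s(3) by blast
  then have "rel (H\<inverse>) c (h c)" using rel_converse[OF H(3)] by simp
  moreover have "(\<lambda>i. (b i, b' i)) ` u \<subseteq> H\<inverse>" using H(2) by auto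
  ultimately have "crel N u b b' c (h c)" using Gd_converse[OF H(1)] unfolding crel_def by blast
  then show "h c = can u b b' c" using can_eqI[OF ctp fx(1) N2 fx(2)] by simp
qed

end

section \<open>Simplices in normal form\<close>

lemma elementary_cong:
  assumes "\<And>x. x \<in> A \<Longrightarrow> h x = h' x" shows "elementary_on M A h \<longleftrightarrow> elementary_on M A h'"
proof -
  have "qsat M (\<lambda>i. h (v i)) \<psi> \<longleftrightarrow> qsat M (\<lambda>i. h' (v i)) \<psi>" if "\<forall>i\<in>qfv \<psi>. v i \<in> A" for v \<psi>
    by (rule qsat_cong) (use assms that in auto)
  then show ?thesis unfolding elementary_on_def by blast
qed

lemma boundary_pair:
  assumes "supp f = {i, j}" "i < j"
  shows "boundary (frag_of f) = frag_of (restrict_cube f {j}) - frag_of (restrict_cube f {i})"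
proof -
  have "{i, j} - {i} = {j}" "{i, j} - {j} = {i}" using assms(2) by auto
  then have "face 0 f = restrict_cube f {j}" "face 1 f = restrict_cube f {i}"
    using assms by (simp_all add: face_def)
  moreover have "card (supp f) = Suc (Suc 0)" using assms by simp
  ultimately show ?thesis by (simp add: boundary_def)
qed

lemma boundary_triple:
  assumes "supp f = {i, j, k}" "i < j" "j < k"
  shows "boundary (frag_of f) =
    frag_of (restrict_cube f {j, k}) - frag_of (restrict_cube f {i, k}) + frag_of (restrict_cube f {i, j})"
proof -
  have "{i, j, k} - {i} = {j, k}" "{i, j, k} - {j} = {i, k}" "{i, j, k} - {k} = {i, j}" using assms by auto
  then have "face 0 f = restrict_cube f {j, k}" "face 1 f = restrict_cube f {i, k}" "face 2 f = restrict_cube f {i, j}"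
    using assms by (simp_all add: face_def)
  moreover have "card (supp f) = Suc (Suc (Suc 0))" using assms by simp
  ultimately show ?thesis by (simp add: boundary_def numeral_2_eq_2)
qed

locale circle_homology = sat_circle M + indep_relation M ind
  for M :: "'a circ_struct" and ind :: "'a meq set \<Rightarrow> 'a meq set \<Rightarrow> 'a meq set \<Rightarrow> bool"
begin

abbreviation "B \<equiv> acl_empty M"
abbreviation "ac x \<equiv> acl M {Home x}"
abbreviation "Sx n \<equiv> simplices M ind p0 n"

lemma small_countable: "countable A \<Longrightarrow> A \<subseteq> Meq M \<Longrightarrow> small M A"
  unfolding small_def using countable_lesspoll by blast

lemma small_acl: "countable A \<Longrightarrow> small M (acl M A)"
  by (intro small_countable countable_acl acl_Meq)

lemma B_acl: "B \<subseteq> acl M A"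
  by (rule acl_mono) simp

lemma Home_Meq: "x \<in> P \<Longrightarrow> Home x \<in> Meq M"
proof -
  assume "x \<in> P"
  then have "Home x \<in> sort_set M Home_sort" by simp
  then show ?thesis unfolding Meq_def by blast
qed

lemma Home_acl: "D \<subseteq> P \<Longrightarrow> x \<in> D \<Longrightarrow> Home x \<in> acl M (Home ` D)"
  using acl_increasing[of "Home ` D" M] Home_Meq by blast

lemma Home_ac: "x \<in> P \<Longrightarrow> Home x \<in> ac x"
  using Home_acl[of "{x}" x] by simp

text \<open>Closing again adds nothing, by \<open>efix_acl\<close>.\<close>

lemma acl_union:
  assumes "finite u" "u \<noteq> {}" "b ` u \<subseteq> P"
  shows "acl M (\<Union>i\<in>u. ac (b i)) = acl M (Home ` b ` u)"
proof
  have D: "finite (b ` u)" "b ` u \<noteq> {}" using assms by auto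
  show "acl M (Home ` b ` u) \<subseteq> acl M (\<Union>i\<in>u. ac (b i))"
    by (rule acl_mono) (use Home_ac assms in blast)
  show "acl M (\<Union>i\<in>u. ac (b i)) \<subseteq> acl M (Home ` b ` u)"
  proof
    fix c assume c: "c \<in> acl M (\<Union>i\<in>u. ac (b i))"
    have "efix (b ` u) c"
    proof (rule efix_acl[OF _ D(1) assms(3) c])
      fix a assume "a \<in> (\<Union>i\<in>u. ac (b i))"
      then obtain i where i: "i \<in> u" "a \<in> ac (b i)" by blast
      then have "efix {b i} a" using efix_acl_Home[of "{b i}" a] assms(3) by auto
      then show "efix (b ` u) a" using efix_mono i by blast
    qed
    then show "c \<in> acl M (Home ` b ` u)" using acl_Home_eq[OF D(1) assms(3) D(2)] by simp
  qed
qed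

lemma can_image:
  assumes "ctp u b b'" "u \<noteq> {}"
  shows "can u b b' ` acl M (Home ` b ` u) = acl M (Home ` b' ` u)"
proof -
  have *: "can u b b' ` acl M (Home ` b ` u) \<subseteq> acl M (Home ` b' ` u)" if "ctp u b b'" for b b'
    using acl_Home_eq[of "b ` u"] acl_Home_eq[of "b' ` u"] ctp_points[OF that] ctp_points[OF ctp_sym[OF that]]
      can_efix[OF that] assms(2) by auto
  have "c \<in> can u b b' ` acl M (Home ` b ` u)" if c: "c \<in> acl M (Home ` b' ` u)" for c
  proof
    have e: "efix (b' ` u) c" using acl_Home_eq[of "b' ` u"] ctp_points[OF ctp_sym[OF assms(1)]] assms(2) c by auto
    show "c = can u b b' (can u b' b c)"
      using can_comp[OF ctp_sym[OF assms(1)] assms(1) e] can_refl[OF _ e] ctp_trans[OF ctp_sym[OF assms(1)] assms(1)] by simp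
    show "can u b' b c \<in> acl M (Home ` b ` u)" using *[OF ctp_sym[OF assms(1)]] c by blast
  qed
  then show ?thesis using *[OF assms(1)] by blast
qed

text \<open>The closure of a point is also that of its rotations. A choice that depends on the set
  alone lets a vertex object determine its generator.\<close>

definition gen :: "'a meq set \<Rightarrow> 'a" where
  "gen V = (SOME p. p \<in> P \<and> V = ac p)"

definition Gens :: "'a set" where
  "Gens = {p \<in> P. gen (ac p) = p}"

lemma gen_ac: "p \<in> P \<Longrightarrow> gen (ac p) \<in> Gens \<and> ac (gen (ac p)) = ac p"
proof -
  assume p: "p \<in> P"
  have "gen (ac p) \<in> P \<and> ac p = ac (gen (ac p))" unfolding gen_def by (rule someI[of _ p]) (use p in simp)
  then show ?thesis unfolding Gens_def by auto
qed

lemma Gens_P: "p \<in> Gens \<Longrightarrow> p \<in> P" by (simp add: Gens_def)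

text \<open>The point \<open>b u i\<close> is the image in \<open>f(u)\<close> of the chosen generator of the vertex \<open>f({i})\<close>.\<close>

definition Mk :: "nat set \<Rightarrow> (nat set \<Rightarrow> nat \<Rightarrow> 'a) \<Rightarrow> 'a meq cube" where
  "Mk s b = \<lparr> supp = s,
     obj = (\<lambda>u. if u \<subseteq> s then acl M (Home ` b u ` u) else {}),
     arr = (\<lambda>u v. if u \<subseteq> v \<and> v \<subseteq> s then restrict (can u (b u) (b v)) (acl M (Home ` b u ` u)) else (\<lambda>x. undefined)) \<rparr>"

text \<open>The condition on \<open>Gens\<close> makes \<open>b\<close> recoverable from the
  functor; the other conditions turn \<open>Mk s b\<close> into a simplex.\<close>

definition vld :: "nat set \<Rightarrow> (nat set \<Rightarrow> nat \<Rightarrow> 'a) \<Rightarrow> bool" where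
  "vld s b \<longleftrightarrow> finite s \<and> (\<forall>u v. u \<subseteq> v \<and> v \<subseteq> s \<longrightarrow> ctp u (b u) (b v)) \<and> (\<forall>i\<in>s. b {i} i \<in> Gens) \<and>
     (\<forall>u\<subseteq>s. u \<noteq> {} \<longrightarrow> indep_family ind B u (\<lambda>i. ac (b u i)))"

lemma supp_Mk [simp]: "supp (Mk s b) = s" by (simp add: Mk_def)

lemma obj_Mk: "u \<subseteq> s \<Longrightarrow> obj (Mk s b) u = acl M (Home ` b u ` u)" by (simp add: Mk_def)

lemma arr_Mk: "u \<subseteq> v \<Longrightarrow> v \<subseteq> s \<Longrightarrow> arr (Mk s b) u v = restrict (can u (b u) (b v)) (acl M (Home ` b u ` u))"
  by (simp add: Mk_def)

lemma Mk_cong: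
  assumes "\<And>u i. u \<subseteq> s \<Longrightarrow> i \<in> u \<Longrightarrow> b u i = b' u i" shows "Mk s b = Mk s b'"
proof -
  have 1: "b u ` u = b' u ` u" if "u \<subseteq> s" for u using assms[OF that] by (rule image_cong[OF refl])
  have 2: "can u (b u) (b v) = can u (b' u) (b' v)" if "u \<subseteq> v" "v \<subseteq> s" for u v
    by (rule can_cong) (use assms that in auto)
  have "obj (Mk s b) u = obj (Mk s b') u" for u by (simp add: Mk_def 1)
  then have "obj (Mk s b) = obj (Mk s b')" by (rule ext)
  moreover have "arr (Mk s b) = arr (Mk s b')"
  proof (intro ext)
    fix u v x show "arr (Mk s b) u v x = arr (Mk s b') u v x"
      by (cases "u \<subseteq> v \<and> v \<subseteq> s") (auto simp: Mk_def 1 2)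
  qed
  ultimately show ?thesis by (simp add: cube.equality)
qed

lemma restrict_Mk: "t \<subseteq> s \<Longrightarrow> restrict_cube (Mk s b) t = Mk t b"
  by (auto simp: restrict_cube_def Mk_def fun_eq_iff)

lemma vld_subset: "vld s b \<Longrightarrow> t \<subseteq> s \<Longrightarrow> vld t b"
  unfolding vld_def by (meson finite_subset subsetD subset_trans)

lemma vld_ctp: "vld s b \<Longrightarrow> u \<subseteq> v \<Longrightarrow> v \<subseteq> s \<Longrightarrow> ctp u (b u) (b v)"
  by (simp add: vld_def)

lemma vld_P: "vld s b \<Longrightarrow> u \<subseteq> s \<Longrightarrow> b u ` u \<subseteq> P"
  using vld_ctp[of s b u u] ctp_points by blast

lemma can_in:
  assumes "ctp u b b'" "c \<in> acl M (Home ` b ` u)" shows "can u b b' c \<in> acl M (Home ` b' ` u)"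
proof (cases "u = {}")
  case True then show ?thesis using can_acl_empty[OF assms(1)] assms(2) by simp
next
  case False then show ?thesis using can_image[OF assms(1) False] assms(2) by blast
qed

lemma acl_efix: "ctp u b b' \<Longrightarrow> c \<in> acl M (Home ` b ` u) \<Longrightarrow> efix (b ` u) c"
  using efix_acl_Home[of "b ` u" c] ctp_points by blast

lemma functor_Mk:
  assumes b: "vld s b" shows "is_functor M (Mk s b)"
proof -
  have fin: "finite s" using b by (simp add: vld_def)
  have obj: "C_object M (acl M (Home ` b u ` u))" if "u \<subseteq> s" for u
    unfolding C_object_def using small_acl[of "Home ` b u ` u"] B_acl finite_subset[OF that fin]
    by (simp add: countable_finite)
  have mor: "C_morphism M (acl M (Home ` b u ` u)) (acl M (Home ` b v ` v))
      (restrict (can u (b u) (b v)) (acl M (Home ` b u ` u)))" if uv: "u \<subseteq> v" "v \<subseteq> s" for u v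
  proof -
    note c = vld_ctp[OF b uv]
    have "acl M (Home ` b v ` u) \<subseteq> acl M (Home ` b v ` v)" using uv by (intro acl_mono) auto
    then have "can u (b u) (b v) x \<in> acl M (Home ` b v ` v)" if "x \<in> acl M (Home ` b u ` u)" for x
      using can_in[OF c that] by blast
    moreover have "elementary_on M (acl M (Home ` b u ` u)) (restrict (can u (b u) (b v)) (acl M (Home ` b u ` u)))"
      by (rule iffD1[OF elementary_cong can_elementary[OF c acl_efix[OF c]]]) simp_all
    moreover have "restrict (can u (b u) (b v)) (acl M (Home ` b u ` u)) x = x" if "x \<in> B" for x
      using can_acl_empty[OF c that] B_acl that by auto
    ultimately show ?thesis unfolding C_morphism_def by auto
  qed
  have idt: "arr (Mk s b) u u x = x" if "u \<subseteq> s" "x \<in> obj (Mk s b) u" for u x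
    using that can_refl[OF vld_ctp[OF b subset_refl that(1)] acl_efix[OF vld_ctp[OF b subset_refl that(1)]]]
    by (simp add: obj_Mk arr_Mk)
  have comp: "arr (Mk s b) v w (arr (Mk s b) u v x) = arr (Mk s b) u w x"
    if uvw: "u \<subseteq> v" "v \<subseteq> w" "w \<subseteq> s" and x: "x \<in> obj (Mk s b) u" for u v w x
  proof -
    have vs: "v \<subseteq> s" "u \<subseteq> s" "u \<subseteq> w" using uvw by auto
    note uv = vld_ctp[OF b uvw(1) vs(1)] and vw = vld_ctp[OF b uvw(2,3)]
    note uvw' = ctp_subset[OF vw uvw(1)]
    have x: "x \<in> acl M (Home ` b u ` u)" using x vs by (simp add: obj_Mk)
    have e: "efix (b u ` u) x" by (rule acl_efix[OF uv x])
    have m: "can u (b u) (b v) x \<in> acl M (Home ` b v ` v)"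
      using mor[OF uvw(1) vs(1)] x unfolding C_morphism_def by (auto dest!: PiE_mem)
    have "can v (b v) (b w) (can u (b u) (b v) x) = can u (b v) (b w) (can u (b u) (b v) x)"
      by (rule can_restrict[OF vw uvw(1) can_efix[OF uv e]])
    also have "\<dots> = can u (b u) (b w) x" by (rule can_comp[OF uv uvw' e])
    finally show ?thesis using x m uvw vs by (simp add: arr_Mk)
  qed
  show ?thesis unfolding is_functor_def supp_Mk
  proof (intro conjI allI impI ballI)
    fix u assume "u \<subseteq> s" then show "C_object M (obj (Mk s b) u)" using obj by (simp add: obj_Mk)
  next
    fix u v assume "u \<subseteq> v \<and> v \<subseteq> s"
    then have "u \<subseteq> v" "v \<subseteq> s" "u \<subseteq> s" by auto
    then show "C_morphism M (obj (Mk s b) u) (obj (Mk s b) v) (arr (Mk s b) u v)"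
      using mor by (simp add: obj_Mk arr_Mk)
  next
    fix u v w x assume "u \<subseteq> v \<and> v \<subseteq> w \<and> w \<subseteq> s" "x \<in> obj (Mk s b) u"
    then show "arr (Mk s b) v w (arr (Mk s b) u v x) = arr (Mk s b) u w x" using comp by blast
  next
    fix u assume "\<not> u \<subseteq> s" then show "obj (Mk s b) u = {}" by (simp add: Mk_def)
  next
    fix u v assume "\<not> (u \<subseteq> v \<and> v \<subseteq> s)" then show "arr (Mk s b) u v = (\<lambda>x. undefined)"
      unfolding Mk_def by auto
  qed (use idt in blast)
qed

lemma vertex_image_Mk:
  assumes b: "vld s b" "u \<subseteq> s" "i \<in> u" shows "vertex_image (Mk s b) u i = ac (b u i)"
proof -
  have iu: "{i} \<subseteq> u" "{i} \<subseteq> s" using b by auto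
  have "vertex_image (Mk s b) u i = can {i} (b {i}) (b u) ` acl M (Home ` b {i} ` {i})"
    using iu b by (simp add: vertex_image_def obj_Mk arr_Mk)
  also have "\<dots> = acl M (Home ` b u ` {i})" by (rule can_image[OF vld_ctp[OF b(1) iu(1) b(2)]]) simp
  finally show ?thesis by simp
qed

lemma Mk_simplex:
  assumes b: "vld s b" and card: "card s = n + 1" shows "Mk s b \<in> Sx n"
proof -
  have fin: "finite s" using b by (simp add: vld_def)
  have real: "realizations M p0 = P" by (auto simp: realizations_def p0_def)
  have "\<exists>a\<in>realizations M p0. obj (Mk s b) {i} = ac a" if "i \<in> s" for i
    using vld_P[OF b, of "{i}"] that by (intro bexI[of _ "b {i} i"]) (auto simp: obj_Mk real)
  moreover have "obj (Mk s b) u = acl M (\<Union>i\<in>u. vertex_image (Mk s b) u i) \<and>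
      indep_family ind B u (vertex_image (Mk s b) u)" if u: "u \<noteq> {}" "u \<subseteq> s" for u
  proof
    have "(\<Union>i\<in>u. vertex_image (Mk s b) u i) = (\<Union>i\<in>u. ac (b u i))" using vertex_image_Mk[OF b u(2)] by simp
    then show "obj (Mk s b) u = acl M (\<Union>i\<in>u. vertex_image (Mk s b) u i)"
      using acl_union[OF finite_subset[OF u(2) fin] u(1) vld_P[OF b u(2)]] u by (simp add: obj_Mk)
    have "indep_family ind B u (\<lambda>i. ac (b u i))" using b u by (simp add: vld_def)
    then show "indep_family ind B u (vertex_image (Mk s b) u)"
      using vertex_image_Mk[OF b u(2)] unfolding indep_family_def by simp
  qed
  ultimately show ?thesis unfolding simplices_def using fin card functor_Mk[OF b] by (simp add: obj_Mk)
qed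

text \<open>Arrows are elementary on closures of points, so rigidity makes them the canonical maps
  given by their values on points. These values are images of the chosen generators, and
  functoriality makes them compatible.\<close>

lemma simplex_normal_form:
  assumes f: "f \<in> Sx n" shows "\<exists>b. vld (supp f) b \<and> f = Mk (supp f) b"
proof -
  let ?s = "supp f"
  have fin: "finite ?s" and fnct: "is_functor M f" and e: "obj f {} = B"
    and vert: "\<And>i. i \<in> ?s \<Longrightarrow> \<exists>b\<in>P. obj f {i} = ac b"
    and ne: "\<And>u. u \<noteq> {} \<Longrightarrow> u \<subseteq> ?s \<Longrightarrow> obj f u = acl M (\<Union>i\<in>u. vertex_image f u i) \<and>
        indep_family ind B u (vertex_image f u)"
    using f by (auto simp: simplices_def realizations_def p0_def)
  have mor: "\<And>u v. u \<subseteq> v \<Longrightarrow> v \<subseteq> ?s \<Longrightarrow> C_morphism M (obj f u) (obj f v) (arr f u v)"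
    and idt: "\<And>u x. u \<subseteq> ?s \<Longrightarrow> x \<in> obj f u \<Longrightarrow> arr f u u x = x"
    and comp: "\<And>u v w x. u \<subseteq> v \<Longrightarrow> v \<subseteq> w \<Longrightarrow> w \<subseteq> ?s \<Longrightarrow> x \<in> obj f u \<Longrightarrow> arr f v w (arr f u v x) = arr f u w x"
    and out: "\<And>u. \<not> u \<subseteq> ?s \<Longrightarrow> obj f u = {}" "\<And>u v. \<not> (u \<subseteq> v \<and> v \<subseteq> ?s) \<Longrightarrow> arr f u v = (\<lambda>x. undefined)"
    using fnct unfolding is_functor_def by simp_all
  define g where "g = (\<lambda>i. gen (obj f {i}))"
  have g: "g i \<in> Gens" "obj f {i} = ac (g i)" "g i \<in> P" if "i \<in> ?s" for i
    using vert[OF that] gen_ac Gens_P by (auto simp: g_def)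
  define b where "b = (\<lambda>u i. SOME x. x \<in> P \<and> arr f {i} u (Home (g i)) = Home x)"
  have b: "b u i \<in> P \<and> arr f {i} u (Home (g i)) = Home (b u i)" if u: "u \<subseteq> ?s" "i \<in> u" for u i
  proof -
    have i: "i \<in> ?s" using u by blast
    have "elementary_on M (ac (g i)) (arr f {i} u)" using mor[of "{i}" u] u g[OF i] by (simp add: C_morphism_def)
    from elementary_Home[OF this Home_ac[OF g(3)[OF i]] g(3)[OF i]]
    have "\<exists>x. x \<in> P \<and> arr f {i} u (Home (g i)) = Home x" by blast
    then show ?thesis unfolding b_def by (rule someI_ex)
  qed
  have bi: "b {i} i = g i" if "i \<in> ?s" for i
  proof -
    have "arr f {i} {i} (Home (g i)) = Home (g i)" using idt[of "{i}"] that g[OF that] Home_ac by simp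
    then show ?thesis using b[of "{i}" i] that by simp
  qed
  have vi: "vertex_image f u i = ac (b u i)" if u: "u \<subseteq> ?s" "i \<in> u" for u i
  proof -
    have i: "i \<in> ?s" using u by blast
    have el: "elementary_on M (acl M (Home ` (\<lambda>_. g i) ` {i})) (arr f {i} u)"
      using mor[of "{i}" u] u g[OF i] by (simp add: C_morphism_def)
    have ctp: "ctp {i} (\<lambda>_. g i) (b u)" and eq: "\<And>c. c \<in> acl M (Home ` (\<lambda>_. g i) ` {i}) \<Longrightarrow> arr f {i} u c = can {i} (\<lambda>_. g i) (b u) c"
      using rigid[OF el, of "b u"] b[OF u] g[OF i] by auto
    have "vertex_image f u i = can {i} (\<lambda>_. g i) (b u) ` acl M (Home ` (\<lambda>_. g i) ` {i})"
      using eq g[OF i] by (simp add: vertex_image_def)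
    also have "\<dots> = acl M (Home ` b u ` {i})" by (rule can_image[OF ctp]) simp
    finally show ?thesis by simp
  qed
  have obj: "obj f u = acl M (Home ` b u ` u)" if u: "u \<subseteq> ?s" for u
  proof (cases "u = {}")
    case True then show ?thesis using e by simp
  next
    case False
    have "(\<Union>i\<in>u. vertex_image f u i) = (\<Union>i\<in>u. ac (b u i))" using vi[OF u] by simp
    then have "obj f u = acl M (\<Union>i\<in>u. ac (b u i))" using ne[OF False u] by simp
    also have "\<dots> = acl M (Home ` b u ` u)"
      by (rule acl_union[OF finite_subset[OF u fin] False]) (use b[OF u] in blast)
    finally show ?thesis .
  qed
  have arr: "ctp u (b u) (b v) \<and> arr f u v = restrict (can u (b u) (b v)) (acl M (Home ` b u ` u))"
    if uv: "u \<subseteq> v" "v \<subseteq> ?s" for u v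
  proof -
    have us: "u \<subseteq> ?s" using uv by blast
    have mor': "C_morphism M (acl M (Home ` b u ` u)) (obj f v) (arr f u v)" using mor[OF uv] obj[OF us] by simp
    have "ctp u (b u) (b v) \<and> (\<forall>c\<in>acl M (Home ` b u ` u). arr f u v c = can u (b u) (b v) c)"
    proof (cases "u = {}")
      case True
      \<comment> \<open>The domain is \<open>B\<close>, where arrows and canonical maps are both the
        identity.\<close>
      have "ctp {} (b u) (b v)" by (simp add: ctp_def)
      then show ?thesis using mor' can_acl_empty[of "{}" "b u" "b v"] True by (auto simp: C_morphism_def)
    next
      case False
      have el: "elementary_on M (acl M (Home ` b u ` u)) (arr f u v)" using mor' by (simp add: C_morphism_def)
      have "b v i \<in> P \<and> arr f u v (Home (b u i)) = Home (b v i)" if i: "i \<in> u" for i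
      proof -
        have iv: "i \<in> ?s" "{i} \<subseteq> u" "i \<in> v" using i us uv by auto
        have "arr f u v (arr f {i} u (Home (g i))) = arr f {i} v (Home (g i))"
          by (rule comp) (use iv uv g[OF iv(1)] Home_ac in auto)
        then show ?thesis using b[OF us i] b[OF uv(2) iv(3)] by simp
      qed
      then show ?thesis
        using rigid[OF el finite_subset[OF us fin] False, of "b v"] b[OF us] by blast
    qed
    moreover have "arr f u v \<in> extensional (acl M (Home ` b u ` u))"
      using mor' by (auto simp: C_morphism_def PiE_def)
    ultimately show ?thesis by (auto intro!: extensionalityI[of _ "acl M (Home ` b u ` u)"])
  qed
  have "f = Mk ?s b"
  proof (rule cube.equality)
    show "obj f = obj (Mk ?s b)" using obj out(1) by (auto simp: Mk_def fun_eq_iff)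
    show "arr f = arr (Mk ?s b)" using arr out(2) by (auto simp: Mk_def fun_eq_iff)
  qed auto
  moreover have "vld ?s b" unfolding vld_def
  proof (intro conjI allI impI ballI)
    fix u assume u: "u \<subseteq> ?s" "u \<noteq> {}"
    then show "indep_family ind B u (\<lambda>i. ac (b u i))"
      using ne[OF u(2,1)] vi[OF u(1)] unfolding indep_family_def by simp
  qed (use fin arr bi g in auto)
  ultimately show ?thesis by blast
qed

text \<open>Equal functors have equal vertex objects, hence equal chosen generators, and equal
  arrows on these. So the angle of an edge will be well defined.\<close>

lemma Mk_inject:
  assumes b: "vld s b" and b': "vld s b'" and eq: "Mk s b = Mk s b'" and u: "u \<subseteq> s" "i \<in> u"
  shows "b u i = b' u i"
proof -
  have iu: "{i} \<subseteq> s" "{i} \<subseteq> u" using u by auto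
  have "ac (b {i} i) = ac (b' {i} i)" using arg_cong[OF eq, of "\<lambda>f. obj f {i}"] iu by (simp add: obj_Mk)
  moreover have "b {i} i \<in> Gens" "b' {i} i \<in> Gens" using b b' iu by (auto simp: vld_def)
  ultimately have e: "b {i} i = b' {i} i" by (auto simp: Gens_def)
  have *: "arr (Mk s b) {i} u (Home (b {i} i)) = Home (b u i)" if b: "vld s b" for b
  proof -
    have "Home (b {i} i) \<in> acl M (Home ` b {i} ` {i})" using Home_acl[of "b {i} ` {i}"] vld_P[OF b iu(1)] by auto
    then show ?thesis using can_Home[OF vld_ctp[OF b iu(2) u(1)], of i] iu u by (simp add: arr_Mk)
  qed
  show ?thesis using *[OF b] *[OF b'] e eq by simp
qed

text \<open>Every \<open>b u\<close> realises the restriction to \<open>u\<close> of one type, that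
  of the template \<open>T\<close>; this yields all transition conditions together.\<close>

lemma vldI:
  assumes "finite s" and P: "\<And>u i. u \<subseteq> s \<Longrightarrow> i \<in> u \<Longrightarrow> b u i \<in> P"
    and T: "\<And>N u i j. 2 \<le> N \<Longrightarrow> u \<subseteq> s \<Longrightarrow> i \<in> u \<Longrightarrow> j \<in> u \<Longrightarrow> cod N (b u i) (b u j) = cod N (T i) (T j)"
    and "\<And>i. i \<in> s \<Longrightarrow> b {i} i \<in> Gens"
    and "\<And>u. u \<subseteq> s \<Longrightarrow> u \<noteq> {} \<Longrightarrow> indep_family ind B u (\<lambda>i. ac (b u i))"
  shows "vld s b"
  unfolding vld_def
proof (intro conjI allI impI ballI)
  fix u v assume uv: "u \<subseteq> v \<and> v \<subseteq> s"
  then have us: "u \<subseteq> s" by blast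
  show "ctp u (b u) (b v)" unfolding ctp_def
  proof (intro conjI allI impI ballI)
    show "finite u" using us assms(1) by (rule finite_subset)
    fix i assume i: "i \<in> u"
    then show "b u i \<in> P" "b v i \<in> P" using P us uv by auto
    fix N j assume "2 \<le> (N :: nat)" "j \<in> u"
    moreover from this have "i \<in> v" "j \<in> v" using i uv by auto
    ultimately show "cod N (b u i) (b u j) = cod N (b v i) (b v j)" using T[of N u i j] T[of N v i j] i us uv by simp
  qed
qed (use assms in auto)

end

section \<open>The first homology group\<close>

lemma card_2_less: "card (s :: nat set) = 2 \<Longrightarrow> \<exists>i j. i < j \<and> s = {i, j}"
  unfolding card_2_iff by (metis insert_commute linorder_neqE_nat)

lemma card_3_less:
  assumes "card (s :: nat set) = 3" shows "\<exists>i j k. i < j \<and> j < k \<and> s = {i, j, k}"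
proof -
  have fin: "finite s" "s \<noteq> {}" using assms by (auto intro: card_ge_0_finite)
  define i where "i = Min s"
  have i: "i \<in> s" "\<And>x. x \<in> s \<Longrightarrow> i \<le> x" using fin by (auto simp: i_def)
  have "card (s - {i}) = 2" using assms i fin by simp
  then obtain j k where jk: "j < k" "s - {i} = {j, k}" using card_2_less by blast
  then have "j \<in> s" "j \<noteq> i" "s = {i, j, k}" using i by auto
  then show ?thesis using jk i(2)[of j] by (intro exI[of _ i] exI[of _ j] exI[of _ k]) auto
qed

lemma subset_pair: "u \<subseteq> {i, j} \<Longrightarrow> u = {} \<or> u = {i} \<or> u = {j} \<or> u = {i, j}"
  by auto

lemma subset_triple:
  assumes "u \<subseteq> {i, j, k}"
  shows "u = {} \<or> u = {i} \<or> u = {j} \<or> u = {k} \<or> u = {i, j} \<or> u = {j, k} \<or> u = {i, k} \<or> u = {i, j, k}"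
proof (cases "i \<in> u")
  case True
  then obtain w where w: "u = insert i w" "w \<subseteq> {j, k}" using assms by (metis insert_Diff subset_insert_iff)
  from subset_pair[OF w(2)] have "u = {i} \<or> u = {i, j} \<or> u = {i, k} \<or> u = {i, j, k}"
    by (elim disjE) (simp_all only: w(1) simp_thms)
  then show ?thesis by (elim disjE) (simp_all only: simp_thms)
next
  case False
  then have "u \<subseteq> {j, k}" using assms by blast
  from subset_pair[OF this] show ?thesis by (elim disjE) (simp_all only: simp_thms)
qed

abbreviation keys :: "('c \<Rightarrow>\<^sub>0 int) \<Rightarrow> 'c set" where "keys \<equiv> Poly_Mapping.keys"

definition lin :: "('c \<Rightarrow> real) \<Rightarrow> ('c \<Rightarrow>\<^sub>0 int) \<Rightarrow> real" where
  "lin w c = (\<Sum>x\<in>keys c. of_int (Poly_Mapping.lookup c x) * w x)"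

lemma lin_superset:
  assumes "finite A" "keys c \<subseteq> A"
  shows "lin w c = (\<Sum>x\<in>A. of_int (Poly_Mapping.lookup c x) * w x)"
  unfolding lin_def by (rule sum.mono_neutral_left) (use assms in \<open>auto simp: in_keys_iff\<close>)

lemma lin_0 [simp]: "lin w 0 = 0" by (simp add: lin_def)

lemma lin_add: "lin w (a + b) = lin w a + lin w b"
proof -
  let ?A = "keys a \<union> keys b"
  have "lin w (a + b) = (\<Sum>x\<in>?A. of_int (Poly_Mapping.lookup (a + b) x) * w x)"
    by (rule lin_superset) (use Poly_Mapping.keys_add[of a b] in auto)
  also have "\<dots> = (\<Sum>x\<in>?A. of_int (Poly_Mapping.lookup a x) * w x) + (\<Sum>x\<in>?A. of_int (Poly_Mapping.lookup b x) * w x)"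
    by (simp add: lookup_add distrib_right sum.distrib)
  also have "\<dots> = lin w a + lin w b" using lin_superset[of ?A a w] lin_superset[of ?A b w] by simp
  finally show ?thesis .
qed

lemma lin_diff: "lin w (a - b) = lin w a - lin w b"
  using lin_add[of w "a - b" b] by simp

lemma lin_of [simp]: "lin w (frag_of x) = w x"
  by (simp add: lin_def)

lemma boundary_add: "boundary (a + b) = boundary a + boundary b"
  by (simp add: boundary_def frag_extend_add)

lemma boundary_diff: "boundary (a - b) = boundary a - boundary b"
  by (simp add: boundary_def frag_extend_diff)

lemma boundary_0 [simp]: "boundary 0 = 0"
  by (simp add: boundary_def)

section \<open>Independence calculus and generic points\<close>

context circle_homology
begin

text \<open>Countability is preserved by unions, closures and conjugation, and it implies
  smallness.\<close>

definition cs :: "'a meq set \<Rightarrow> bool" where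
  "cs A \<longleftrightarrow> countable A \<and> A \<subseteq> Meq M"

lemma cs_small: "cs A \<Longrightarrow> small M A" using small_countable by (simp add: cs_def)
lemma cs_subset: "cs A \<Longrightarrow> A' \<subseteq> A \<Longrightarrow> cs A'" unfolding cs_def using countable_subset by blast
lemma cs_Un: "cs A \<Longrightarrow> cs A' \<Longrightarrow> cs (A \<union> A')" by (auto simp: cs_def)
lemma cs_acl: "cs A \<Longrightarrow> cs (acl M A)" using countable_acl acl_Meq unfolding cs_def by blast
lemma cs_Home: "finite D \<Longrightarrow> D \<subseteq> P \<Longrightarrow> cs (Home ` D)" using Home_Meq by (auto simp: cs_def countable_finite)
lemma cs_B: "cs B" using cs_acl[of "{}"] by (simp add: cs_def)
lemma cs_ac: "x \<in> P \<Longrightarrow> cs (ac x)" using cs_acl[OF cs_Home[of "{x}"]] by simp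

lemma ind_mono:
  assumes "cs A" "cs C" "cs D" "ind A C D" "A' \<subseteq> A" "D' \<subseteq> D" shows "ind A' C D'"
proof -
  have "small M A'" "small M D'" using assms cs_subset cs_small by blast+
  then show ?thesis
    using finite_character[of A C D] finite_character[of A' C D'] assms cs_small by (meson subset_trans)
qed

lemma ind_sym: "cs A \<Longrightarrow> cs C \<Longrightarrow> cs D \<Longrightarrow> ind A C D \<Longrightarrow> ind D C A"
  using symmetry cs_small by blast

lemma conj_cs:
  assumes "conj_over M E A A'" "cs A" shows "cs A'"
proof -
  obtain h where h: "elementary_on M (A \<union> E \<union> B) h" "h ` A = A'" using assms(1) by (auto simp: conj_over_def)
  have "h c \<in> Meq M" if c: "c \<in> A" for c
  proof -
    obtain s where "c \<in> sort_set M s" using assms(2) c by (auto simp: cs_def Meq_def)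
    then have "h c \<in> sort_set M s" using elementary_sort[OF h(1)] c by blast
    then show ?thesis by (auto simp: Meq_def)
  qed
  then show ?thesis using h(2) assms(2) by (auto simp: cs_def)
qed

text \<open>A family with one vertex has to be independent from the empty union. Extension gives a
  conjugate independent from \<open>ac p\<close>; after symmetry it can be shrunk to
  \<open>{}\<close>.\<close>

lemma ind_empty: assumes "p \<in> P" shows "ind (ac p) B {}"
proof -
  have c: "cs (ac p)" by (rule cs_ac[OF assms])
  obtain A' where A': "conj_over M B (ac p) A'" "ind A' B (ac p)"
    using extension[of "ac p" "ac p" B] cs_small[OF c] B_acl by blast
  have "cs A'" using conj_cs[OF A'(1) c] .
  then have "ind (ac p) B A'" using ind_sym[OF _ cs_B c A'(2)] by blast
  then show ?thesis using ind_mono[OF c cs_B \<open>cs A'\<close>] by blast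
qed

text \<open>Over \<open>ac y\<close> the point \<open>z\<close> is independent from
  \<open>x\<close>. Symmetry and normality turn this into independence of \<open>x\<close> from
  \<open>y\<close> and \<open>z\<close> over \<open>ac y\<close>, and transitivity combines it with
  independence of \<open>x\<close> from \<open>y\<close>.\<close>

lemma ind_triple:
  assumes P: "x \<in> P" "y \<in> P" "z \<in> P" and xy: "ind (ac x) B (ac y)" and z: "ind (ac z) B (ac x \<union> ac y)"
  shows "ind (ac x) B (ac y \<union> ac z)"
proof -
  note c = cs_ac[OF P(1)] cs_ac[OF P(2)] cs_ac[OF P(3)]
  have "ind (ac z) (ac y) (ac x \<union> ac y)"
    using transitivity[of "ac z" "ac x \<union> ac y" B "ac y"] z c cs_small cs_Un B_acl by blast
  then have "ind (ac z) (ac y) (ac x)" using ind_mono[OF c(3,2) cs_Un[OF c(1,2)]] by blast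
  then have "ind (ac x) (ac y) (ac z)" using ind_sym[OF c(3,2,1)] by blast
  then have "ind (ac x) (ac y) (acl M (ac z \<union> ac y))" using normality c cs_small by blast
  moreover have "ac y \<union> ac z \<subseteq> acl M (ac z \<union> ac y)"
    using acl_increasing[of "ac z \<union> ac y" M] acl_Meq by blast
  ultimately have "ind (ac x) (ac y) (ac y \<union> ac z)"
    using ind_mono[OF c(1,2) cs_acl[OF cs_Un[OF c(3,2)]]] by blast
  then show ?thesis
    using transitivity[of "ac x" "ac y \<union> ac z" B "ac y"] xy c cs_small cs_Un B_acl by blast
qed

lemma ang_if_cod: "ctp u b b' \<Longrightarrow> i \<in> u \<Longrightarrow> j \<in> u \<Longrightarrow> ang (b i) (b j) = ang (b' i) (b' j)"
  unfolding ctp_def by (rule ang_cong) auto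

text \<open>Extension only controls the type of the new tuple, not its position relative to \<open>X\<close>. So a family
  with prescribed mutual angles is moved as a whole, and rational positions relative to \<open>X\<close> are avoided
  by offering infinitely many translates of it.\<close>

lemma generic_points:
  fixes \<alpha> :: "nat \<Rightarrow> real"
  assumes X: "finite X" "X \<subseteq> P"
  obtains e where "\<And>j. e j \<in> P" "\<And>j l. ang (e j) (e l) - (\<alpha> l - \<alpha> j) \<in> \<int>"
    "\<And>j x. j < m \<Longrightarrow> x \<in> X \<Longrightarrow> ang x (e j) \<notin> \<rat>" "\<And>j. ind (ac (e j)) B (acl M (Home ` X))"
proof -
  obtain c :: real where c: "c \<notin> \<rat>" using ex_irrational by blast
  obtain x0 where x0: "x0 \<in> P" using points_ne by blast
  \<comment> \<open>Copy number \<open>i\<close> of the family, turned as a whole by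
    \<open>i * c\<close> with \<open>c\<close> irrational.\<close>
  define y where "y = (\<lambda>(i::nat) j. SOME y. y \<in> P \<and> ang x0 y - (\<alpha> j + real i * c) \<in> \<int>)"
  have y': "y i j \<in> P \<and> ang x0 (y i j) - (\<alpha> j + real i * c) \<in> \<int>" for i j
    unfolding y_def by (rule someI_ex) (use ex_ang[OF x0] in blast)
  then have y: "y i j \<in> P" "ang x0 (y i j) - (\<alpha> j + real i * c) \<in> \<int>" for i j by auto
  define A where "A = (\<lambda>(i, j). Home (y i j)) ` (UNIV :: (nat \<times> nat) set)"
  have csA: "cs A" using y(1) Home_Meq by (auto simp: A_def cs_def)
  define C where "C = acl M (Home ` X)"
  have csC: "cs C" unfolding C_def by (rule cs_acl[OF cs_Home[OF X]])
  obtain A' where A': "conj_over M B A A'" "ind A' B C"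
    using extension[of A C B] cs_small csA csC B_acl unfolding C_def by blast
  have csA': "cs A'" by (rule conj_cs[OF A'(1) csA])
  obtain h where h: "elementary_on M (A \<union> B \<union> B) h" "h ` A = A'" using A'(1) by (auto simp: conj_over_def)
  have hA: "Home (y i j) \<in> A" for i j by (auto simp: A_def)
  have "\<exists>z. z \<in> P \<and> h (Home (y i j)) = Home z" for i j
    using elementary_Home[OF h(1), of "y i j"] hA[of i j] y(1) by blast
  then obtain z where z: "\<And>i j. z i j \<in> P" "\<And>i j. h (Home (y i j)) = Home (z i j)" by metis
  have zz: "ang (z i j) (z i' j') - ((\<alpha> j' + real i' * c) - (\<alpha> j + real i * c)) \<in> \<int>" for i j i' j'
  proof -
    have "ang (z i j) (z i' j') = ang (y i j) (y i' j')"
      by (rule ang_cong) (use y(1) z elementary_cod[OF h(1)] hA in auto)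
    then have "ang (z i j) (z i' j') - ((\<alpha> j' + real i' * c) - (\<alpha> j + real i * c)) =
        (ang x0 (y i j) + ang (y i j) (y i' j') - ang x0 (y i' j')) + (ang x0 (y i' j') - (\<alpha> j' + real i' * c))
        - (ang x0 (y i j) - (\<alpha> j + real i * c))" by simp
    also have "\<dots> \<in> \<int>" by (intro Ints_add Ints_diff ang_add y x0)
    finally show ?thesis .
  qed
  have indz: "ind (ac (z i j)) B C" for i j
  proof -
    have "Home (z i j) \<in> A'" using z(2) h(2) hA by (metis imageI)
    then have "ind {Home (z i j)} B C" using ind_mono[OF csA' cs_B csC A'(2)] by blast
    moreover have c1: "cs {Home (z i j)}" using cs_Home[of "{z i j}"] z(1) by simp
    \<comment> \<open>Normality closes the right-hand side, so symmetry is applied before and after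
      it.\<close>
    ultimately have "ind C B {Home (z i j)}" using ind_sym[OF _ cs_B csC] by blast
    then have "ind C B (acl M ({Home (z i j)} \<union> B))" using normality cs_small c1 csC cs_B by blast
    moreover have "ac (z i j) \<subseteq> acl M ({Home (z i j)} \<union> B)" by (rule acl_mono) simp
    ultimately have "ind C B (ac (z i j))"
      using ind_mono[OF csC cs_B cs_acl[OF cs_Un[OF c1 cs_B]]] by blast
    then show ?thesis using ind_sym[OF csC cs_B cs_ac[OF z(1)]] by blast
  qed
  \<comment> \<open>Two copies differ by a nonzero integer multiple of the irrational
    \<open>c\<close>, so at most one of them is at a rational angle from \<open>x\<close>.\<close>
  have bad: "finite {i. ang x (z i j) \<in> \<rat>}" if x: "x \<in> X" for x j
  proof -
    have "i = i'" if r: "ang x (z i j) \<in> \<rat>" "ang x (z i' j) \<in> \<rat>" for i i'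
    proof (rule ccontr)
      assume "i \<noteq> i'"
      have "(ang x (z i j) + ang (z i j) (z i' j) - ang x (z i' j)) - (ang (z i j) (z i' j) - ((\<alpha> j + real i' * c) - (\<alpha> j + real i * c))) \<in> \<int>"
        by (rule Ints_diff[OF ang_add zz]) (use x X z in auto)
      then have "(ang x (z i j) - ang x (z i' j)) + (real i' - real i) * c \<in> \<rat>"
        using Ints_subset_Rats by (auto simp: algebra_simps)
      then have "((ang x (z i j) - ang x (z i' j)) + (real i' - real i) * c) - (ang x (z i j) - ang x (z i' j)) \<in> \<rat>"
        by (rule Rats_diff[OF _ Rats_diff[OF r]])
      then have "(real i' - real i) * c \<in> \<rat>" by simp
      then have "(real i' - real i) * c / (real i' - real i) \<in> \<rat>"
        by (rule Rats_divide) auto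
      then show False using c \<open>i \<noteq> i'\<close> by simp
    qed
    then have "{i. ang x (z i j) \<in> \<rat>} \<subseteq> {SOME i. ang x (z i j) \<in> \<rat>}"
      by (metis (mono_tags, lifting) mem_Collect_eq singletonI someI subsetI)
    then show ?thesis by (rule finite_subset) simp
  qed
  have "finite (\<Union>j<m. \<Union>x\<in>X. {i. ang x (z i j) \<in> \<rat>})" using bad X by auto
  then obtain i where i: "i \<notin> (\<Union>j<m. \<Union>x\<in>X. {i. ang x (z i j) \<in> \<rat>})"
    using ex_new_if_finite[OF infinite_UNIV_nat] by blast
  show thesis
  proof (rule that[of "z i"])
    show "ang (z i j) (z i l) - (\<alpha> l - \<alpha> j) \<in> \<int>" for j l using zz[of i j i l] by simp
    show "ang x (z i j) \<notin> \<rat>" if "j < m" "x \<in> X" for j x using i that by blast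
    show "ind (ac (z i j)) B (acl M (Home ` X))" for j using indz by (simp add: C_def)
  qed (rule z)
qed

section \<open>Edges and triangles\<close>

definition i2 :: "'a \<Rightarrow> 'a \<Rightarrow> bool" where
  "i2 x y \<longleftrightarrow> x \<in> P \<and> y \<in> P \<and> ind (ac x) B (ac y)"

lemma i2_sym: "i2 x y \<Longrightarrow> ind (ac y) B (ac x)"
  using ind_sym cs_ac cs_B by (auto simp: i2_def)

definition e0 :: "nat \<Rightarrow> 'a \<Rightarrow> 'a meq cube" where
  "e0 i p = Mk {i} (\<lambda>_ _. p)"

text \<open>\<open>p\<close> and \<open>q\<close> generate the vertices, \<open>x\<close> and
  \<open>y\<close> are their images in the object of the edge. The pairs are otherwise unrelated,
  since all points have the same type.\<close>

definition e1_pts :: "nat \<Rightarrow> nat \<Rightarrow> 'a \<Rightarrow> 'a \<Rightarrow> 'a \<Rightarrow> 'a \<Rightarrow> nat set \<Rightarrow> nat \<Rightarrow> 'a" where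
  "e1_pts i j p q x y u l = (if j \<notin> u then p else if i \<notin> u then q else if l = i then x else y)"

definition e1 :: "nat \<Rightarrow> nat \<Rightarrow> 'a \<Rightarrow> 'a \<Rightarrow> 'a \<Rightarrow> 'a \<Rightarrow> 'a meq cube" where
  "e1 i j p q x y = Mk {i, j} (e1_pts i j p q x y)"

lemma vld_e1:
  assumes "i < j" "p \<in> Gens" "q \<in> Gens" "i2 x y" shows "vld {i, j} (e1_pts i j p q x y)"
proof (rule vldI[where T = "\<lambda>l. if l = i then x else y"])
  note P = Gens_P[OF assms(2)] Gens_P[OF assms(3)]
  have xy: "x \<in> P" "y \<in> P" using assms by (auto simp: i2_def)
  show "e1_pts i j p q x y u l \<in> P" for u l using P xy by (simp add: e1_pts_def)
  show "e1_pts i j p q x y {l} l \<in> Gens" if "l \<in> {i, j}" for l using assms that by (auto simp: e1_pts_def)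
  fix u assume u: "u \<subseteq> {i, j}"
  { fix N l l' assume "2 \<le> (N :: nat)" "l \<in> u" "l' \<in> u"
    then show "cod N (e1_pts i j p q x y u l) (e1_pts i j p q x y u l') =
      cod N (if l = i then x else y) (if l' = i then x else y)"
      using subset_pair[OF u] assms(1) cod_eq_0[of p p N] cod_eq_0[of q q N] cod_eq_0[of x x N] cod_eq_0[of y y N] P xy
      by (auto simp: e1_pts_def) }
  assume "u \<noteq> {}"
  then show "indep_family ind B u (\<lambda>l. ac (e1_pts i j p q x y u l))"
    using subset_pair[OF u] assms(1,4) i2_sym[OF assms(4)] ind_empty P
    by (auto simp: e1_pts_def indep_family_def i2_def insert_Diff_if)
qed simp

lemma e1_simplex: "i < j \<Longrightarrow> p \<in> Gens \<Longrightarrow> q \<in> Gens \<Longrightarrow> i2 x y \<Longrightarrow> e1 i j p q x y \<in> Sx 1"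
  unfolding e1_def by (rule Mk_simplex[OF vld_e1]) auto

lemma e1_exhaust:
  assumes "f \<in> Sx 1"
  obtains i j p q x y where "i < j" "p \<in> Gens" "q \<in> Gens" "i2 x y" "f = e1 i j p q x y" "supp f = {i, j}"
proof -
  obtain b where b: "vld (supp f) b" "f = Mk (supp f) b" using simplex_normal_form[OF assms] by blast
  have "card (supp f) = 2" using assms by (simp add: simplices_def)
  then obtain i j where ij: "i < j" "supp f = {i, j}" using card_2_less by blast
  have "Mk {i, j} b = e1 i j (b {i} i) (b {j} j) (b {i, j} i) (b {i, j} j)"
    unfolding e1_def by (rule Mk_cong) (use ij(1) in \<open>auto dest!: subset_pair simp: e1_pts_def\<close>)
  moreover have "b {i} i \<in> Gens" "b {j} j \<in> Gens" using b ij by (auto simp: vld_def)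
  moreover have "i2 (b {i, j} i) (b {i, j} j)"
  proof -
    have "indep_family ind B {i, j} (\<lambda>l. ac (b {i, j} l))" using b ij by (auto simp: vld_def)
    then show ?thesis using vld_P[OF b(1), of "{i, j}"] ij
      by (auto simp: indep_family_def i2_def insert_Diff_if)
  qed
  ultimately show ?thesis using that[OF ij(1)] b(2) ij(2) by metis
qed

lemma e0_simplex:
  assumes "p \<in> Gens" shows "e0 i p \<in> Sx 0"
proof -
  have "vld {i} (\<lambda>_ _. p)"
  proof (rule vldI[where T = "\<lambda>_. p"])
    fix u assume "u \<subseteq> {i}" "u \<noteq> {}"
    then have "u = {i}" by blast
    then show "indep_family ind B u (\<lambda>i. ac p)" using ind_empty Gens_P assms by (simp add: indep_family_def)
  qed (use assms Gens_P in auto)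
  then show ?thesis unfolding e0_def by (rule Mk_simplex) simp
qed

lemma boundary_e1:
  assumes "i < j" shows "boundary (frag_of (e1 i j p q x y)) = frag_of (e0 j q) - frag_of (e0 i p)"
proof -
  have "restrict_cube (e1 i j p q x y) {j} = e0 j q" "restrict_cube (e1 i j p q x y) {i} = e0 i p"
    unfolding e1_def e0_def using assms
    by (subst restrict_Mk; auto intro!: Mk_cong dest!: subset_singletonD simp: e1_pts_def)+
  then show ?thesis using boundary_pair[of "e1 i j p q x y" i j] assms by (simp add: e1_def)
qed

definition Bd :: "('a meq cube \<Rightarrow>\<^sub>0 int) set" where
  "Bd = boundary ` carrier (chains M ind p0 2)"

lemma Bd_add: "a \<in> Bd \<Longrightarrow> b \<in> Bd \<Longrightarrow> a + b \<in> Bd"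
  unfolding Bd_def chains_def
proof (elim imageE)
  fix c d assume "a = boundary c" "b = boundary d" "c \<in> carrier (free_Abelian_group (Sx 2))"
    "d \<in> carrier (free_Abelian_group (Sx 2))"
  then show "a + b \<in> boundary ` carrier (free_Abelian_group (Sx 2))"
    using Poly_Mapping.keys_add[of c d] by (intro image_eqI[of _ _ "c + d"]) (auto simp: boundary_add)
qed

lemma Bd_minus: "a \<in> Bd \<Longrightarrow> - a \<in> Bd"
  unfolding Bd_def chains_def
proof (elim imageE)
  fix c assume "a = boundary c" "c \<in> carrier (free_Abelian_group (Sx 2))"
  then show "- a \<in> boundary ` carrier (free_Abelian_group (Sx 2))"
    using boundary_diff[of 0 c] by (intro image_eqI[of _ _ "- c"]) (auto simp: keys_minus)
qed

lemma Bd_diff: "a \<in> Bd \<Longrightarrow> b \<in> Bd \<Longrightarrow> a - b \<in> Bd"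
  using Bd_add[of a "- b"] Bd_minus[of b] by simp

abbreviation "F i j p q x y \<equiv> frag_of (e1 i j p q x y)"

lemma Bd_cong: "a \<in> Bd \<Longrightarrow> a = b \<Longrightarrow> b \<in> Bd" by simp

text \<open>The arrows from the edges into the top object are canonical maps, which ask for equal
  types only. Hence the edges may use points other than \<open>x\<close>, \<open>y\<close>,
  \<open>z\<close>, and this freedom lets sides of different cones match.\<close>

lemma fill:
  assumes ijk: "i < j" "j < k" and G: "p \<in> Gens" "q \<in> Gens" "r \<in> Gens"
    and e: "i2 x1 y1" "i2 y2 z2" "i2 x3 z3"
    and xyz: "i2 x y" "z \<in> P" "ind (ac z) B (ac x \<union> ac y)"
    and m: "\<And>N. 2 \<le> N \<Longrightarrow> cod N x1 y1 = cod N x y" "\<And>N. 2 \<le> N \<Longrightarrow> cod N y2 z2 = cod N y z"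
      "\<And>N. 2 \<le> N \<Longrightarrow> cod N x3 z3 = cod N x z"
  shows "F j k q r y2 z2 - F i k p r x3 z3 + F i j p q x1 y1 \<in> Bd"
proof -
  \<comment> \<open>In order: the faces without \<open>k\<close>, the vertex \<open>k\<close>, the
    two edges at \<open>k\<close>, and the full triple.\<close>
  define b where "b = (\<lambda>u l. if k \<notin> u then (if j \<notin> u then p else if i \<notin> u then q else if l = i then x1 else y1)
    else if i \<notin> u \<and> j \<notin> u then r else if i \<notin> u then (if l = j then y2 else z2)
    else if j \<notin> u then (if l = i then x3 else z3) else if l = i then x else if l = j then y else z)"
  have P: "p \<in> P" "q \<in> P" "r \<in> P" "x1 \<in> P" "y1 \<in> P" "y2 \<in> P" "z2 \<in> P" "x3 \<in> P" "z3 \<in> P" "x \<in> P" "y \<in> P" "z \<in> P"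
    using Gens_P G e xyz by (auto simp: i2_def)
  have xz: "ind (ac x) B (ac y \<union> ac z)" using ind_triple[OF P(10-12)] xyz by (simp add: i2_def)
  have "ind (ac z) B (ac y \<union> ac x)" using xyz(3) by (simp add: Un_commute)
  then have yz: "ind (ac y) B (ac x \<union> ac z)" using ind_triple[OF P(11,10,12) i2_sym[OF xyz(1)]] by simp
  have m': "cod N y1 x1 = cod N y x" "cod N z2 y2 = cod N z y" "cod N z3 x3 = cod N z x" if "2 \<le> N" for N
    using cod_swap_eq[OF _ _ _ _ that m(1)[OF that]] cod_swap_eq[OF _ _ _ _ that m(2)[OF that]]
      cod_swap_eq[OF _ _ _ _ that m(3)[OF that]] P by auto
  have z0: "cod N a a = 0" if "2 \<le> N" "a \<in> P" for N a using cod_eq_0[of a a N] that by simp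
  have vld: "vld {i, j, k} b"
  proof (rule vldI[where T = "\<lambda>l. if l = i then x else if l = j then y else z"])
    show "b u l \<in> P" for u l using P by (simp add: b_def)
    show "b {l} l \<in> Gens" if "l \<in> {i, j, k}" for l using ijk G that by (auto simp: b_def)
    fix u assume u: "u \<subseteq> {i, j, k}"
    { fix N l l' assume N: "2 \<le> (N :: nat)" and l: "l \<in> u" "l' \<in> u"
      show "cod N (b u l) (b u l') =
        cod N (if l = i then x else if l = j then y else z) (if l' = i then x else if l' = j then y else z)"
        using subset_triple[OF u] ijk l
        by (elim disjE) (auto simp: b_def m[OF N] m'[OF N] z0[OF N] P) }
    assume "u \<noteq> {}"
    then show "indep_family ind B u (\<lambda>l. ac (b u l))"
      using subset_triple[OF u] ijk e i2_sym[OF e(1)] i2_sym[OF e(2)] i2_sym[OF e(3)] ind_empty P xz yz xyz(3)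
      by (elim disjE) (auto simp: b_def indep_family_def i2_def insert_Diff_if Un_commute)
  qed simp
  have f: "Mk {i, j, k} b \<in> Sx 2" by (rule Mk_simplex[OF vld]) (use ijk in auto)
  have "restrict_cube (Mk {i, j, k} b) {j, k} = e1 j k q r y2 z2"
    unfolding e1_def by (subst restrict_Mk) (use ijk in \<open>auto intro!: Mk_cong dest!: subset_pair simp: e1_pts_def b_def\<close>)
  moreover have "restrict_cube (Mk {i, j, k} b) {i, k} = e1 i k p r x3 z3"
    unfolding e1_def by (subst restrict_Mk) (use ijk in \<open>auto intro!: Mk_cong dest!: subset_pair simp: e1_pts_def b_def\<close>)
  moreover have "restrict_cube (Mk {i, j, k} b) {i, j} = e1 i j p q x1 y1"
    unfolding e1_def by (subst restrict_Mk) (use ijk in \<open>auto intro!: Mk_cong dest!: subset_pair simp: e1_pts_def b_def\<close>)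
  ultimately have "boundary (frag_of (Mk {i, j, k} b)) = F j k q r y2 z2 - F i k p r x3 z3 + F i j p q x1 y1"
    using boundary_triple[OF supp_Mk ijk] by simp
  then show ?thesis using f unfolding Bd_def chains_def by (intro image_eqI[of _ _ "frag_of (Mk {i, j, k} b)"]) auto
qed

text \<open>The base keeps its own points and \<open>z\<close> is the apex. Its irrational angles
  determine all codes, so the sides may be any independent pairs with the right angles modulo
  1.\<close>

lemma cone:
  assumes ijk: "i < j" "j < k" and G: "p \<in> Gens" "q \<in> Gens" "r \<in> Gens"
    and xyz: "i2 x y" "z \<in> P" "ind (ac z) B (ac x \<union> ac y)" "ang x z \<notin> \<rat>" "ang y z \<notin> \<rat>"
    and e: "i2 y2 z2" "i2 x3 z3" "ang y2 z2 - ang y z \<in> \<int>" "ang x3 z3 - ang x z \<in> \<int>"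
  shows "F i j p q x y - (F i k p r x3 z3 - F j k q r y2 z2) \<in> Bd"
proof -
  have P: "x \<in> P" "y \<in> P" "y2 \<in> P" "z2 \<in> P" "x3 \<in> P" "z3 \<in> P" using e xyz by (auto simp: i2_def)
  have "F j k q r y2 z2 - F i k p r x3 z3 + F i j p q x y \<in> Bd"
    by (rule fill[OF ijk G xyz(1) e(1,2) xyz(1-3)])
      (use cod_eq_if_irrational[OF P(2) xyz(2) P(3,4) _ xyz(5) e(3)] cod_eq_if_irrational[OF P(1) xyz(2) P(5,6) _ xyz(4) e(4)] in auto)
  then show ?thesis by (rule Bd_cong) simp
qed

end

section \<open>Angles of edges and loops\<close>

context circle_homology
begin

definition pts :: "'a meq cube \<Rightarrow> nat set \<Rightarrow> nat \<Rightarrow> 'a" where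
  "pts f = (SOME b. vld (supp f) b \<and> f = Mk (supp f) b)"

text \<open>Read from the smaller to the larger vertex; by \<open>Mk_inject\<close> the choice in
  \<open>pts\<close> does not matter.\<close>

definition dl :: "'a meq cube \<Rightarrow> real" where
  "dl f = ang (pts f (supp f) (Min (supp f))) (pts f (supp f) (Max (supp f)))"

lemma dl_Mk:
  assumes "vld {i, j} b" "i < j" shows "dl (Mk {i, j} b) = ang (b {i, j} i) (b {i, j} j)"
proof -
  let ?f = "Mk {i, j} b"
  have "vld (supp ?f) (pts ?f) \<and> ?f = Mk (supp ?f) (pts ?f)"
    unfolding pts_def by (rule someI[of _ b]) (use assms in simp)
  then have v: "vld {i, j} (pts ?f)" "Mk {i, j} b = Mk {i, j} (pts ?f)" by simp_all
  have "b {i, j} i = pts ?f {i, j} i" "b {i, j} j = pts ?f {i, j} j"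
    using Mk_inject[OF assms(1) v] by auto
  moreover have "Min {i, j} = i" "Max {i, j} = j" using assms(2) by auto
  ultimately show ?thesis by (simp add: dl_def)
qed

lemma dl_e1: "i < j \<Longrightarrow> p \<in> Gens \<Longrightarrow> q \<in> Gens \<Longrightarrow> i2 x y \<Longrightarrow> dl (e1 i j p q x y) = ang x y"
  using dl_Mk[OF vld_e1] by (simp add: e1_def e1_pts_def)

text \<open>The three edges are mapped into the top object without changing types, so their angles
  are those of one triple of points, to which \<open>ang_add\<close> applies.\<close>

lemma two_simplex_boundary:
  assumes f: "f \<in> Sx 2"
  shows "keys (boundary (frag_of f)) \<subseteq> Sx 1"
    and "boundary (boundary (frag_of f)) = 0" and "lin dl (boundary (frag_of f)) \<in> \<int>"
proof -
  obtain b where b: "vld (supp f) b" "f = Mk (supp f) b" using simplex_normal_form[OF f] by blast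
  have "card (supp f) = 3" using f by (simp add: simplices_def)
  then obtain i j k where ijk: "i < j" "j < k" "supp f = {i, j, k}" using card_3_less by blast
  have v: "vld {i, j, k} b" and fM: "f = Mk {i, j, k} b" using b ijk by simp_all
  have ik: "i < k" using ijk by simp
  have sub: "{j, k} \<subseteq> {i, j, k}" "{i, k} \<subseteq> {i, j, k}" "{i, j} \<subseteq> {i, j, k}" by auto
  have bd: "boundary (frag_of f) = frag_of (Mk {j, k} b) - frag_of (Mk {i, k} b) + frag_of (Mk {i, j} b)"
    using boundary_triple[OF ijk(3,1,2)] fM restrict_Mk[OF sub(1), of b] restrict_Mk[OF sub(2), of b] restrict_Mk[OF sub(3), of b] by simp
  note vs = vld_subset[OF v sub(1)] vld_subset[OF v sub(2)] vld_subset[OF v sub(3)]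
  have s1: "Mk {j, k} b \<in> Sx 1" "Mk {i, k} b \<in> Sx 1" "Mk {i, j} b \<in> Sx 1"
    using Mk_simplex[OF vs(1)] Mk_simplex[OF vs(2)] Mk_simplex[OF vs(3)] ijk by auto
  let ?a = "frag_of (Mk {j, k} b)" and ?b = "frag_of (Mk {i, k} b)" and ?c = "frag_of (Mk {i, j} b)"
  have "keys (?a - ?b + ?c) \<subseteq> keys (?a - ?b) \<union> keys ?c"
    by (rule Poly_Mapping.keys_add)
  also have "\<dots> \<subseteq> (keys ?a \<union> keys ?b) \<union> keys ?c"
    using keys_diff[of ?a ?b] by blast
  finally show "keys (boundary (frag_of f)) \<subseteq> Sx 1" unfolding bd using s1 by auto
  have *: "boundary (frag_of (Mk {l, m} b)) = frag_of (Mk {m} b) - frag_of (Mk {l} b)" if "l < m" for l m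
    using boundary_pair[of "Mk {l, m} b" l m] that restrict_Mk[of "{m}" "{l, m}" b] restrict_Mk[of "{l}" "{l, m}" b] by simp
  show "boundary (boundary (frag_of f)) = 0"
    unfolding bd by (simp add: boundary_add boundary_diff * ijk ik)
  have a: "ang (b {j, k} j) (b {j, k} k) = ang (b {i, j, k} j) (b {i, j, k} k)"
    "ang (b {i, k} i) (b {i, k} k) = ang (b {i, j, k} i) (b {i, j, k} k)"
    "ang (b {i, j} i) (b {i, j} j) = ang (b {i, j, k} i) (b {i, j, k} j)"
    using ang_if_cod[OF vld_ctp[OF v sub(1) subset_refl]] ang_if_cod[OF vld_ctp[OF v sub(2) subset_refl]]
      ang_if_cod[OF vld_ctp[OF v sub(3) subset_refl]] by auto
  have P: "b {i, j, k} i \<in> P" "b {i, j, k} j \<in> P" "b {i, j, k} k \<in> P" using vld_P[OF v subset_refl] by auto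
  have "lin dl (boundary (frag_of f)) = ang (b {i, j, k} j) (b {i, j, k} k) - ang (b {i, j, k} i) (b {i, j, k} k)
      + ang (b {i, j, k} i) (b {i, j, k} j)"
    unfolding bd using dl_Mk[OF vs(1) ijk(2)] dl_Mk[OF vs(2) ik] dl_Mk[OF vs(3) ijk(1)] a
    by (simp add: lin_add lin_diff)
  also have "\<dots> = ang (b {i, j, k} i) (b {i, j, k} j) + ang (b {i, j, k} j) (b {i, j, k} k) - ang (b {i, j, k} i) (b {i, j, k} k)"
    by simp
  also have "\<dots> \<in> \<int>" by (rule ang_add[OF P])
  finally show "lin dl (boundary (frag_of f)) \<in> \<int>" .
qed

lemma two_chain_boundary:
  assumes "keys c \<subseteq> Sx 2"
  shows "keys (boundary c) \<subseteq> Sx 1 \<and> boundary (boundary c) = 0 \<and> lin dl (boundary c) \<in> \<int>"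
  using assms
proof (induction c rule: frag_induction)
  case zero then show ?case by simp
next
  case (one x) then show ?case using two_simplex_boundary[of x] by blast
next
  case (diff a b)
  have "keys (boundary a - boundary b) \<subseteq> Sx 1"
    using keys_diff[of "boundary a" "boundary b"] diff by blast
  then show ?case using diff by (simp add: boundary_diff lin_diff)
qed

lemma one_chain_boundary:
  assumes "keys c \<subseteq> Sx 1"
  shows "keys (boundary c) \<subseteq> Sx 0"
  using assms
proof (induction c rule: frag_induction)
  case zero then show ?case by simp
next
  case (one x)
  from e1_exhaust[OF this] obtain i j p q u v where x: "i < j" "p \<in> Gens" "q \<in> Gens" "x = e1 i j p q u v" by metis
  have "keys (boundary (frag_of x)) \<subseteq> {e0 j q} \<union> {e0 i p}"
    unfolding x(4) boundary_e1[OF x(1)] using keys_diff[of "frag_of (e0 j q)" "frag_of (e0 i p)"] by simp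
  then show ?case using e0_simplex x by blast
next
  case (diff a b)
  then show ?case unfolding boundary_diff using keys_diff[of "boundary a" "boundary b"] by blast
qed

text \<open>\<open>loop k r t L\<close>: the cycle \<open>L\<close> consists of two edges with the same ends, the second of which is
  the vertex \<open>r\<close> at \<open>k\<close>, and \<open>t\<close> is the difference of their angles. The class of \<open>L\<close> depends on \<open>t\<close> only.\<close>

definition loop :: "nat \<Rightarrow> 'a \<Rightarrow> real \<Rightarrow> ('a meq cube \<Rightarrow>\<^sub>0 int) \<Rightarrow> bool" where
  "loop k r t L \<longleftrightarrow> (\<exists>i<k. \<exists>p\<in>Gens. \<exists>x y x' y'. i2 x y \<and> i2 x' y' \<and> ang x' y' - ang x y - t \<in> \<int> \<and>
     L = F i k p r x' y' - F i k p r x y)"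

lemma loopI:
  "i < k \<Longrightarrow> p \<in> Gens \<Longrightarrow> i2 x y \<Longrightarrow> i2 x' y' \<Longrightarrow> ang x' y' - ang x y - t \<in> \<int> \<Longrightarrow>
    loop k r t (F i k p r x' y' - F i k p r x y)"
  unfolding loop_def by blast

lemma i2_generic:
  assumes "finite X" "X \<subseteq> P" "x \<in> X" "z \<in> P" "ind (ac z) B (acl M (Home ` X))" shows "i2 x z"
proof -
  have x: "x \<in> P" using assms by blast
  have "ac x \<subseteq> acl M (Home ` X)" by (rule acl_mono) (use assms in auto)
  then have "ind (ac z) B (ac x)" using ind_mono[OF cs_ac[OF assms(4)] cs_B cs_acl[OF cs_Home[OF assms(1,2)]] assms(5)] by blast
  then show ?thesis unfolding i2_def using x assms(4) ind_sym[OF cs_ac[OF assms(4)] cs_B cs_ac[OF x]] by blast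
qed

lemma ind_generic:
  assumes "finite X" "X \<subseteq> P" "x \<in> X" "y \<in> X" "z \<in> P" "ind (ac z) B (acl M (Home ` X))"
  shows "ind (ac z) B (ac x \<union> ac y)"
proof -
  have "ac x \<subseteq> acl M (Home ` X)" by (rule acl_mono) (use assms in auto)
  moreover have "ac y \<subseteq> acl M (Home ` X)" by (rule acl_mono) (use assms in auto)
  ultimately have "ac x \<union> ac y \<subseteq> acl M (Home ` X)" by (rule Un_least)
  then show ?thesis by (rule ind_mono[OF cs_ac[OF assms(5)] cs_B cs_acl[OF cs_Home[OF assms(1,2)]] assms(6) subset_refl])
qed

lemma ints_cong: "a \<in> \<int> \<Longrightarrow> (a :: real) = b \<Longrightarrow> b \<in> \<int>" by simp

text \<open>Both ends of the pair \<open>a\<close>, \<open>z\<close> are turned by the same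
  angle.\<close>

lemma ang_shift:
  assumes "a \<in> P" "a' \<in> P" "z \<in> P" "z' \<in> P" "ang z z' - ang a a' \<in> \<int>"
  shows "ang a' z' - ang a z \<in> \<int>" "ang a z - ang a' z' \<in> \<int>"
proof -
  have "(ang z z' - ang a a') - (ang a z + ang z z' - ang a z') + (ang a a' + ang a' z' - ang a z') \<in> \<int>"
    by (rule Ints_add[OF Ints_diff[OF assms(5) ang_add[OF assms(1,3,4)]] ang_add[OF assms(1,2,4)]])
  then show "ang a' z' - ang a z \<in> \<int>" by (rule ints_cong) simp
  then show "ang a z - ang a' z' \<in> \<int>" by (metis Ints_minus minus_diff_eq)
qed

text \<open>Coning both loops off to a common apex at \<open>k + 1\<close>, whose copies are placed so that the sides match.\<close>

lemma loop_unique: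
  assumes r: "r \<in> Gens" and L: "loop k r t L1" "loop k r t' L2" and tt: "t - t' \<in> \<int>"
  shows "L1 - L2 \<in> Bd"
proof -
  obtain i p x y x' y' where 1: "i < k" "p \<in> Gens" "i2 x y" "i2 x' y'" "ang x' y' - ang x y - t \<in> \<int>"
    "L1 = F i k p r x' y' - F i k p r x y" using L(1) by (auto simp: loop_def)
  obtain i' p' u v u' v' where 2: "i' < k" "p' \<in> Gens" "i2 u v" "i2 u' v'" "ang u' v' - ang u v - t' \<in> \<int>"
    "L2 = F i' k p' r u' v' - F i' k p' r u v" using L(2) by (auto simp: loop_def)
  define X where "X = {x, y, x', y', u, v, u', v'}"
  have X: "finite X" "X \<subseteq> P" using 1 2 by (auto simp: X_def i2_def)
  have XP: "x \<in> P" "y \<in> P" "x' \<in> P" "y' \<in> P" "u \<in> P" "v \<in> P" "u' \<in> P" "v' \<in> P" using X by (auto simp: X_def)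
  have inX: "x \<in> X" "y \<in> X" "x' \<in> X" "y' \<in> X" "u \<in> X" "v \<in> X" "u' \<in> X" "v' \<in> X" by (auto simp: X_def)
  \<comment> \<open>The apexes 0 to 3 belong to the pairs \<open>x y\<close>, \<open>x' y'\<close>,
    \<open>u v\<close>, \<open>u' v'\<close> in this order. The prescribed differences give equal
    angles to the sides at \<open>x\<close> and \<open>x'\<close>, at \<open>y\<close> and
    \<open>v\<close>, and at \<open>u\<close> and \<open>u'\<close>.\<close>
  define \<alpha> where "\<alpha> = (\<lambda>n::nat. if n = 0 then 0 else if n = 1 then ang x x' else if n = 2 then ang y v
    else ang y v + ang u u')"
  obtain e where e: "\<And>j. e j \<in> P" "\<And>j l. ang (e j) (e l) - (\<alpha> l - \<alpha> j) \<in> \<int>"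
    "\<And>j a. j < 4 \<Longrightarrow> a \<in> X \<Longrightarrow> ang a (e j) \<notin> \<rat>" "\<And>j. ind (ac (e j)) B (acl M (Home ` X))"
    using generic_points[OF X, of \<alpha> 4] by metis
  note i2e = i2_generic[OF X _ e(1) e(4)]
  note inde = ind_generic[OF X _ _ e(1) e(4)]
  have ee: "ang (e 0) (e 1) - ang x x' \<in> \<int>" "ang (e 0) (e 2) - ang y v \<in> \<int>" "ang (e 2) (e 3) - ang u u' \<in> \<int>"
    using e(2)[of 0 1] e(2)[of 0 2] e(2)[of 2 3] by (auto simp: \<alpha>_def)
  note a1 = ang_shift[OF XP(1,3) e(1) e(1) ee(1)]
  note a2 = ang_shift[OF XP(2,6) e(1) e(1) ee(2)]
  note a3 = ang_shift[OF XP(5,7) e(1) e(1) ee(3)]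
  \<comment> \<open>The fourth match, of the sides at \<open>y'\<close> and \<open>v'\<close>, is
    not prescribed: it follows since both loops have the same angle modulo 1.\<close>
  have "(ang x' (e 1) - ang x (e 0)) - (ang v (e 2) - ang y (e 0)) - (ang u' (e 3) - ang u (e 2))
      + (ang x' y' + ang y' (e 1) - ang x' (e 1)) - (ang u' v' + ang v' (e 3) - ang u' (e 3))
      + (ang u v + ang v (e 2) - ang u (e 2)) - (ang x y + ang y (e 0) - ang x (e 0))
      - (ang x' y' - ang x y - t) + (ang u' v' - ang u v - t') - (t - t') \<in> \<int>"
    by (rule Ints_diff[OF Ints_add[OF Ints_diff[OF Ints_diff[OF Ints_add[OF Ints_diff[OF Ints_add[OF
      Ints_diff[OF Ints_diff[OF a1(1) a2(1)] a3(1)] ang_add[OF XP(3,4) e(1)]] ang_add[OF XP(7,8) e(1)]]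
      ang_add[OF XP(5,6) e(1)]] ang_add[OF XP(1,2) e(1)]] 1(5)] 2(5)] tt])
  then have a4: "ang y' (e 1) - ang v' (e 3) \<in> \<int>" by (rule ints_cong) simp
  have kk: "k < Suc k" by simp
  have 4: "(0::nat) < 4" "(1::nat) < 4" "(2::nat) < 4" "(3::nat) < 4" by simp_all
  have z: "ang a b - ang a b \<in> \<int>" for a b by simp
  have c1: "F i k p r x y - (F i (Suc k) p r x (e 0) - F k (Suc k) r r y (e 0)) \<in> Bd"
    by (rule cone[OF 1(1) kk 1(2) r r 1(3) e(1) inde[OF inX(1,2)] e(3)[OF 4(1) inX(1)] e(3)[OF 4(1) inX(2)]
        i2e[OF inX(2)] i2e[OF inX(1)] z z])
  have c2: "F i k p r x' y' - (F i (Suc k) p r x (e 0) - F k (Suc k) r r y' (e 1)) \<in> Bd"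
    by (rule cone[OF 1(1) kk 1(2) r r 1(4) e(1) inde[OF inX(3,4)] e(3)[OF 4(2) inX(3)] e(3)[OF 4(2) inX(4)]
        i2e[OF inX(4)] i2e[OF inX(1)] z a1(2)])
  have c3: "F i' k p' r u v - (F i' (Suc k) p' r u (e 2) - F k (Suc k) r r y (e 0)) \<in> Bd"
    by (rule cone[OF 2(1) kk 2(2) r r 2(3) e(1) inde[OF inX(5,6)] e(3)[OF 4(3) inX(5)] e(3)[OF 4(3) inX(6)]
        i2e[OF inX(2)] i2e[OF inX(5)] a2(2) z])
  have c4: "F i' k p' r u' v' - (F i' (Suc k) p' r u (e 2) - F k (Suc k) r r y' (e 1)) \<in> Bd"
    by (rule cone[OF 2(1) kk 2(2) r r 2(4) e(1) inde[OF inX(7,8)] e(3)[OF 4(4) inX(7)] e(3)[OF 4(4) inX(8)]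
        i2e[OF inX(4)] i2e[OF inX(5)] a4 a3(2)])
  \<comment> \<open>All side edges cancel in this combination of the four cones.\<close>
  show ?thesis
    by (rule Bd_cong[OF Bd_add[OF Bd_diff[OF Bd_diff[OF c2 c1] c4] c3]]) (simp add: 1(6) 2(6))
qed

text \<open>Three edges share their ends, and the points at their upper ends have mutual angles
  \<open>s\<close>, \<open>t\<close> and \<open>s + t\<close>; differences of edges
  telescope.\<close>

lemma loop_triple:
  assumes k: "0 < k"
  shows "\<exists>L1 L2. loop k r s L1 \<and> loop k r t L2 \<and> loop k r (s + t) (L1 + L2)"
proof -
  obtain o1 where o1: "o1 \<in> P" using points_ne by blast
  define p where "p = gen (ac o1)"
  have p: "p \<in> Gens" "p \<in> P" using gen_ac[OF o1] Gens_P by (auto simp: p_def)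
  define \<alpha> where "\<alpha> = (\<lambda>n::nat. if n = 0 then 0 else if n = 1 then s else s + t)"
  have X: "finite {p}" "{p} \<subseteq> P" using p by auto
  obtain e where e: "\<And>j. e j \<in> P" "\<And>j l. ang (e j) (e l) - (\<alpha> l - \<alpha> j) \<in> \<int>"
    "\<And>j. ind (ac (e j)) B (acl M (Home ` {p}))"
    using generic_points[OF X, of \<alpha> 0] by metis
  have i2: "i2 p (e j)" for j by (rule i2_generic[OF X _ e(1) e(3)]) simp
  have loop: "loop k r (\<alpha> l - \<alpha> j) (F 0 k p r p (e l) - F 0 k p r p (e j))" for j l
  proof -
    have "(ang (e j) (e l) - (\<alpha> l - \<alpha> j)) - (ang p (e j) + ang (e j) (e l) - ang p (e l)) \<in> \<int>"
      by (intro Ints_diff e(2) ang_add p e(1))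
    then have "ang p (e l) - ang p (e j) - (\<alpha> l - \<alpha> j) \<in> \<int>" by (rule ints_cong) simp
    then show ?thesis by (rule loopI[OF k p(1) i2 i2])
  qed
  show ?thesis using loop[of 1 0] loop[of 2 1] loop[of 2 0]
    by (intro exI[of _ "F 0 k p r p (e 1) - F 0 k p r p (e 0)"] exI[of _ "F 0 k p r p (e 2) - F 0 k p r p (e 1)"])
      (simp add: \<alpha>_def)
qed

section \<open>Classes of loops and coning off a cycle\<close>

definition lam :: "nat \<Rightarrow> 'a \<Rightarrow> real \<Rightarrow> ('a meq cube \<Rightarrow>\<^sub>0 int)" where
  "lam k r t = (SOME L. loop k r t L)"

lemma lam_loop: "0 < k \<Longrightarrow> loop k r t (lam k r t)"
  unfolding lam_def using loop_triple[of k r t t] by (metis someI)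

lemma loop_lam: "0 < k \<Longrightarrow> r \<in> Gens \<Longrightarrow> loop k r t L \<Longrightarrow> t - t' \<in> \<int> \<Longrightarrow> L - lam k r t' \<in> Bd"
  using loop_unique lam_loop by blast

lemma lam_add:
  assumes "0 < k" "r \<in> Gens" shows "lam k r s + lam k r t - lam k r (s + t) \<in> Bd"
proof -
  obtain L1 L2 where L: "loop k r s L1" "loop k r t L2" "loop k r (s + t) (L1 + L2)" using loop_triple[OF assms(1)] by blast
  have "L1 - lam k r s \<in> Bd" "L2 - lam k r t \<in> Bd" "L1 + L2 - lam k r (s + t) \<in> Bd"
    using loop_lam[OF assms L(1)] loop_lam[OF assms L(2)] loop_lam[OF assms L(3)] by auto
  from Bd_diff[OF Bd_diff[OF this(3,1)] this(2)] show ?thesis by (rule Bd_cong) simp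
qed

lemma lam_diff:
  assumes "0 < k" "r \<in> Gens" shows "lam k r (s - t) - (lam k r s - lam k r t) \<in> Bd"
  using lam_add[OF assms, of "s - t" t] by (rule Bd_cong) simp

text \<open>An edge minus itself is the zero chain, and it is a loop of any integer angle.\<close>

lemma lam_int:
  assumes "0 < k" "r \<in> Gens" "t \<in> \<int>" shows "lam k r t \<in> Bd"
proof -
  have "loop k r t (lam k r t)" by (rule lam_loop[OF assms(1)])
  then obtain i p x y where i: "i < k" "p \<in> Gens" "i2 x y" by (auto simp: loop_def)
  have "ang x y - ang x y - t \<in> \<int>" using assms(3) by simp
  from loopI[OF i(1,2,3,3) this] have "loop k r t 0" by simp
  from loop_lam[OF assms(1,2) this, of t] have "- lam k r t \<in> Bd" by simp
  from Bd_minus[OF this] show ?thesis by simp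
qed

text \<open>Joins the 0-simplex \<open>v\<close> to the vertex \<open>r\<close> at \<open>k\<close>
  by a reference edge with fixed points \<open>a\<close>, \<open>c\<close>. Its linear extension is
  the cone operator on 0-chains; the generator of \<open>v\<close> is recovered from its
  object.\<close>

definition edge :: "nat \<Rightarrow> 'a \<Rightarrow> 'a \<Rightarrow> 'a \<Rightarrow> 'a meq cube \<Rightarrow> ('a meq cube \<Rightarrow>\<^sub>0 int)" where
  "edge k r a c v = F (Min (supp v)) k (gen (obj v (supp v))) r a c"

lemma edge_e0: "p \<in> Gens \<Longrightarrow> edge k r a c (e0 i p) = F i k p r a c"
  by (simp add: edge_def e0_def obj_Mk Gens_def)

text \<open>Coning \<open>f\<close> off gives two sides. Each differs from its reference edge by a
  loop, and the angles of these loops differ by the angle of \<open>f\<close> modulo 1. Modulo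
  boundaries, \<open>edge\<close> is thus a contracting homotopy with error
  \<open>lam\<close>.\<close>

lemma simplex_homologous:
  assumes k: "0 < k" "r \<in> Gens" and ac: "i2 a c" and f: "f \<in> Sx 1" "supp f \<subseteq> {..<k}"
  shows "frag_of f - (lam k r (dl f) - frag_extend (edge k r a c) (boundary (frag_of f))) \<in> Bd"
proof -
  from e1_exhaust[OF f(1)] obtain i j p q x y where e: "i < j" "p \<in> Gens" "q \<in> Gens" "i2 x y" "f = e1 i j p q x y"
    "supp f = {i, j}" by metis
  have jk: "j < k" "i < k" using f(2) e(6) by auto
  define X where "X = {x, y}"
  have X: "finite X" "X \<subseteq> P" "x \<in> X" "y \<in> X" using e(4) by (auto simp: X_def i2_def)
  obtain z where z: "z \<in> P" "ang x z \<notin> \<rat>" "ang y z \<notin> \<rat>" "ind (ac z) B (acl M (Home ` X))"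
  proof (rule generic_points[OF X(1,2), of "\<lambda>_. 0" 1])
    fix g :: "nat \<Rightarrow> 'a"
    assume g: "\<And>j. g j \<in> P" "\<And>j x. j < 1 \<Longrightarrow> x \<in> X \<Longrightarrow> ang x (g j) \<notin> \<rat>"
      "\<And>j. ind (ac (g j)) B (acl M (Home ` X))"
    show thesis by (rule that[OF g(1) g(2)[OF zero_less_one X(3)] g(2)[OF zero_less_one X(4)] g(3)])
  qed
  have xz: "i2 x z" "i2 y z" using i2_generic[OF X(1,2) _ z(1,4)] X by auto
  have c: "F i j p q x y - (F i k p r x z - F j k q r y z) \<in> Bd"
    by (rule cone[OF e(1) jk(1) e(2,3) k(2) e(4) z(1) ind_generic[OF X z(1,4)] z(2,3) xz(2,1)]) auto
  have "loop k r (ang x z - ang a c) (F i k p r x z - F i k p r a c)"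
    by (rule loopI[OF jk(2) e(2) ac xz(1)]) simp
  then have l1: "F i k p r x z - F i k p r a c - lam k r (ang x z - ang a c) \<in> Bd" by (rule loop_lam[OF k]) simp
  have "loop k r (ang y z - ang a c) (F j k q r y z - F j k q r a c)"
    by (rule loopI[OF jk(1) e(3) ac xz(2)]) simp
  then have l2: "F j k q r y z - F j k q r a c - lam k r (ang y z - ang a c) \<in> Bd" by (rule loop_lam[OF k]) simp
  have l3: "lam k r ((ang x z - ang a c) - (ang y z - ang a c)) - (lam k r (ang x z - ang a c) - lam k r (ang y z - ang a c)) \<in> Bd"
    by (rule lam_diff[OF k])
  have "ang x y + ang y z - ang x z \<in> \<int>" using ang_add e(4) z(1) by (simp add: i2_def)
  then have "- (ang x y + ang y z - ang x z) \<in> \<int>" by (rule Ints_minus)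
  then have "((ang x z - ang a c) - (ang y z - ang a c)) - ang x y \<in> \<int>" by (rule ints_cong) simp
  from loop_lam[OF k lam_loop[OF k(1)] this]
  have l4: "lam k r ((ang x z - ang a c) - (ang y z - ang a c)) - lam k r (ang x y) \<in> Bd" .
  have b: "boundary (frag_of f) = frag_of (e0 j q) - frag_of (e0 i p)" unfolding e(5) by (rule boundary_e1[OF e(1)])
  have "frag_extend (edge k r a c) (boundary (frag_of f)) = F j k q r a c - F i k p r a c"
    unfolding b by (simp add: frag_extend_diff edge_e0 e)
  moreover have "dl f = ang x y" using dl_e1 e by simp
  ultimately show ?thesis
    using Bd_add[OF Bd_add[OF Bd_diff[OF Bd_add[OF c l1] l2] Bd_minus[OF l3]] l4]
    by (elim Bd_cong) (simp add: e(5))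
qed

lemma chain_homologous:
  assumes k: "0 < k" "r \<in> Gens" and ac: "i2 a c"
    and "keys d \<subseteq> {f \<in> Sx 1. supp f \<subseteq> {..<k}}"
  shows "d - (lam k r (lin dl d) - frag_extend (edge k r a c) (boundary d)) \<in> Bd"
  using assms(4)
proof (induction d rule: frag_induction)
  case zero
  show ?case using Bd_minus[OF lam_int[OF k, of 0]] by simp
next
  case (one f)
  then show ?case using simplex_homologous[OF k ac, of f] by simp
next
  case (diff d d')
  from Bd_diff[OF Bd_diff[OF diff] lam_diff[OF k, of "lin dl d" "lin dl d'"]] show ?case
    by (rule Bd_cong) (simp add: lin_diff boundary_diff frag_extend_diff)
qed

lemma cycle_is_boundary:
  assumes d: "keys d \<subseteq> Sx 1" "boundary d = 0" "lin dl d \<in> \<int>"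
  shows "d \<in> Bd"
proof -
  have "finite (\<Union>f\<in>keys d. supp f)" using d(1) by (auto simp: simplices_def)
  then obtain n where n: "(\<Union>f\<in>keys d. supp f) \<subseteq> {..<n}" using finite_nat_bounded by blast
  \<comment> \<open>Above all vertex indices of \<open>d\<close>, so that \<open>k\<close> can be
    the last vertex of every cone; the successor makes it positive, as loops require.\<close>
  define k where "k = Suc n"
  have keys: "keys d \<subseteq> {f \<in> Sx 1. supp f \<subseteq> {..<k}}"
    using d(1) n by (auto simp: k_def subset_eq less_Suc_eq)
  have k: "0 < k" by (simp add: k_def)
  obtain o1 where o1: "o1 \<in> P" using points_ne by blast
  have r: "gen (ac o1) \<in> Gens" using gen_ac[OF o1] by simp
  obtain a c where ac: "i2 a c" using lam_loop[OF k] unfolding loop_def by blast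
  have "d - lam k (gen (ac o1)) (lin dl d) \<in> Bd" using chain_homologous[OF k r ac keys] d(2) by simp
  from Bd_add[OF this lam_int[OF k r d(3)]] show ?thesis by simp
qed

lemma cycle_exists:
  "\<exists>d. keys d \<subseteq> Sx 1 \<and> boundary d = 0 \<and> lin dl d - t \<in> \<int>"
proof -
  obtain o1 where o1: "o1 \<in> P" using points_ne by blast
  define r where "r = gen (ac o1)"
  have r: "r \<in> Gens" using gen_ac[OF o1] by (simp add: r_def)
  have "loop 1 r t (lam 1 r t)" by (rule lam_loop) simp
  then obtain i p x y x' y' where 1: "i < (1::nat)" "p \<in> Gens" "i2 x y" "i2 x' y'" "ang x' y' - ang x y - t \<in> \<int>"
    unfolding loop_def by blast
  let ?d = "F i 1 p r x' y' - F i 1 p r x y"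
  have "keys ?d \<subseteq> {e1 i 1 p r x' y'} \<union> {e1 i 1 p r x y}"
    using keys_diff[of "F i 1 p r x' y'" "F i 1 p r x y"] by simp
  then have "keys ?d \<subseteq> Sx 1"
    using e1_simplex[OF 1(1,2) r 1(4)] e1_simplex[OF 1(1,2) r 1(3)] by blast
  moreover have "boundary ?d = 0" unfolding boundary_diff boundary_e1[OF 1(1)] by (rule diff_self)
  moreover have "lin dl ?d - t \<in> \<int>"
    unfolding lin_diff lin_of dl_e1[OF 1(1,2) r 1(4)] dl_e1[OF 1(1,2) r 1(3)] by (rule 1(5))
  ultimately show ?thesis by blast
qed

section \<open>The isomorphism given by the total angle\<close>

lemma H1_iso: "H1 M ind p0 \<cong> (real_add_group Mod \<int>)"
proof -
  let ?C = "\<lambda>n. chains M ind p0 n"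
  let ?K = "kernel (?C 1) (?C 0) boundary"
  let ?G = "subgroup_generated (?C 1) ?K"
  have grpC: "group (?C n)" for n by (simp add: chains_def)
  have hom: "boundary \<in> hom (?C 1) (?C 0)"
    using one_chain_boundary by (auto simp: hom_def chains_def boundary_add)
  interpret bh: group_hom "?C 1" "?C 0" boundary
    using grpC hom by (simp add: group_hom_def group_hom_axioms_def)
  have K: "subgroup ?K (?C 1)" by (rule bh.subgroup_kernel)
  have carG: "carrier ?G = ?K" by (rule subgroup.carrier_subgroup_generated_subgroup[OF K])
  have Kiff: "d \<in> ?K \<longleftrightarrow> keys d \<subseteq> Sx 1 \<and> boundary d = 0" for d
    by (simp add: kernel_def chains_def)
  have grpG: "group ?G" by (rule bh.G.group_subgroup_generated)
  have grpR: "comm_group real_add_group"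
    by (rule comm_groupI) (auto simp: real_add_group_def intro: exI[of _ "- x" for x] left_minus)
  then interpret R: comm_group real_add_group .
  have ZR: "subgroup \<int> real_add_group"
  proof (rule R.subgroupI)
    fix a :: real assume a: "a \<in> \<int>"
    have "inv\<^bsub>real_add_group\<^esub> a = - a" by (rule R.inv_equality) (auto simp: real_add_group_def)
    then show "inv\<^bsub>real_add_group\<^esub> a \<in> \<int>" using a by simp
  qed (auto simp: real_add_group_def)
  interpret Z: normal "\<int>" real_add_group by (rule R.subgroup_imp_normal[OF ZR])
  \<comment> \<open>The total angle of a cycle modulo 1. It is onto with kernel \<open>Bd\<close>,
    and the first isomorphism theorem concludes.\<close>
  let ?h = "\<lambda>d. \<int> #>\<^bsub>real_add_group\<^esub> (lin dl d)"
  have "lin dl \<in> hom ?G real_add_group"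
    by (auto simp: hom_def real_add_group_def chains_def lin_add)
  then have hh: "?h \<in> hom ?G (real_add_group Mod \<int>)"
    using hom_compose[of "lin dl" ?G real_add_group _ "real_add_group Mod \<int>"] Z.r_coset_hom_Mod
    by (simp add: comp_def)
  interpret h: group_hom ?G "real_add_group Mod \<int>" ?h
    using grpG hh Z.factorgroup_is_group by (simp add: group_hom_def group_hom_axioms_def)
  have coset: "\<int> #>\<^bsub>real_add_group\<^esub> t = \<int> #>\<^bsub>real_add_group\<^esub> s" if "s - t \<in> \<int>" for s t
  proof (rule R.repr_independence[OF _ _ ZR])
    show "s \<in> \<int> #>\<^bsub>real_add_group\<^esub> t" using that by (auto simp: r_coset_def real_add_group_def intro!: bexI[of _ "s - t"])
  qed (simp add: real_add_group_def)
  have "?h ` carrier ?G = carrier (real_add_group Mod \<int>)"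
  proof
    show "?h ` carrier ?G \<subseteq> carrier (real_add_group Mod \<int>)" using h.hom_closed by blast
    show "carrier (real_add_group Mod \<int>) \<subseteq> ?h ` carrier ?G"
    proof
      fix X assume "X \<in> carrier (real_add_group Mod \<int>)"
      then obtain t where t: "X = \<int> #>\<^bsub>real_add_group\<^esub> t" by (auto simp: FactGroup_def RCOSETS_def)
      obtain d where d: "keys d \<subseteq> Sx 1" "boundary d = 0" "lin dl d - t \<in> \<int>"
        using cycle_exists by blast
      then have "d \<in> ?K" unfolding Kiff by blast
      moreover have "X = ?h d" unfolding t by (rule coset[OF d(3)])
      ultimately show "X \<in> ?h ` carrier ?G" unfolding carG by blast
    qed
  qed
  \<comment> \<open>A cycle of integer angle bounds by coning; conversely, additivity of angles on
    triangles makes the angle of a boundary an integer.\<close>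
  moreover have "kernel ?G (real_add_group Mod \<int>) ?h = Bd"
  proof
    show "kernel ?G (real_add_group Mod \<int>) ?h \<subseteq> Bd"
    proof
      fix d assume "d \<in> kernel ?G (real_add_group Mod \<int>) ?h"
      then have d: "d \<in> ?K" "?h d = \<int>" unfolding kernel_def[of ?G] carG by (auto simp: FactGroup_def)
      then have "lin dl d \<in> \<int>" using R.coset_join1[OF d(2) _ ZR] by (simp add: real_add_group_def)
      then show "d \<in> Bd" using cycle_is_boundary d(1) Kiff by blast
    qed
    show "Bd \<subseteq> kernel ?G (real_add_group Mod \<int>) ?h"
    proof
      fix d assume "d \<in> Bd"
      then obtain c where "keys c \<subseteq> Sx 2" "d = boundary c" by (auto simp: Bd_def chains_def)
      then have "d \<in> ?K" "lin dl d \<in> \<int>" using two_chain_boundary[of c] Kiff by auto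
      moreover from this have "?h d = \<int>" using R.coset_join2[OF _ ZR] by (simp add: real_add_group_def)
      ultimately show "d \<in> kernel ?G (real_add_group Mod \<int>) ?h"
        unfolding kernel_def[of ?G] carG by (auto simp: FactGroup_def)
    qed
  qed
  ultimately show ?thesis using h.FactGroup_iso by (simp add: H1_def Bd_def)
qed

end

theorem theorem5p10:
  fixes M :: "'a circ_struct"
    and ind :: "'a meq set \<Rightarrow> 'a meq set \<Rightarrow> 'a meq set \<Rightarrow> bool"
  assumes "is_model M (theory_of unit_circle)"
    and "saturated M"
    and "indep_relation M ind"
  shows "H1 M ind p0 \<cong> (real_add_group Mod \<int>)"
proof -
  interpret circle_homology M ind
    using assms by (simp add: circle_homology_def sat_circle_def sat_circle_axioms_def circle_model_def)
  show ?thesis by (rule H1_iso)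
qed

end
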